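(* Let $R$ be an aperiodic vertically unbounded two-step rule, let $x\in(0,\infty)$ and take $0<y<\tau(x)$. Then the vertical drift $\delta_{\mathbf y}(x,y)$ is negative. For each step direction $\theta$, the dominant singularity of the half-plane generating function $H_\theta(t;x,y)$ (as a function of $t$) is a square-root singularity at $t=\kappa(x)$. Near $t=\kappa(x)$, $$H_\theta(t;x,y)\underset{t\to\kappa(x)}{\sim}c^*(x,y)+c^-(x,y)\sqrt{1-t/\kappa(x)},$$ where $c^*(x,y)$ is constant with respect to $t$ and $$\begin{aligned}c^-(x,y)=&\sqrt{\frac{2}{\kappa(x)\,\mu^{(0,2)}(x,\tau(x))}}\cdot\frac{D_\theta(\kappa(x);x,y)}{D_\theta(\kappa(x);x,\tau(x))}\cdot\frac{1}{1-B_\theta(\kappa(x);x,y)}\\&\times\left(C_\theta^{(0,0,1)}(\kappa(x);x,\tau(x))-D_\theta^{(0,0,1)}(\kappa(x);x,\tau(x))\,\frac{C_\theta(\kappa(x);x,\tau(x))}{D_\theta(\kappa(x);x,\tau(x))}\right).\end{aligned}$$ Consequently $$\Theta_m^+(x,y)\sim-\frac{c^-(x,y)}{2\sqrt{\pi}\,m^{3/2}}\,\lambda(x)^m\qquad\text{as }m\to\infty,$$ where $\lambda(x)=1/\kappa(x)$.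
   Context: Steps on $\mathbb Z^2$: east $(1,0)$, north $(0,1)$, west $(-1,0)$, south $(0,-1)$, abbreviated $e,n,w,s$. A two-step rule is a map $R:\{e,n,w,s\}^2\to\{0,1\}$; $R(i,j)=1$ means a step of type $i$ may be immediately followed by one of type $j$. Its transfer matrix is $T=(R(i,j))_{i,j}$. The rule is aperiodic if there is $k\ge1$ with $(T^k)_{ij}>0$ for all $i,j$. A rule is north-bound if there is always a north step between each pair of south steps, south-bound if there is always a south step between each pair of north steps, and vertically unbounded if it is neither. A walk obeying $R$ is a nonempty finite sequence of steps, starting at the origin, with arbitrary first step and with $R(i,j)=1$ for each consecutive pair $(i,j)$. The generating function of a class of walks is $\sum t^m x^a y^b$ over walks in the class, where $m$ is the length and $(a,b)$ the endpoint. $B_\theta$: full-plane walks obeying $R$ whose first step $j$ satisfies $R(\theta,j)=1$, containing exactly one $\theta$ step, which is their last step. $C_\theta$ (resp. $D_\theta$): full-plane walks obeying $R$ which do not (resp. do) start with a south step and contain exactly one $\theta$ step, which is their last step. $B_\theta,C_\theta,D_\theta$ are regarded as rational functions of $t,x,y$; a superscript $(i,j,k)$ denotes the partial derivative taken $i$ times in $t$, $j$ in $x$, $k$ in $y$. $H_\theta(t;x,y)=\sum_m\Theta^+_m(x,y)t^m$: walks obeying $R$, starting at the origin, staying in $\{(a,b):b\ge0\}$, with last step $\theta$. For $x,y\in(0,\infty)$, $\rho(x,y)$ is the smallest positive $t$ with $B_\theta(t;x,y)=1$ (it exists and is independent of $\theta$), $\mu(x,y)=1/\rho(x,y)$, and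 $\mu^{(0,2)}$ is its second partial derivative in $y$. The vertical drift is $\delta_{\mathbf y}(x,y)=\frac{B_\theta^{(0,0,1)}(\rho;x,y)}{\rho B_\theta^{(1,0,0)}(\rho;x,y)}=\frac{\partial}{\partial y}\log\mu(x,y)$, with $\rho=\rho(x,y)$. For fixed $x$, $\rho(x,\cdot)$ is increasing and then decreasing on $(0,\infty)$; $\tau(x)$ is the unique point where $\partial\rho/\partial y=0$, and $\kappa(x)=\rho(x,\tau(x))$. A dominant singularity is a singularity closest to $t=0$. The two-term relation $\sim$ near $t=\kappa(x)$ means the leading terms of the singular expansion (error $o(\sqrt{1-t/\kappa(x)})$).
   Formalization: Uniqueness of the dominant singularity and the asymptotics of Θ_m^+ are proved only if cycle (length, height) vectors generate Z^2; else they fail, e.g. allowed pairs nn,ns,ne,sn,ss,ew,wn,ws, singular also at -κ. D_θ/(1-B_θ) is evaluated as one rational function, covering common poles. *)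

theory Defs
  imports "HOL-Complex_Analysis.Complex_Analysis" "HOL-Library.Landau_Symbols"
begin


datatype step = East | North | West | South

instance step :: finite
proof
  have "(UNIV :: step set) = {East, North, West, South}"
    using step.exhaust by blast
  then show "finite (UNIV :: step set)"
    by (metis finite.emptyI finite.insertI)
qed

fun dx :: "step \<Rightarrow> int" where
  "dx East = 1" | "dx West = -1" | "dx North = 0" | "dx South = 0"

fun dy :: "step \<Rightarrow> int" where
  "dy North = 1" | "dy South = -1" | "dy East = 0" | "dy West = 0"

type_synonym rule = "step \<Rightarrow> step \<Rightarrow> bool"

definition transfer_matrix :: "rule \<Rightarrow> real ^ step ^ step" where
  "transfer_matrix R = (\<chi> i j. of_bool (R i j))"

text \<open>The matrix power is an iterated matrix product, because \<open>^\<close> and \<open>*\<close> on \<open>real ^ step ^ step\<close>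
  act entrywise.\<close>

definition aperiodic :: "rule \<Rightarrow> bool" where
  "aperiodic R \<longleftrightarrow>
     (\<exists>k\<ge>1. \<forall>i j. ((\<lambda>M. transfer_matrix R ** M) ^^ k) (mat 1) $ i $ j > 0)"

definition walks :: "rule \<Rightarrow> step list set" where
  "walks R = {w. w \<noteq> [] \<and> successively R w}"

definition north_bound :: "rule \<Rightarrow> bool" where
  "north_bound R \<longleftrightarrow> (\<forall>w\<in>walks R. \<forall>i j. i < j \<and> j < length w \<and> w ! i = South \<and> w ! j = South \<longrightarrow>
      (\<exists>k. i < k \<and> k < j \<and> w ! k = North))"

definition south_bound :: "rule \<Rightarrow> bool" where
  "south_bound R \<longleftrightarrow> (\<forall>w\<in>walks R. \<forall>i j. i < j \<and> j < length w \<and> w ! i = North \<and> w ! j = North \<longrightarrow>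
      (\<exists>k. i < k \<and> k < j \<and> w ! k = South))"

definition vertically_unbounded :: "rule \<Rightarrow> bool" where
  "vertically_unbounded R \<longleftrightarrow> \<not> north_bound R \<and> \<not> south_bound R"

definition end_x :: "step list \<Rightarrow> int" where
  "end_x w = (\<Sum>s\<leftarrow>w. dx s)"

definition end_y :: "step list \<Rightarrow> int" where
  "end_y w = (\<Sum>s\<leftarrow>w. dy s)"

text \<open>Joint aperiodicity in length and height: for some \<open>k\<close>, every step type can be followed after
  exactly \<open>k\<close> further steps of total height 0 by every other one.  Equivalently, the vectors
  (length, height) of the closed cycles of \<open>R\<close> generate the whole lattice of integer pairs.  It
  implies \<open>aperiodic\<close> but is not implied by it: for the rule allowing exactly
  \<open>nn, ns, ne, sn, ss, ew, wn, ws\<close>, which is aperiodic and vertically unbounded, every closed cycle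
  has length congruent to its height modulo 2.  Then \<open>-\<kappa>\<close> is a singularity of the half-plane
  generating function just as \<open>\<kappa>\<close> is, and its coefficients have different asymptotics along
  even and odd lengths.\<close>

definition height_aperiodic :: "rule \<Rightarrow> bool" where
  "height_aperiodic R \<longleftrightarrow>
     (\<exists>k\<ge>1. \<forall>i j. \<exists>w. length w = k \<and> last w = j \<and> successively R (i # w) \<and> end_y w = 0)"

text \<open>For fixed \<open>x\<close> and \<open>y\<close>, the generating function of a class of walks as a power series in the
  length variable \<open>t\<close>.\<close>

definition walk_gf :: "step list set \<Rightarrow> real \<Rightarrow> real \<Rightarrow> real fps" where
  "walk_gf A x y =
     Abs_fps (\<lambda>m. \<Sum>w\<in>{w \<in> A. length w = m}. x powi end_x w * y powi end_y w)"

definition ends_at_first :: "step \<Rightarrow> step list \<Rightarrow> bool" where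
  "ends_at_first \<theta> w \<longleftrightarrow> w \<noteq> [] \<and> last w = \<theta> \<and> \<theta> \<notin> set (butlast w)"

definition B_walks :: "rule \<Rightarrow> step \<Rightarrow> step list set" where
  "B_walks R \<theta> = {w \<in> walks R. ends_at_first \<theta> w \<and> R \<theta> (hd w)}"

definition C_walks :: "rule \<Rightarrow> step \<Rightarrow> step list set" where
  "C_walks R \<theta> = {w \<in> walks R. ends_at_first \<theta> w \<and> hd w \<noteq> South}"

definition D_walks :: "rule \<Rightarrow> step \<Rightarrow> step list set" where
  "D_walks R \<theta> = {w \<in> walks R. ends_at_first \<theta> w \<and> hd w = South}"

text \<open>The value at \<open>t\<close> of the rational function whose Taylor expansion at 0 is \<open>F\<close>, also where the
  series \<open>F\<close> diverges: the quotient of the values of numerator and denominator in lowest terms.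
  At a pole the value is 0 by the convention for division.\<close>

definition rat_eval :: "real fps \<Rightarrow> real \<Rightarrow> real" where
  "rat_eval F t = (THE v. \<exists>p q. q \<noteq> 0 \<and> coprime p q \<and>
     F * fps_of_poly q = fps_of_poly p \<and> v = poly p t / poly q t)"

definition B_fun :: "rule \<Rightarrow> step \<Rightarrow> real \<Rightarrow> real \<Rightarrow> real \<Rightarrow> real" where
  "B_fun R \<theta> t x y = rat_eval (walk_gf (B_walks R \<theta>) x y) t"

definition C_fun :: "rule \<Rightarrow> step \<Rightarrow> real \<Rightarrow> real \<Rightarrow> real \<Rightarrow> real" where
  "C_fun R \<theta> t x y = rat_eval (walk_gf (C_walks R \<theta>) x y) t"

definition D_fun :: "rule \<Rightarrow> step \<Rightarrow> real \<Rightarrow> real \<Rightarrow> real \<Rightarrow> real" where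
  "D_fun R \<theta> t x y = rat_eval (walk_gf (D_walks R \<theta>) x y) t"

text \<open>The rational function \<open>D / (1 - B)\<close> in \<open>t\<close>.  The division takes place before evaluation: where
  \<open>B\<close> and \<open>D\<close> have no pole this is the quotient of their values, but at \<open>t = \<kappa>\<close> they can have a
  common pole for some \<open>y < \<tau>\<close>, at which the quotient itself is regular.\<close>

definition D_over_one_minus_B :: "rule \<Rightarrow> step \<Rightarrow> real \<Rightarrow> real \<Rightarrow> real \<Rightarrow> real" where
  "D_over_one_minus_B R \<theta> t x y =
     rat_eval (walk_gf (D_walks R \<theta>) x y / (1 - walk_gf (B_walks R \<theta>) x y)) t"

definition rho :: "rule \<Rightarrow> real \<Rightarrow> real \<Rightarrow> real" where
  "rho R x y = (THE r. \<forall>\<theta>. 0 < r \<and> B_fun R \<theta> r x y = 1 \<and>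
     (\<forall>t. 0 < t \<and> t < r \<longrightarrow> B_fun R \<theta> t x y \<noteq> 1))"

definition mu :: "rule \<Rightarrow> real \<Rightarrow> real \<Rightarrow> real" where
  "mu R x y = 1 / rho R x y"

definition drift_y :: "rule \<Rightarrow> step \<Rightarrow> real \<Rightarrow> real \<Rightarrow> real" where
  "drift_y R \<theta> x y =
     deriv (\<lambda>v. B_fun R \<theta> (rho R x y) x v) y /
     (rho R x y * deriv (\<lambda>t. B_fun R \<theta> t x y) (rho R x y))"

definition tau :: "rule \<Rightarrow> real \<Rightarrow> real" where
  "tau R x = (THE y. 0 < y \<and> ((\<lambda>v. rho R x v) has_real_derivative 0) (at y))"

definition kappa :: "rule \<Rightarrow> real \<Rightarrow> real" where
  "kappa R x = rho R x (tau R x)"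

definition half_plane_walks :: "rule \<Rightarrow> step \<Rightarrow> step list set" where
  "half_plane_walks R \<theta> =
     {w \<in> walks R. last w = \<theta> \<and> (\<forall>k\<le>length w. 0 \<le> end_y (take k w))}"

definition Theta_plus :: "rule \<Rightarrow> step \<Rightarrow> real \<Rightarrow> real \<Rightarrow> nat \<Rightarrow> real" where
  "Theta_plus R \<theta> x y m = fps_nth (walk_gf (half_plane_walks R \<theta>) x y) m"

definition H_gf :: "rule \<Rightarrow> step \<Rightarrow> real \<Rightarrow> real \<Rightarrow> complex fps" where
  "H_gf R \<theta> x y = Abs_fps (\<lambda>m. complex_of_real (Theta_plus R \<theta> x y m))"

definition c_minus :: "rule \<Rightarrow> step \<Rightarrow> real \<Rightarrow> real \<Rightarrow> real" where
  "c_minus R \<theta> x y = (let \<kappa> = kappa R x; \<tau> = tau R x in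
     sqrt (2 / (\<kappa> * (deriv ^^ 2) (\<lambda>v. mu R x v) \<tau>))
     * (D_over_one_minus_B R \<theta> \<kappa> x y / D_fun R \<theta> \<kappa> x \<tau>)
     * (deriv (\<lambda>v. C_fun R \<theta> \<kappa> x v) \<tau>
        - deriv (\<lambda>v. D_fun R \<theta> \<kappa> x v) \<tau> * (C_fun R \<theta> \<kappa> x \<tau> / D_fun R \<theta> \<kappa> x \<tau>)))"

text \<open>The singularities closest to 0 of the analytic function defined by a power series are the
  points on its circle of convergence to which it has no analytic continuation.\<close>

definition dominant_singularity :: "complex fps \<Rightarrow> complex \<Rightarrow> bool" where
  "dominant_singularity F z \<longleftrightarrow> fps_conv_radius F = ereal (norm z) \<and>
     \<not> (\<exists>g \<epsilon>. \<epsilon> > 0 \<and> g holomorphic_on ball z \<epsilon> \<and>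
          (\<forall>t \<in> ball z \<epsilon> \<inter> ball 0 (norm z). eval_fps F t = g t))"

text \<open>For \<open>t\<close> in the disc of convergence, \<open>1 - t / z\<close> has positive real part, so that \<open>csqrt\<close> is
  applied away from its branch cut.\<close>

definition sqrt_singularity :: "complex fps \<Rightarrow> complex \<Rightarrow> bool" where
  "sqrt_singularity F z \<longleftrightarrow>
     (\<exists>g h \<epsilon>. \<epsilon> > 0 \<and> g holomorphic_on ball z \<epsilon> \<and> h holomorphic_on ball z \<epsilon> \<and> h z \<noteq> 0 \<and>
        (\<forall>t \<in> ball z \<epsilon> \<inter> ball 0 (norm z). eval_fps F t = g t + h t * csqrt (1 - t / z)))"

end

theory Submission
  imports Defs "HOL-Computational_Algebra.Field_as_Ring"
    "HOL-Computational_Algebra.Polynomial_Factorial" "HOL-Real_Asymp.Real_Asymp"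
begin

text \<open>Cutting walks at their South steps, and the pieces at their North steps, expresses everything
  through the series \<open>A\<close>, \<open>N\<close> and \<open>G\<close> of walks with horizontal steps between a South-South pair, a
  North-North pair, and both mixed pairs.  Full-plane walks are then governed by the quadratic kernel
  \<open>N y\<^sup>2 - (1 + A N - G) y + A\<close>, whose double root gives \<open>\<kappa>\<close> and \<open>\<tau> = sqrt (A / N)\<close>.

  The half-plane series differs from a full-plane series by one unknown series in \<open>t\<close>, that of the
  walks ending at height 0.  The kernel method determines it, and after cancelling the vanishing
  factor the half-plane series is an explicit function of \<open>csqrt (1 - V)\<close> with
  \<open>V = 4 A G N / (1 - G - A N)\<^sup>2\<close>.  Nonnegativity of the coefficients gives \<open>\<bar>V\<bar> \<le> 1\<close> for
  \<open>\<bar>t\<bar> \<le> \<kappa>\<close> and keeps all denominators away from 0, so that the only possible boundary singularities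
  are the points with \<open>V = 1\<close>.  There all series have maximal modulus, and the phases of \<open>t\<close> along
  closed walks depend on the height alone, which height aperiodicity excludes unless \<open>t = \<kappa>\<close>.

  For the coefficients, subtracting the terms \<open>(1 - t / \<kappa>)^(1/2)\<close> and \<open>(1 - t / \<kappa>)^(3/2)\<close> leaves a
  function with bounded second derivative on the disc, whose coefficients are
  \<open>O(m\<^sup>-\<^sup>2 \<kappa>^(-m))\<close> by Cauchy's estimate.\<close>

section \<open>Power series with nonnegative coefficients\<close>

text \<open>For \<open>0 < y < \<tau>\<close> the point \<open>\<kappa>\<close> lies beyond
  \<open>\<rho>(y)\<close>: the return series to South exceeds 1 there, so
  \<open>D / (1 - B)\<close> has to be read as a rational function beyond its radius. This is why
  values of rational series are treated separately and why all identities are written as products of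
  series that converge past \<open>\<kappa>\<close>. The half-plane series itself reaches
  \<open>\<kappa>\<close>, since its heights are nonnegative and the value at
  \<open>y = \<tau>\<close> dominates.

  The variable \<open>zeta = y / (1 - y N)\<close> replaces \<open>y\<close>: in it the unknown
  enters linearly and the kernel reads \<open>G N Z^2 - (1 - G - A N) Z + A\<close>, with the
  discriminant unchanged. Dividing that discriminant by the square of \<open>1 - G - A N\<close>
  gives \<open>1 - V\<close>. Its values stay in the right half-plane, so the principal root is the
  correct branch on the whole disc.

  A second obstacle is that \<open>A\<close>, \<open>N\<close>, \<open>G\<close> may diverge at a
  finite point; \<open>\<kappa>\<close> must be found strictly inside their common domain, or else
  the expansion at \<open>\<kappa>\<close> has no analytic ingredients.\<close>

definition nonneg_coeffs :: "real fps \<Rightarrow> bool" where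
  "nonneg_coeffs F \<longleftrightarrow> (\<forall>n. 0 \<le> fps_nth F n)"

text \<open>The inequality is strict, so a series that satisfies it converges on the closed disc of
  radius \<open>t\<close> and slightly beyond. Continuity and derivatives at \<open>t\<close> itself
  are then available.\<close>

definition conv_at :: "'a :: {banach, real_normed_div_algebra} fps \<Rightarrow> real \<Rightarrow> bool" where
  "conv_at F t \<longleftrightarrow> ereal t < fps_conv_radius F"

text \<open>Positivity and monotonicity are statements about real series, singularities about
  complex functions; this embedding connects the two.\<close>

definition cfps :: "real fps \<Rightarrow> complex fps" where
  "cfps F = Abs_fps (\<lambda>n. of_real (fps_nth F n))"

lemma cfps_nth [simp]: "fps_nth (cfps F) n = of_real (fps_nth F n)"
  by (simp add: cfps_def)

lemma cfps_add: "cfps (F + G) = cfps F + cfps G"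
  and cfps_diff: "cfps (F - G) = cfps F - cfps G"
  and cfps_mult: "cfps (F * G) = cfps F * cfps G"
  and cfps_const: "cfps (fps_const a) = fps_const (of_real a)"
  and cfps_X: "cfps fps_X = fps_X"
  and cfps_1: "cfps 1 = 1"
  by (simp_all add: fps_eq_iff fps_mult_nth)

lemma conv_radius_cfps [simp]: "fps_conv_radius (cfps F) = fps_conv_radius F"
proof -
  have "Abs_fps (\<lambda>n. norm (fps_nth (cfps F) n)) = Abs_fps (\<lambda>n. norm (fps_nth F n))"
    by simp
  then show ?thesis
    by (metis fps_conv_radius_def fps_conv_radius_norm)
qed

lemma conv_at_cfps [simp]: "conv_at (cfps F) t \<longleftrightarrow> conv_at F t"
  by (simp add: conv_at_def)

lemma conv_at_mono: "conv_at F t \<Longrightarrow> s \<le> t \<Longrightarrow> conv_at F s"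
  unfolding conv_at_def by (meson ereal_less_eq(3) le_less_trans)

lemma conv_at_simps [simp, intro]:
  "conv_at (fps_const a) t" "conv_at fps_X t" "conv_at 1 t" "conv_at 0 t"
  by (simp_all add: conv_at_def)

lemma conv_at_add [intro]: "conv_at F t \<Longrightarrow> conv_at G t \<Longrightarrow> conv_at (F + G) t"
  unfolding conv_at_def by (rule less_le_trans [OF _ fps_conv_radius_add]) simp

lemma conv_at_diff [intro]: "conv_at F t \<Longrightarrow> conv_at G t \<Longrightarrow> conv_at (F - G) t"
  unfolding conv_at_def by (rule less_le_trans [OF _ fps_conv_radius_diff]) simp

lemma conv_at_mult [intro]:
  fixes F :: "'a :: {banach, real_normed_field} fps"
  shows "conv_at F t \<Longrightarrow> conv_at G t \<Longrightarrow> conv_at (F * G) t"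
  unfolding conv_at_def by (rule less_le_trans [OF _ fps_conv_radius_mult]) simp

lemma conv_at_sum [intro]:
  "(\<And>i. i \<in> I \<Longrightarrow> conv_at (F i) t) \<Longrightarrow> conv_at (\<Sum>i\<in>I. F i) t"
  by (induction I rule: infinite_finite_induct) (simp_all add: conv_at_add)

lemma conv_at_norm: "conv_at F t \<Longrightarrow> norm z \<le> t \<Longrightarrow> ereal (norm z) < fps_conv_radius F"
  unfolding conv_at_def using ereal_less_eq(3) le_less_trans by blast

lemma ev_add: "conv_at F t \<Longrightarrow> conv_at G t \<Longrightarrow> norm z \<le> t \<Longrightarrow>
    eval_fps (F + G) z = eval_fps F z + eval_fps G z"
  by (rule eval_fps_add) (rule conv_at_norm, assumption+)+

lemma ev_diff: "conv_at F t \<Longrightarrow> conv_at G t \<Longrightarrow> norm z \<le> t \<Longrightarrow>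
    eval_fps (F - G) z = eval_fps F z - eval_fps G z"
  by (rule eval_fps_diff) (rule conv_at_norm, assumption+)+

lemma ev_mult:
  fixes F :: "'a :: {banach, real_normed_field} fps"
  shows "conv_at F t \<Longrightarrow> conv_at G t \<Longrightarrow> norm z \<le> t \<Longrightarrow>
    eval_fps (F * G) z = eval_fps F z * eval_fps G z"
  by (rule eval_fps_mult) (rule conv_at_norm, assumption+)+

lemma eval_cfps_real:
  assumes "conv_at F \<bar>t\<bar>"
  shows "eval_fps (cfps F) (of_real t) = of_real (eval_fps F t)"
proof -
  have "(\<lambda>n. fps_nth F n * t ^ n) sums eval_fps F t"
    using assms by (intro sums_eval_fps) (simp add: conv_at_def)
  then have "(\<lambda>n. of_real (fps_nth F n * t ^ n) :: complex) sums of_real (eval_fps F t)"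
    by (rule sums_of_real)
  then show ?thesis
    by (simp add: eval_fps_def sums_iff)
qed

lemma nonneg_coeffs_simps [simp, intro]:
  "0 \<le> a \<Longrightarrow> nonneg_coeffs (fps_const a)" "nonneg_coeffs fps_X" "nonneg_coeffs 1" "nonneg_coeffs 0"
  by (auto simp: nonneg_coeffs_def fps_X_def)

lemma nonneg_coeffs_add [intro]:
  "nonneg_coeffs F \<Longrightarrow> nonneg_coeffs G \<Longrightarrow> nonneg_coeffs (F + G)"
  by (auto simp: nonneg_coeffs_def)

lemma nonneg_coeffs_mult [intro]:
  "nonneg_coeffs F \<Longrightarrow> nonneg_coeffs G \<Longrightarrow> nonneg_coeffs (F * G)"
  by (auto simp: nonneg_coeffs_def fps_mult_nth intro!: sum_nonneg)

lemma nonneg_coeffs_sum [intro]: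
  "(\<And>i. i \<in> I \<Longrightarrow> nonneg_coeffs (F i)) \<Longrightarrow> nonneg_coeffs (\<Sum>i\<in>I. F i)"
  by (induction I rule: infinite_finite_induct) (simp_all add: nonneg_coeffs_add)

lemma eval_nonneg_ge:
  assumes "nonneg_coeffs F" "conv_at F t" "0 \<le> t"
  shows "fps_nth F m * t ^ m \<le> eval_fps F t"
proof -
  have "(\<lambda>n. fps_nth F n * t ^ n) sums eval_fps F t"
    using assms by (intro sums_eval_fps) (simp add: conv_at_def)
  then have "sum (\<lambda>n. fps_nth F n * t ^ n) {m} \<le> (\<Sum>n. fps_nth F n * t ^ n)"
    using assms by (intro sum_le_suminf) (auto simp: sums_iff nonneg_coeffs_def)
  also have "\<dots> = eval_fps F t" by (simp add: eval_fps_def)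
  finally have "sum (\<lambda>n. fps_nth F n * t ^ n) {m} \<le> eval_fps F t" .
  then show ?thesis by simp
qed

lemma eval_nonneg:
  assumes "nonneg_coeffs F" "conv_at F t" "0 \<le> t"
  shows "0 \<le> eval_fps F t"
  using eval_nonneg_ge [OF assms, of 0] assms by (auto simp: nonneg_coeffs_def intro: order_trans)

lemma eval_pos:
  assumes "nonneg_coeffs F" "conv_at F t" "0 < t" "F \<noteq> 0"
  shows "0 < eval_fps F t"
proof -
  obtain m where "fps_nth F m \<noteq> 0" using assms(4) by (auto simp: fps_eq_iff)
  then have "0 < fps_nth F m" using assms(1) by (metis nonneg_coeffs_def less_eq_real_def)
  then have "0 < fps_nth F m * t ^ m" using assms(3) by simp
  then show ?thesis using eval_nonneg_ge [of F t m] assms by simp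
qed

lemma norm_eval_cfps_le:
  assumes "nonneg_coeffs F" "conv_at F (norm z)"
  shows "norm (eval_fps (cfps F) z) \<le> eval_fps F (norm z)"
proof -
  have "summable (\<lambda>n. norm (fps_nth F n * norm z ^ n))"
    using assms by (intro norm_summable_fps) (simp add: conv_at_def)
  moreover have "norm (fps_nth (cfps F) n * z ^ n) = norm (fps_nth F n * norm z ^ n)" for n
    by (simp add: norm_mult norm_power abs_mult)
  ultimately have s: "summable (\<lambda>n. norm (fps_nth (cfps F) n * z ^ n))" by simp
  have "norm (eval_fps (cfps F) z) \<le> (\<Sum>n. norm (fps_nth (cfps F) n * z ^ n))"
    unfolding eval_fps_def by (rule summable_norm [OF s])
  also have "\<dots> = eval_fps F (norm z)"
    using assms(1) unfolding eval_fps_def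
    by (intro suminf_cong) (auto simp: norm_mult norm_power nonneg_coeffs_def)
  finally show ?thesis .
qed

lemma eval_mono:
  assumes "nonneg_coeffs F" "conv_at F t" "0 \<le> s" "s \<le> t"
  shows "eval_fps F s \<le> eval_fps F t"
  unfolding eval_fps_def using assms conv_at_mono [OF assms(2,4)]
  by (intro suminf_le summable_fps)
     (auto simp: conv_at_def nonneg_coeffs_def intro!: mult_left_mono power_mono)

lemma eval_strict_mono:
  assumes "nonneg_coeffs F" "conv_at F t" "0 \<le> s" "s < t" "fps_nth F 0 = 0" "F \<noteq> 0"
  shows "eval_fps F s < eval_fps F t"
proof -
  obtain m where m: "fps_nth F m \<noteq> 0" using assms(6) by (auto simp: fps_eq_iff)
  then have "m > 0" using assms(5) by (cases m) auto
  have "0 < fps_nth F m" using assms(1) m by (metis nonneg_coeffs_def less_eq_real_def)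
  then have lt: "fps_nth F m * s ^ m < fps_nth F m * t ^ m"
    using \<open>m > 0\<close> assms by (intro mult_strict_left_mono power_strict_mono) auto
  have cs: "conv_at F s" using conv_at_mono assms by (metis less_imp_le)
  have "0 < (\<Sum>n. fps_nth F n * t ^ n - fps_nth F n * s ^ n)"
    using assms cs lt
    by (intro suminf_pos2 [of _ m] summable_diff summable_fps)
       (auto simp: conv_at_def nonneg_coeffs_def intro!: mult_left_mono power_mono)
  also have "\<dots> = eval_fps F t - eval_fps F s"
    unfolding eval_fps_def using assms cs
    by (intro suminf_diff [symmetric] summable_fps) (auto simp: conv_at_def)
  finally show ?thesis by simp
qed

lemma isCont_eval: "conv_at F \<bar>t\<bar> \<Longrightarrow> isCont (eval_fps F) (t :: real)"
  by (intro continuous_eval_fps) (simp add: conv_at_def)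

lemma conv_at_enlarge:
  assumes "conv_at F t"
  obtains s where "t < s" "conv_at F s"
  using ereal_dense2 [OF assms [unfolded conv_at_def]] unfolding conv_at_def by auto

lemma conv_at_eventually:
  assumes "conv_at F t"
  shows "eventually (\<lambda>s. conv_at F s) (at_right t)"
proof -
  obtain s where "t < s" "conv_at F s" using conv_at_enlarge [OF assms] .
  then show ?thesis
    by (intro eventually_at_rightI [of t s]) (auto intro: conv_at_mono [of F s])
qed

text \<open>Used to move a radius to the right while a geometric ratio stays below 1.\<close>

lemma ex_right_less:
  assumes "conv_at F t" "0 \<le> t" "eval_fps F t < (u :: real)"
  obtains s where "t < s" "conv_at F s" "eval_fps F s < u"
proof -
  have "isCont (eval_fps F) t" using assms by (intro isCont_eval) auto
  then have "(eval_fps F \<longlongrightarrow> eval_fps F t) (at_right t)"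
    unfolding isCont_def by (rule tendsto_within_subset) simp
  then have "eventually (\<lambda>s. eval_fps F s < u) (at_right t)"
    using assms(3) order_tendsto_iff by blast
  then have "eventually (\<lambda>s. eval_fps F s < u \<and> conv_at F s \<and> t < s) (at_right t)"
    using conv_at_eventually [OF assms(1)] eventually_at_right_less [of t] by eventually_elim simp
  then obtain s where "eval_fps F s < u \<and> conv_at F s \<and> t < s"
    by (metis (mono_tags, lifting) eventually_happens trivial_limit_at_right_real)
  then show ?thesis using that by blast
qed

text \<open>The equation \<open>X = 1 + F X\<close>, with \<open>F\<close> free of a constant term,
  expresses each coefficient of \<open>X\<close> through earlier ones with nonnegative
  weights.\<close>

lemma nonneg_coeffs_geometric:
  assumes "nonneg_coeffs F" "fps_nth F 0 = 0"
  shows "nonneg_coeffs (inverse (1 - F))"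
proof -
  let ?X = "inverse (1 - F)"
  have "(1 - F) * ?X = 1" by (simp add: inverse_mult_eq_1' assms)
  then have X: "?X = 1 + F * ?X" by (simp add: algebra_simps)
  have "0 \<le> fps_nth ?X n" for n
  proof (induction n rule: less_induct)
    case (less n)
    have "fps_nth ?X n = fps_nth 1 n + (\<Sum>i=0..n. fps_nth F i * fps_nth ?X (n - i))"
      using arg_cong [OF X, of "\<lambda>f. fps_nth f n"] by (simp add: fps_mult_nth)
    moreover have "fps_nth F i * fps_nth ?X (n - i) \<ge> 0" if "i \<le> n" for i
      using assms less [of "n - i"] that
      by (cases "i = 0") (auto simp: nonneg_coeffs_def intro!: mult_nonneg_nonneg)
    moreover have "0 \<le> fps_nth (1 :: real fps) n" by simp
    ultimately show ?case using sum_nonneg [of "{0..n}"] by (smt (verit) atLeastAtMost_iff)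
  qed
  then show ?thesis by (simp add: nonneg_coeffs_def)
qed

text \<open>The bound \<open>F(s) < 1\<close> persists at some \<open>s > t\<close>, where it forces
  the coefficients of the inverse to be at most \<open>s^(-n)\<close>. This leaves room for
  convergence strictly beyond \<open>t\<close>.\<close>

lemma conv_at_geometric:
  assumes "nonneg_coeffs F" "fps_nth F 0 = 0" "conv_at F t" "0 \<le> t" "eval_fps F t < 1"
  shows "conv_at (inverse (1 - F)) t"
proof -
  obtain s where s: "t < s" "conv_at F s" "eval_fps F s < 1"
    using ex_right_less [OF assms(3,4,5)] by blast
  have s0: "0 < s" using s assms by simp
  have sums: "(\<lambda>n. fps_nth F n * s ^ n) sums eval_fps F s"
    using s s0 by (intro sums_eval_fps) (simp add: conv_at_def)
  then have sums': "(\<lambda>n. fps_nth F (Suc n) * s ^ Suc n) sums eval_fps F s"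
    by (subst sums_Suc_iff) (simp add: assms)
  have eq: "(\<lambda>n. norm (fps_nth (1 - F) (Suc n)) * s ^ Suc n) = (\<lambda>n. fps_nth F (Suc n) * s ^ Suc n)"
    using assms(1) by (auto simp: nonneg_coeffs_def)
  have b: "norm (fps_nth (inverse (1 - F)) n) \<le> inverse (s ^ n)" for n
  proof -
    have "norm (natfun_inverse (1 - F) n) \<le> inverse (s ^ n)"
      using sums' s s0 assms eq by (intro natfun_inverse_bound) (auto simp: sums_iff)
    then show ?thesis using assms by (simp add: fps_inverse_def)
  qed
  \<comment> \<open>Below \<open>s\<close> the comparison series is geometric with ratio less than
    1; above \<open>t\<close> the strict inequality of \<open>conv_at\<close> is obtained.\<close>
  define r where "r = (t + s) / 2"
  have r: "t < r" "r < s" "0 < r" using s assms by (auto simp: r_def)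
  have "summable (\<lambda>n. fps_nth (inverse (1 - F)) n * r ^ n)"
  proof (rule summable_comparison_test' [of "\<lambda>n. (r / s) ^ n"])
    show "summable (\<lambda>n. (r / s) ^ n)" using r by (intro summable_geometric) auto
    show "norm (fps_nth (inverse (1 - F)) n * r ^ n) \<le> (r / s) ^ n" for n
    proof -
      have "norm (fps_nth (inverse (1 - F)) n * r ^ n) = norm (fps_nth (inverse (1 - F)) n) * r ^ n"
        using r by (simp add: abs_mult)
      also have "\<dots> \<le> inverse (s ^ n) * r ^ n" using b [of n] r by (intro mult_right_mono) auto
      also have "\<dots> = (r / s) ^ n" by (simp add: power_mult_distrib power_inverse divide_inverse mult.commute)
      finally show ?thesis .
    qed
  qed
  then have "ereal r \<le> fps_conv_radius (inverse (1 - F))"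
    unfolding fps_conv_radius_def using r conv_radius_geI [of _ r] by fastforce
  then show ?thesis using r unfolding conv_at_def by (metis ereal_less(2) less_ereal.simps(1) less_le_trans)
qed

lemma ev_geometric:
  fixes F :: "'a :: {banach, real_normed_field} fps"
  assumes "fps_nth F 0 = 0" "conv_at F t" "conv_at (inverse (1 - F)) t" "norm z \<le> t"
  shows "(1 - eval_fps F z) * eval_fps (inverse (1 - F)) z = 1"
proof -
  have "(1 - F) * inverse (1 - F) = 1" by (simp add: inverse_mult_eq_1' assms)
  then have "eval_fps ((1 - F) * inverse (1 - F)) z = 1" by simp
  then show ?thesis using assms
    by (simp add: ev_mult [of _ t] ev_diff [of _ t] conv_at_diff)
qed

section \<open>Equality in the triangle inequality for series with nonnegative coefficients\<close>

lemma norm_1_Re_1: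
  assumes "norm w = 1" "Re w = 1"
  shows "w = 1"
proof -
  have "(Re w)\<^sup>2 + (Im w)\<^sup>2 = 1" using assms(1) by (simp add: cmod_def)
  then show ?thesis using assms(2) by (simp add: complex_eq_iff)
qed

text \<open>Equality in the triangle inequality means that all nonzero terms point in the same
  direction \<open>\<sigma>\<close>. After division by their moduli this fixes the powers of the
  phase of \<open>z\<close> at every index in the support of \<open>F\<close>.\<close>

lemma eval_aligned:
  assumes "nonneg_coeffs F" "conv_at F (norm z)" "norm (eval_fps (cfps F) z) = eval_fps F (norm z)"
    and "z \<noteq> 0"
  obtains \<sigma> where "norm \<sigma> = 1" "eval_fps (cfps F) z = \<sigma> * of_real (eval_fps F (norm z))"
    "\<And>m. fps_nth F m \<noteq> 0 \<Longrightarrow> (z / of_real (norm z)) ^ m = \<sigma>"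
proof -
  define w where "w = eval_fps (cfps F) z"
  \<comment> \<open>If \<open>w = 0\<close>, then \<open>F\<close> vanishes at
    \<open>norm z > 0\<close>, so no coefficient is nonzero and any unit phase serves.\<close>
  define \<sigma> where "\<sigma> = (if w = 0 then 1 else sgn w)"
  have \<sigma>: "norm \<sigma> = 1" by (auto simp: \<sigma>_def norm_sgn)
  have w: "w = \<sigma> * of_real (eval_fps F (norm z))"
    using assms(3) by (auto simp: \<sigma>_def w_def [symmetric] sgn_div_norm scaleR_conv_of_real field_simps)
  have \<sigma>2: "cnj \<sigma> * \<sigma> = 1" using \<sigma> by (metis complex_norm_square mult.commute of_real_1 power_one)
  let ?u = "z / of_real (norm z)"
  have u: "norm ?u = 1" using assms(4) by (simp add: norm_divide)
  have "(\<lambda>n. fps_nth (cfps F) n * z ^ n) sums w"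
    unfolding w_def using assms by (intro sums_eval_fps) (simp add: conv_at_def)
  then have "(\<lambda>n. Re (cnj \<sigma> * (fps_nth (cfps F) n * z ^ n))) sums Re (cnj \<sigma> * w)"
    by (intro sums_Re sums_mult)
  also have "cnj \<sigma> * w = of_real (eval_fps F (norm z))" using w \<sigma>2 by (simp add: mult.assoc [symmetric])
  finally have 1: "(\<lambda>n. Re (cnj \<sigma> * (fps_nth (cfps F) n * z ^ n))) sums eval_fps F (norm z)" by simp
  have 2: "(\<lambda>n. fps_nth F n * norm z ^ n) sums eval_fps F (norm z)"
    using assms by (intro sums_eval_fps) (simp add: conv_at_def)
  have eq: "Re (cnj \<sigma> * (fps_nth (cfps F) n * z ^ n)) = fps_nth F n * norm z ^ n * Re (cnj \<sigma> * ?u ^ n)" for n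
  proof -
    have "cnj \<sigma> * (fps_nth (cfps F) n * z ^ n) = of_real (fps_nth F n * norm z ^ n) * (cnj \<sigma> * ?u ^ n)"
      using assms(4) by (simp add: power_divide field_simps)
    moreover have "Re (of_real a * v) = a * Re v" for a v by simp
    ultimately show ?thesis by metis
  qed
  have le1: "Re (cnj \<sigma> * ?u ^ n) \<le> 1" for n
    using complex_Re_le_cmod [of "cnj \<sigma> * ?u ^ n"] u \<sigma> by (simp add: norm_mult norm_power)
  \<comment> \<open>The loss of real part in each term after rotation by
    \<open>cnj \<sigma>\<close>. The losses are nonnegative and sum to 0, so each of them is
    0.\<close>
  have S: "(\<lambda>n. fps_nth F n * norm z ^ n - Re (cnj \<sigma> * (fps_nth (cfps F) n * z ^ n))) sums 0"
    using sums_diff [OF 2 1] by simp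
  have nn: "0 \<le> fps_nth F n * norm z ^ n - Re (cnj \<sigma> * (fps_nth (cfps F) n * z ^ n))" for n
  proof -
    have "fps_nth F n * norm z ^ n * Re (cnj \<sigma> * ?u ^ n) \<le> fps_nth F n * norm z ^ n * 1"
      using assms(1) le1 [of n] by (intro mult_left_mono) (auto simp: nonneg_coeffs_def)
    then show ?thesis by (simp only: eq)
  qed
  have "?u ^ m = \<sigma>" if "fps_nth F m \<noteq> 0" for m
  proof -
    have "fps_nth F m * norm z ^ m - Re (cnj \<sigma> * (fps_nth (cfps F) m * z ^ m)) = 0"
      using S nn by (metis (no_types, lifting) suminf_eq_zero_iff sums_iff)
    then have "fps_nth F m * norm z ^ m * (1 - Re (cnj \<sigma> * ?u ^ m)) = 0"
      by (simp only: eq right_diff_distrib mult_1_right)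
    moreover have "fps_nth F m * norm z ^ m \<noteq> 0" using that assms(4) by simp
    ultimately have r: "Re (cnj \<sigma> * ?u ^ m) = 1"
      by (metis mult_eq_0_iff eq_iff_diff_eq_0)
    have n: "norm (cnj \<sigma> * ?u ^ m) = 1" using u \<sigma> by (simp add: norm_mult norm_power)
    have "cnj \<sigma> * ?u ^ m = 1" using n r by (rule norm_1_Re_1)
    then show ?thesis using \<sigma>2 by (metis mult.assoc mult.commute mult_1)
  qed
  then show ?thesis using that [of \<sigma>] \<sigma> w by (auto simp: w_def)
qed

section \<open>Values of rational power series\<close>

text \<open>Unlike in \<open>rat_eval\<close>, the fraction need not be in lowest terms.\<close>

definition rat_val :: "real fps \<Rightarrow> real \<Rightarrow> real \<Rightarrow> bool" where
  "rat_val F t v \<longleftrightarrow> (\<exists>p q. poly q t \<noteq> 0 \<and> F * fps_of_poly q = fps_of_poly p \<and> v = poly p t / poly q t)"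

definition rational_fps :: "real fps \<Rightarrow> bool" where
  "rational_fps F \<longleftrightarrow> (\<exists>p q. q \<noteq> 0 \<and> F * fps_of_poly q = fps_of_poly p)"

lemma rational_coprime:
  fixes F :: "real fps"
  assumes "q \<noteq> 0" "F * fps_of_poly q = fps_of_poly p"
  obtains p' q' where "coprime p' q'" "q' \<noteq> 0" "F * fps_of_poly q' = fps_of_poly p'" "q' dvd q"
proof -
  define d where "d = gcd p q"
  obtain p' q' where d: "p = d * p'" "q = d * q'" "coprime p' q'"
    using gcd_coprime_exists [of p q] assms unfolding d_def
    by (metis gcd_eq_0_iff mult.commute)
  have d0: "d \<noteq> 0" using assms d by auto
  have "fps_of_poly d * (F * fps_of_poly q') = fps_of_poly d * fps_of_poly p'"
    using assms(2) d by (simp add: fps_of_poly_mult mult_ac)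
  then have "F * fps_of_poly q' = fps_of_poly p'" using d0 by simp
  then show ?thesis using that d assms by auto
qed

text \<open>Cross-multiplication shows that a denominator in lowest terms divides every other
  denominator. It is therefore nonzero at \<open>t\<close> as soon as one denominator is, and the
  two quotients agree.\<close>

lemma rat_eval_eq:
  assumes "rat_val F t v"
  shows "rat_eval F t = v"
proof -
  obtain p q where pq: "poly q t \<noteq> 0" "F * fps_of_poly q = fps_of_poly p" "v = poly p t / poly q t"
    using assms unfolding rat_val_def by blast
  have q0: "q \<noteq> 0" using pq by auto
  have val: "poly a t / poly b t = v" if "b \<noteq> 0" "coprime a b" "F * fps_of_poly b = fps_of_poly a" for a b
  proof -
    have "fps_of_poly (p * b) = (F * fps_of_poly q) * fps_of_poly b"
      by (simp only: pq(2) fps_of_poly_mult)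
    also have "\<dots> = (F * fps_of_poly b) * fps_of_poly q" by (simp only: mult_ac)
    also have "\<dots> = fps_of_poly (a * q)" by (simp only: that(3) fps_of_poly_mult)
    finally have "fps_of_poly (p * b) = fps_of_poly (a * q)" .
    then have e: "p * b = a * q" by simp
    then have "b dvd a * q" by (metis dvd_triv_right)
    then have "b dvd q" using that(2) by (metis coprime_commute coprime_dvd_mult_right_iff)
    then have "poly b t \<noteq> 0" using pq(1) by (auto elim: dvdE)
    moreover have "poly p t * poly b t = poly a t * poly q t" using e by (metis poly_mult)
    ultimately show ?thesis using pq(1) by (simp add: pq(3) field_simps)
  qed
  obtain p' q' where "coprime p' q'" "q' \<noteq> 0" "F * fps_of_poly q' = fps_of_poly p'"
    using rational_coprime [OF q0 pq(2)] by metis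
  then show ?thesis
    unfolding rat_eval_def using val by (intro the_equality) metis+
qed

text \<open>Where the series converges, a zero of the denominator would be a zero of the numerator
  too, against coprimality. So a convergent rational series has no pole at \<open>t\<close>, and its
  sum is its rational value.\<close>

lemma rat_val_eval:
  assumes "rational_fps F" "conv_at F \<bar>t\<bar>"
  shows "rat_val F t (eval_fps F t)"
proof -
  obtain p q where "q \<noteq> 0" "F * fps_of_poly q = fps_of_poly p"
    using assms(1) unfolding rational_fps_def by blast
  then obtain p q where pq: "coprime p q" "q \<noteq> 0" "F * fps_of_poly q = fps_of_poly p"
    using rational_coprime by metis
  have "eval_fps (F * fps_of_poly q) t = eval_fps F t * eval_fps (fps_of_poly q) t"
    using assms(2) by (intro eval_fps_mult) (auto simp: conv_at_def)
  then have e: "poly p t = eval_fps F t * poly q t" using pq(3) by simp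
  have "poly q t \<noteq> 0"
  proof
    assume "poly q t = 0"
    then have "poly p t = 0" using e by simp
    with \<open>poly q t = 0\<close> show False using pq(1) by (meson coprime_poly_0)
  qed
  then show ?thesis unfolding rat_val_def using pq e by (intro exI [of _ p] exI [of _ q]) auto
qed

lemma rat_val_const: "rat_val (fps_const a) t a"
  unfolding rat_val_def by (intro exI [of _ "[:a:]"] exI [of _ 1]) (simp add: fps_of_poly_const)

lemma rat_val_X: "rat_val fps_X t t"
  unfolding rat_val_def by (intro exI [of _ "[:0, 1:]"] exI [of _ 1]) (simp add: fps_of_poly_fps_X)

lemma rat_val_add:
  assumes "rat_val F t u" "rat_val G t v"
  shows "rat_val (F + G) t (u + v)"
proof -
  obtain p q p' q' where "poly q t \<noteq> 0" "F * fps_of_poly q = fps_of_poly p" "u = poly p t / poly q t"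
    "poly q' t \<noteq> 0" "G * fps_of_poly q' = fps_of_poly p'" "v = poly p' t / poly q' t"
    using assms unfolding rat_val_def by blast
  moreover have "(F + G) * fps_of_poly (q * q') =
      (F * fps_of_poly q) * fps_of_poly q' + (G * fps_of_poly q') * fps_of_poly q"
    by (simp add: fps_of_poly_mult algebra_simps)
  moreover have "poly p t / poly q t + poly p' t / poly q' t
      = poly (p * q' + p' * q) t / poly (q * q') t" if "poly q t \<noteq> 0" "poly q' t \<noteq> 0"
    using that by (simp add: add_frac_eq)
  ultimately show ?thesis unfolding rat_val_def
    by (intro exI [of _ "p * q' + p' * q"] exI [of _ "q * q'"])
       (simp add: fps_of_poly_mult fps_of_poly_add)
qed

lemma rat_val_mult:
  assumes "rat_val F t u" "rat_val G t v"
  shows "rat_val (F * G) t (u * v)"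
proof -
  obtain p q p' q' where "poly q t \<noteq> 0" "F * fps_of_poly q = fps_of_poly p" "u = poly p t / poly q t"
    "poly q' t \<noteq> 0" "G * fps_of_poly q' = fps_of_poly p'" "v = poly p' t / poly q' t"
    using assms unfolding rat_val_def by blast
  moreover have "(F * G) * fps_of_poly (q * q') = (F * fps_of_poly q) * (G * fps_of_poly q')"
    by (simp add: fps_of_poly_mult algebra_simps)
  ultimately show ?thesis unfolding rat_val_def
    by (intro exI [of _ "p * p'"] exI [of _ "q * q'"]) (simp add: fps_of_poly_mult)
qed

lemma rat_val_diff:
  assumes "rat_val F t u" "rat_val G t v"
  shows "rat_val (F - G) t (u - v)"
  using rat_val_add [OF assms(1) rat_val_mult [OF rat_val_const [of "-1"] assms(2)]]
  by (simp flip: fps_const_neg)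

text \<open>The series \<open>F\<close> may diverge at \<open>t\<close>: only \<open>U\<close> and
  \<open>X\<close> need values there. In this way \<open>B\<close>, \<open>C\<close> and
  \<open>D\<close> are evaluated from series that do converge.\<close>

lemma rat_val_quotient:
  assumes "rat_val U t u" "u \<noteq> 0" "U \<noteq> 0" "rat_val X t v" "F * U = X"
  shows "rat_val F t (v / u)"
proof -
  obtain p q p' q' where *: "poly q t \<noteq> 0" "U * fps_of_poly q = fps_of_poly p" "u = poly p t / poly q t"
    "poly q' t \<noteq> 0" "X * fps_of_poly q' = fps_of_poly p'" "v = poly p' t / poly q' t"
    using assms unfolding rat_val_def by blast
  have "F * fps_of_poly (p * q') = F * (U * fps_of_poly q) * fps_of_poly q'"
    by (simp only: *(2) fps_of_poly_mult mult_ac)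
  also have "\<dots> = (F * U) * fps_of_poly q' * fps_of_poly q" by (simp only: mult_ac)
  also have "\<dots> = fps_of_poly (p' * q)" by (simp only: *(5) assms(5) fps_of_poly_mult)
  finally have "F * fps_of_poly (p * q') = fps_of_poly (p' * q)" .
  moreover have "poly (p * q') t \<noteq> 0" using * assms(2) by auto
  moreover have "v / u = poly (p' * q) t / poly (p * q') t" using * by simp
  ultimately show ?thesis unfolding rat_val_def by blast
qed

lemma rational_fps_iff: "rational_fps F \<longleftrightarrow> (\<exists>t v. rat_val F t v)"
proof
  assume "rational_fps F"
  then obtain p q where q: "q \<noteq> 0" "F * fps_of_poly q = fps_of_poly p"
    unfolding rational_fps_def by blast
  then obtain t where "poly q t \<noteq> 0" using poly_all_0_iff_0 by blast
  then show "\<exists>t v. rat_val F t v" unfolding rat_val_def using q by blast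
qed (metis rational_fps_def rat_val_def poly_0)

lemma rational_fps_const [intro]: "rational_fps (fps_const a)"
  using rat_val_const rational_fps_iff by blast

lemma rational_fps_X [intro]: "rational_fps fps_X"
  using rat_val_X rational_fps_iff by blast

lemma rational_fps_add [intro]:
  assumes "rational_fps F" "rational_fps G"
  shows "rational_fps (F + G)"
proof -
  obtain p q p' q' where "q \<noteq> 0" "F * fps_of_poly q = fps_of_poly p"
    "q' \<noteq> 0" "G * fps_of_poly q' = fps_of_poly p'"
    using assms unfolding rational_fps_def by blast
  moreover have "(F + G) * fps_of_poly (q * q') =
      (F * fps_of_poly q) * fps_of_poly q' + (G * fps_of_poly q') * fps_of_poly q"
    by (simp add: fps_of_poly_mult algebra_simps)
  ultimately show ?thesis unfolding rational_fps_def
    by (intro exI [of _ "p * q' + p' * q"] exI [of _ "q * q'"])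
       (simp add: fps_of_poly_mult fps_of_poly_add)
qed

lemma rational_fps_mult [intro]:
  assumes "rational_fps F" "rational_fps G"
  shows "rational_fps (F * G)"
proof -
  obtain p q p' q' where "q \<noteq> 0" "F * fps_of_poly q = fps_of_poly p"
    "q' \<noteq> 0" "G * fps_of_poly q' = fps_of_poly p'"
    using assms unfolding rational_fps_def by blast
  moreover have "(F * G) * fps_of_poly (q * q') = (F * fps_of_poly q) * (G * fps_of_poly q')"
    by (simp add: fps_of_poly_mult algebra_simps)
  ultimately show ?thesis unfolding rational_fps_def
    by (intro exI [of _ "p * p'"] exI [of _ "q * q'"]) (simp add: fps_of_poly_mult)
qed

lemma rational_fps_geometric [intro]:
  assumes "rational_fps F" "fps_nth F 0 = 0"
  shows "rational_fps (inverse (1 - F))"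
proof -
  obtain p q where pq: "q \<noteq> 0" "F * fps_of_poly q = fps_of_poly p"
    using assms unfolding rational_fps_def by blast
  have X: "inverse (1 - F) * (1 - F) = 1" by (simp add: inverse_mult_eq_1 assms)
  have n0: "1 - F \<noteq> 0" using X by auto
  have e: "(1 - F) * fps_of_poly q = fps_of_poly (q - p)"
    using pq by (simp add: fps_of_poly_diff algebra_simps)
  then have "q - p \<noteq> 0" using n0 pq by auto
  moreover have "inverse (1 - F) * fps_of_poly (q - p) = fps_of_poly q"
    unfolding e [symmetric] mult.assoc [symmetric] X by simp
  ultimately show ?thesis unfolding rational_fps_def by blast
qed

section \<open>Square-root singularities\<close>

text \<open>The square-root formula is known only on this lens inside the disc. As the lens
  accumulates at \<open>k\<close>, identities between holomorphic functions extend from it to a full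
  neighbourhood of \<open>k\<close>.\<close>

lemma of_real_islimpt_inner:
  assumes "0 < k" "0 < e"
  shows "complex_of_real k islimpt (ball (of_real k) e \<inter> ball 0 k)"
  unfolding islimpt_approachable
proof (intro allI impI)
  fix d :: real assume d: "0 < d"
  define q where "q = min (min d e) k / 2"
  have q: "0 < q" "q < d" "q < e" "q < k" using assms d by (auto simp: q_def min_def)
  have "dist (complex_of_real (k - q)) (of_real k) = q"
    using q by (simp only: dist_of_real) (simp add: dist_real_def)
  moreover have "complex_of_real (k - q) \<in> ball 0 k" using q by (simp del: of_real_diff)
  ultimately show "\<exists>t\<in>ball (of_real k) e \<inter> ball 0 k. t \<noteq> complex_of_real k \<and> dist t (of_real k) < d"
    using q by (intro bexI [of _ "of_real (k - q)"]) (auto simp: dist_commute)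
qed

lemma Re_one_minus_pos:
  assumes "0 < k" "norm t \<le> k" "t \<noteq> complex_of_real k"
  shows "0 < Re (1 - t / of_real k)"
proof -
  have "Re t \<le> k" using complex_Re_le_cmod [of t] assms by linarith
  moreover have "Re t \<noteq> k"
  proof
    assume e: "Re t = k"
    have "(Re t)\<^sup>2 + (Im t)\<^sup>2 \<le> k\<^sup>2" using assms by (metis cmod_power2 norm_ge_zero power_mono)
    then have "Im t = 0" using e by simp
    then show False using e assms(3) by (simp add: complex_eq_iff)
  qed
  ultimately have "Re t < k" by simp
  then show ?thesis using assms by (simp add: Re_divide_of_real)
qed

lemma Re_pos_not_nonpos: "0 < Re z \<Longrightarrow> z \<notin> \<real>\<^sub>\<le>\<^sub>0"
  by (auto simp: complex_nonpos_Reals_iff)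

text \<open>Principal roots of points in the right half-plane lie in the sector where the imaginary
  part is smaller in modulus than the real part. A product of two such roots still has positive real
  part, so it is the principal root.\<close>

lemma csqrt_mult_Re_pos:
  assumes "0 < Re a" "0 < Re b"
  shows "csqrt (a * b) = csqrt a * csqrt b"
proof -
  have im: "\<bar>Im (csqrt u)\<bar> < Re (csqrt u)" if "0 < Re u" for u
  proof -
    have "Re ((csqrt u)\<^sup>2) = (Re (csqrt u))\<^sup>2 - (Im (csqrt u))\<^sup>2"
      unfolding power2_eq_square by simp
    then have "\<bar>Im (csqrt u)\<bar>\<^sup>2 < (Re (csqrt u))\<^sup>2" using that by (simp del: csqrt.simps)
    then show ?thesis by (rule power2_less_imp_less) (rule Re_csqrt)
  qed
  have "\<bar>Im (csqrt a) * Im (csqrt b)\<bar> < Re (csqrt a) * Re (csqrt b)"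
    unfolding abs_mult using im assms by (intro mult_strict_mono') auto
  then have "0 < Re (csqrt a * csqrt b)" by (simp del: csqrt.simps)
  then show ?thesis
    by (intro csqrt_unique disjI1) (simp_all add: power_mult_distrib del: csqrt.simps)
qed

text \<open>A continuation \<open>u\<close> would make \<open>(u - g) / h\<close> a holomorphic
  square root of \<open>1 - t / k\<close> near \<open>k\<close>. Such a root vanishes at
  \<open>k\<close>, so its square has derivative 0 there, whereas \<open>1 - t / k\<close> has
  derivative \<open>- 1 / k\<close>.\<close>

lemma sqrt_not_continuable:
  assumes k: "0 < k" and e: "0 < \<epsilon>"
    and hol: "g holomorphic_on ball (of_real k) \<epsilon>" "h holomorphic_on ball (of_real k) \<epsilon>"
    and h0: "h (of_real k) \<noteq> 0"
    and f: "\<And>t. t \<in> ball (of_real k) \<epsilon> \<inter> ball 0 k \<Longrightarrow> f t = g t + h t * csqrt (1 - t / of_real k)"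
  shows "\<not> (\<exists>u \<delta>. \<delta> > 0 \<and> u holomorphic_on ball (complex_of_real k) \<delta> \<and>
          (\<forall>t \<in> ball (of_real k) \<delta> \<inter> ball 0 k. f t = u t))"
proof
  let ?k = "complex_of_real k"
  assume "\<exists>u \<delta>. \<delta> > 0 \<and> u holomorphic_on ball ?k \<delta> \<and> (\<forall>t \<in> ball ?k \<delta> \<inter> ball 0 k. f t = u t)"
  then obtain u \<delta> where u: "\<delta> > 0" "u holomorphic_on ball ?k \<delta>"
    "\<And>t. t \<in> ball ?k \<delta> \<inter> ball 0 k \<Longrightarrow> f t = u t" by blast
  have "isCont h ?k" using e
    by (intro field_differentiable_imp_continuous_at holomorphic_on_imp_differentiable_at [OF hol(2) open_ball]) simp
  then obtain d where d: "0 < d" "\<And>t. dist ?k t < d \<Longrightarrow> h t \<noteq> 0" using h0 continuous_at_avoid by metis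
  define r where "r = min d (min \<epsilon> \<delta>)"
  have r: "0 < r" "r \<le> \<epsilon>" "r \<le> \<delta>" "r \<le> d" using d e u by (auto simp: r_def)
  define \<sigma> where "\<sigma> t = (u t - g t) / h t" for t
  have sub: "ball ?k r \<subseteq> ball ?k \<epsilon>" "ball ?k r \<subseteq> ball ?k \<delta>" using r by auto
  have \<sigma>: "\<sigma> holomorphic_on ball ?k r"
    unfolding \<sigma>_def using sub u hol d r
    by (intro holomorphic_intros) (auto intro: holomorphic_on_subset)
  have \<sigma>2: "(\<sigma> t)\<^sup>2 - (1 - t / ?k) = 0" if "t \<in> ball ?k r" for t
  proof (rule analytic_continuation [of "\<lambda>t. (\<sigma> t)\<^sup>2 - (1 - t / ?k)" "ball ?k r" "ball ?k r \<inter> ball 0 k" ?k])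
    show "(\<lambda>t. (\<sigma> t)\<^sup>2 - (1 - t / ?k)) holomorphic_on ball ?k r"
      using \<sigma> k by (intro holomorphic_intros) auto
    show "?k islimpt (ball ?k r \<inter> ball 0 k)" using of_real_islimpt_inner k r by blast
    fix z assume z: "z \<in> ball ?k r \<inter> ball 0 k"
    then have "z \<in> ball ?k \<epsilon> \<inter> ball 0 k" "z \<in> ball ?k \<delta> \<inter> ball 0 k" "h z \<noteq> 0" using sub d r by auto
    then have "\<sigma> z = csqrt (1 - z / ?k)" using f [of z] u(3) [of z] by (simp add: \<sigma>_def)
    then show "(\<sigma> z)\<^sup>2 - (1 - z / ?k) = 0" by simp
  qed (use that r in auto)
  have \<sigma>0: "\<sigma> ?k = 0" using \<sigma>2 [of ?k] r k by simp
  have "(\<sigma> has_field_derivative deriv \<sigma> ?k) (at ?k)"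
    using \<sigma> r by (intro holomorphic_derivI [of _ "ball ?k r"]) auto
  then have "((\<lambda>t. (\<sigma> t)\<^sup>2) has_field_derivative 0) (at ?k)"
    by (auto intro!: derivative_eq_intros simp: \<sigma>0)
  then have "((\<lambda>t. 1 - t / ?k) has_field_derivative 0) (at ?k)"
    by (rule has_field_derivative_transform_within_open [of _ _ _ "ball ?k r"])
       (use r \<sigma>2 in auto)
  moreover have "((\<lambda>t. 1 - t / ?k) has_field_derivative - 1 / ?k) (at ?k)"
    using k by (auto intro!: derivative_eq_intros)
  ultimately have "- 1 / ?k = 0" by (rule DERIV_unique [rotated])
  then show False using k by simp
qed

section \<open>Coefficient asymptotics from a square-root singularity\<close>

definition bounded_near :: "(complex \<Rightarrow> complex) \<Rightarrow> complex set \<Rightarrow> bool" where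
  "bounded_near f S \<longleftrightarrow> (\<exists>C. \<forall>t\<in>S. norm (f t) \<le> C)"

lemma bounded_near_add: "bounded_near f S \<Longrightarrow> bounded_near g S \<Longrightarrow> bounded_near (\<lambda>t. f t + g t) S"
  unfolding bounded_near_def by (meson add_mono norm_triangle_le)

lemma bounded_near_mult: "bounded_near f S \<Longrightarrow> bounded_near g S \<Longrightarrow> bounded_near (\<lambda>t. f t * g t) S"
proof -
  assume "bounded_near f S" "bounded_near g S"
  then obtain C D where "\<And>t. t \<in> S \<Longrightarrow> norm (f t) \<le> C" "\<And>t. t \<in> S \<Longrightarrow> norm (g t) \<le> D"
    unfolding bounded_near_def by blast
  then have "norm (f t * g t) \<le> C * D" if "t \<in> S" for t
    unfolding norm_mult using that by (meson mult_mono norm_ge_zero order_trans)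
  then show ?thesis unfolding bounded_near_def by blast
qed

lemma bounded_near_holomorphic:
  assumes "f holomorphic_on ball a r" "0 < r" "S \<subseteq> ball a (r / 2)"
  shows "bounded_near f S"
proof -
  have "continuous_on (cball a (r/2)) f"
    using assms by (intro holomorphic_on_imp_continuous_on holomorphic_on_subset [OF assms(1)]) auto
  then have "bounded (f ` cball a (r/2))" by (intro compact_imp_bounded compact_continuous_image) auto
  then obtain C where "\<forall>u\<in>f ` cball a (r/2). norm u \<le> C" unfolding bounded_iff by blast
  then have C: "\<And>t. t \<in> cball a (r/2) \<Longrightarrow> norm (f t) \<le> C" by blast
  have "norm (f t) \<le> C" if "t \<in> S" for t
    using C [of t] assms(3) that ball_subset_cball by blast
  then show ?thesis unfolding bounded_near_def by blast
qed

text \<open>Cauchy's estimate on circles of radius \<open>r < k\<close> has a bound independent of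
  \<open>r\<close>, so \<open>r\<close> may tend to \<open>k\<close> and nothing is required on the
  boundary circle.\<close>

lemma coeff_bound_of_bounded:
  fixes D :: "complex fps"
  assumes k: "0 < k" "ereal k \<le> fps_conv_radius D" and C: "\<And>t. t \<in> ball 0 k \<Longrightarrow> norm (eval_fps D t) \<le> C"
  shows "norm (fps_nth D n) * k ^ n \<le> C"
proof -
  have r: "norm (fps_nth D n) * r ^ n \<le> C" if r: "0 < r" "r < k" for r
  proof -
    have s: "ball 0 k \<subseteq> eball (0::complex) (fps_conv_radius D)" using k ball_eball_mono by blast
    have hol: "eval_fps D holomorphic_on ball 0 k" using s by (rule holomorphic_on_eval_fps)
    have "norm ((deriv ^^ n) (eval_fps D) 0) \<le> fact n * C / r ^ n"
    proof (rule Cauchy_inequality)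
      show "eval_fps D holomorphic_on ball 0 r" using hol r by (auto elim: holomorphic_on_subset)
      show "continuous_on (cball 0 r) (eval_fps D)" using hol r
        by (intro holomorphic_on_imp_continuous_on) (auto elim: holomorphic_on_subset)
    qed (use r C in auto)
    moreover have "fps_nth D n = (deriv ^^ n) (eval_fps D) 0 / fact n"
      using k by (intro fps_nth_conv_deriv) (metis ereal_less(2) less_le_trans)
    ultimately have "norm (fps_nth D n) \<le> (fact n * C / r ^ n) / fact n"
      by (simp only: norm_divide norm_fact) (rule divide_right_mono, simp_all)
    also have "\<dots> = C / r ^ n" by simp
    finally have "norm (fps_nth D n) \<le> C / r ^ n" .
    then show ?thesis using r by (simp add: field_simps)
  qed
  have "((\<lambda>r. norm (fps_nth D n) * r ^ n) \<longlongrightarrow> norm (fps_nth D n) * k ^ n) (at_left k)"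
    by (intro tendsto_intros)
  moreover have "eventually (\<lambda>r. norm (fps_nth D n) * r ^ n \<le> C) (at_left k)"
    using r k by (intro eventually_at_leftI [of 0]) auto
  ultimately show ?thesis by (intro tendsto_upperbound [of _ _ "at_left k"]) auto
qed

text \<open>Transfers the second derivative of an explicit formula, valid on a piece of the disc, to
  the formal second derivative, to which the coefficient bound applies.\<close>

lemma second_deriv_eq:
  fixes D :: "complex fps"
  assumes k: "ereal k \<le> fps_conv_radius D" and I: "open I" "I \<subseteq> ball 0 k"
    and eq: "\<And>t. t \<in> I \<Longrightarrow> eval_fps D t = f t"
    and d1: "\<And>t. t \<in> I \<Longrightarrow> (f has_field_derivative f1 t) (at t)"
    and d2: "\<And>t. t \<in> I \<Longrightarrow> (f1 has_field_derivative f2 t) (at t)"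
    and t: "t \<in> I"
  shows "eval_fps (fps_deriv (fps_deriv D)) t = f2 t"
proof -
  have rad: "ereal (norm t) < fps_conv_radius D" if "t \<in> I" for t
  proof -
    have "ereal (norm t) < ereal k" using that I by auto
    then show ?thesis using k by (rule less_le_trans)
  qed
  have rad': "ereal (norm t) < fps_conv_radius (fps_deriv D)" if "t \<in> I" for t
    using rad [OF that] fps_conv_radius_deriv [of D] by (rule less_le_trans)
  have 1: "eval_fps (fps_deriv D) t = f1 t" if t: "t \<in> I" for t
  proof -
    have "(eval_fps D has_field_derivative eval_fps (fps_deriv D) t) (at t)"
      by (rule has_field_derivative_eval_fps [OF rad [OF t]])
    then have "(f has_field_derivative eval_fps (fps_deriv D) t) (at t)"
      by (rule has_field_derivative_transform_within_open [OF _ I(1) t eq])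
    then show ?thesis using d1 [OF t] by (rule DERIV_unique)
  qed
  have "(eval_fps (fps_deriv D) has_field_derivative eval_fps (fps_deriv (fps_deriv D)) t) (at t)"
    by (rule has_field_derivative_eval_fps [OF rad' [OF t]])
  then have "(f1 has_field_derivative eval_fps (fps_deriv (fps_deriv D)) t) (at t)"
    by (rule has_field_derivative_transform_within_open [OF _ I(1) t 1])
  then show ?thesis using d2 [OF t] by (rule DERIV_unique)
qed

lemma binomial_fps:
  fixes k :: real and a :: complex
  defines "S \<equiv> Abs_fps (\<lambda>n. (a gchoose n) * (- 1 / of_real k) ^ n)"
  assumes "0 < k"
  shows "ereal k \<le> fps_conv_radius S" "norm t < k \<Longrightarrow> eval_fps S t = (1 - t / of_real k) powr a"
proof -
  have s: "(\<lambda>n. fps_nth S n * t ^ n) sums (1 - t / of_real k) powr a" if "norm t < k" for t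
  proof -
    have "norm (- t / of_real k) < 1" using that assms by (simp add: norm_divide)
    from gen_binomial_complex [OF this, of a]
    show ?thesis using assms by (simp add: S_def power_divide power_minus' mult_ac power_minus [of t])
  qed
  show "ereal k \<le> fps_conv_radius S"
    unfolding fps_conv_radius_def
  proof (rule conv_radius_geI_ex)
    fix r :: real assume "0 < r" "ereal r < ereal k"
    then show "\<exists>z. norm z = r \<and> summable (\<lambda>n. fps_nth S n * z ^ n)"
      using s [of "of_real r"] by (intro exI [of _ "of_real r"]) (auto simp: sums_iff)
  qed
  show "norm t < k \<Longrightarrow> eval_fps S t = (1 - t / of_real k) powr a"
    using s [of t] by (simp add: eval_fps_def sums_iff)
qed

text \<open>The difference quotient has a removable singularity at \<open>a\<close>. Iterated, this
  is Taylor's formula with a holomorphic remainder.\<close>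

lemma holomorphic_divided_difference:
  assumes "h holomorphic_on S" "open S"
  obtains p where "p holomorphic_on S" "\<And>t. h t = h a + (t - a) * p t" "p a = deriv h a"
proof
  let ?p = "\<lambda>z. if z = a then deriv h a else (h z - h a) / (z - a)"
  show "?p holomorphic_on S" by (rule pole_lemma_open [OF assms])
  show "h t = h a + (t - a) * ?p t" for t by simp
qed simp

text \<open>With \<open>s = csqrt (1 - t / k)\<close> and two divided differences of
  \<open>h\<close>, the part of \<open>h s\<close> not accounted for by \<open>s\<close> and
  \<open>s^3\<close> is \<open>(t - k)^2 s h2\<close>, whose second derivative is bounded near
  \<open>k\<close>. At every other boundary point the function continues, and compactness of the
  closed disc makes the bound global.\<close>

theorem sqrt_transfer:
  fixes F :: "complex fps"
  assumes k: "0 < k" "ereal k \<le> fps_conv_radius F" and e: "0 < \<epsilon>"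
    and hol: "g holomorphic_on ball (of_real k) \<epsilon>" "h holomorphic_on ball (of_real k) \<epsilon>"
    and F: "\<And>t. t \<in> ball (of_real k) \<epsilon> \<inter> ball 0 k \<Longrightarrow> eval_fps F t = g t + h t * csqrt (1 - t / of_real k)"
    and other: "\<And>z. norm z = k \<Longrightarrow> z \<noteq> of_real k \<Longrightarrow>
      \<exists>u \<delta>. 0 < \<delta> \<and> u holomorphic_on ball z \<delta> \<and> (\<forall>t\<in>ball z \<delta> \<inter> ball 0 k. eval_fps F t = u t)"
  shows "(\<lambda>m. fps_nth F m * of_real (k ^ m * real m powr (3/2))) \<longlonglongrightarrow> - h (of_real k) / of_real (2 * sqrt pi)"
proof -
  let ?k = "complex_of_real k"
  let ?s = "\<lambda>t. csqrt (1 - t / ?k)"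
  obtain h1 where h1: "h1 holomorphic_on ball ?k \<epsilon>" "\<And>t. h t = h ?k + (t - ?k) * h1 t"
    using holomorphic_divided_difference [OF hol(2) open_ball] by metis
  obtain h2 where h2: "h2 holomorphic_on ball ?k \<epsilon>" "\<And>t. h1 t = h1 ?k + (t - ?k) * h2 t"
    using holomorphic_divided_difference [OF h1(1) open_ball] by metis
  define S1 where "S1 = Abs_fps (\<lambda>n. ((1/2 :: complex) gchoose n) * (- 1 / of_real k) ^ n)"
  define S3 where "S3 = Abs_fps (\<lambda>n. ((3/2 :: complex) gchoose n) * (- 1 / of_real k) ^ n)"
  \<comment> \<open>Since \<open>t - k = - k s^2\<close>, the linear term of \<open>h\<close>
    contributes \<open>- k h1(k) s^3\<close> to \<open>F\<close>; hence the plus sign in front of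
    \<open>S3\<close>.\<close>
  define D where "D = F - fps_const (h ?k) * S1 + fps_const (?k * h1 ?k) * S3"
  have S1: "ereal k \<le> fps_conv_radius S1" "norm t < k \<Longrightarrow> eval_fps S1 t = ?s t" for t
    unfolding S1_def using binomial_fps [OF k(1), where a = "1/2"] by (auto simp: csqrt_conv_powr)
  have sne: "norm t < k \<Longrightarrow> 0 < Re (1 - t / ?k)" for t using k by (intro Re_one_minus_pos) auto
  have S3: "ereal k \<le> fps_conv_radius S3" "norm t < k \<Longrightarrow> eval_fps S3 t = (?s t) ^ 3" for t
  proof -
    show "ereal k \<le> fps_conv_radius S3" unfolding S3_def by (rule binomial_fps [OF k(1)])
    assume t: "norm t < k"
    have "1 - t / ?k \<noteq> 0" using sne [OF t] by force
    then have "(?s t) ^ 3 = (1 - t / ?k) powr (of_nat 3 * (1/2))"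
      unfolding csqrt_conv_powr by (simp add: powr_def exp_of_nat_mult [symmetric])
    then show "eval_fps S3 t = (?s t) ^ 3"
      unfolding S3_def using binomial_fps(2) [OF k(1) t, where a = "3/2"] by simp
  qed
  have conv: "conv_at F r" "conv_at S1 r" "conv_at S3 r" if "r < k" for r
    using that k S1 S3 unfolding conv_at_def by (metis ereal_less_le less_ereal.simps(1) less_le_trans)+
  have radD: "ereal k \<le> fps_conv_radius D"
  proof (rule ccontr)
    assume "\<not> ?thesis"
    then have "fps_conv_radius D < ereal k" by simp
    then obtain r where r: "fps_conv_radius D < ereal r" "ereal r < ereal k" using ereal_dense2 by blast
    then have "conv_at D r" unfolding D_def using conv [of r] by (intro conv_at_add conv_at_diff conv_at_mult) auto
    then show False using r by (simp add: conv_at_def)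
  qed
  have evD: "eval_fps D t = eval_fps F t - h ?k * ?s t + ?k * h1 ?k * (?s t) ^ 3" if t: "norm t < k" for t
    unfolding D_def using conv [OF t] S1(2) [OF t] S3(2) [OF t]
    by (simp add: ev_add [of _ "norm t"] ev_diff [of _ "norm t"] ev_mult [of _ "norm t"] conv_at_mult conv_at_diff)
  let ?D2 = "fps_deriv (fps_deriv D)"
  have rad2: "ereal k \<le> fps_conv_radius ?D2"
    by (rule order_trans [OF radD order_trans [OF fps_conv_radius_deriv fps_conv_radius_deriv]])
  have local_bound: "\<exists>U. open U \<and> z \<in> U \<and> bounded_near (eval_fps ?D2) (U \<inter> ball 0 k)" if z: "z \<in> cball 0 k" for z
  proof -
    \<comment> \<open>Near a point past which \<open>D\<close> continues holomorphically, the second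
      derivative is bounded on a smaller ball. This settles every point except
      \<open>k\<close>.\<close>
    have cont: "\<exists>U. open U \<and> z \<in> U \<and> bounded_near (eval_fps ?D2) (U \<inter> ball 0 k)"
      if u: "0 < \<delta>" "u holomorphic_on ball z \<delta>" "\<And>t. t \<in> ball z \<delta> \<inter> ball 0 k \<Longrightarrow> eval_fps D t = u t" for u \<delta>
    proof -
      have d2: "deriv (deriv u) holomorphic_on ball z \<delta>" using u by (intro holomorphic_deriv) auto
      have d1: "deriv u holomorphic_on ball z \<delta>" using u by (intro holomorphic_deriv) auto
      have "eval_fps ?D2 t = deriv (deriv u) t" if "t \<in> ball z \<delta> \<inter> ball 0 k" for t
        by (rule second_deriv_eq [OF radD, of "ball z \<delta> \<inter> ball 0 k" u "deriv u"])
           (use u d1 that in \<open>auto intro: holomorphic_derivI\<close>)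
      moreover have "bounded_near (deriv (deriv u)) (ball z (\<delta>/2) \<inter> ball 0 k)"
        using d2 u by (intro bounded_near_holomorphic [of _ z \<delta>]) auto
      ultimately have "bounded_near (eval_fps ?D2) (ball z (\<delta>/2) \<inter> ball 0 k)"
        using u(1) by (auto simp: bounded_near_def)
      then show ?thesis using u(1) by (intro exI [of _ "ball z (\<delta>/2)"]) auto
    qed
    consider "norm z < k" | "norm z = k" "z \<noteq> ?k" | "z = ?k" using z by force
    then show ?thesis
    proof cases
      case 1
      show ?thesis
      proof (rule cont [of "k - norm z" "eval_fps D"])
        have "ball z (k - norm z) \<subseteq> ball 0 k"
        proof
          fix w assume "w \<in> ball z (k - norm z)"
          then show "w \<in> ball 0 k" using norm_triangle_ineq2 [of w z] by (auto simp: dist_norm norm_minus_commute)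
        qed
        also have "\<dots> \<subseteq> eball 0 (fps_conv_radius D)" by (rule ball_eball_mono [OF radD])
        finally show "eval_fps D holomorphic_on ball z (k - norm z)" by (rule holomorphic_on_eval_fps)
      qed (use 1 in auto)
    next
      case 2
      obtain u \<delta> where u: "0 < \<delta>" "u holomorphic_on ball z \<delta>" "\<And>t. t \<in> ball z \<delta> \<inter> ball 0 k \<Longrightarrow> eval_fps F t = u t"
        using other [OF 2] by blast
      \<comment> \<open>Away from \<open>k\<close> on the circle, \<open>1 - t / k\<close> stays in
        the right half-plane, so the subtracted powers are holomorphic there and do not spoil the
        continuation of \<open>F\<close>.\<close>
      have "open {t. 0 < Re (1 - t / ?k)}" by (intro open_Collect_less continuous_intros) (use k in auto)
      moreover have "z \<in> {t. 0 < Re (1 - t / ?k)}" using Re_one_minus_pos [OF k(1) _ 2(2)] 2 by simp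
      ultimately obtain d where d: "0 < d" "ball z d \<subseteq> {t. 0 < Re (1 - t / ?k)}"
        using open_contains_ball by metis
      let ?v = "\<lambda>t. u t - h ?k * ?s t + ?k * h1 ?k * (?s t) ^ 3"
      show ?thesis
      proof (rule cont [of "min \<delta> d" ?v])
        have sh: "?s holomorphic_on ball z (min \<delta> d)"
          using d k by (intro holomorphic_on_csqrt' holomorphic_intros) (auto intro!: Re_pos_not_nonpos)
        have uh: "u holomorphic_on ball z (min \<delta> d)" by (rule holomorphic_on_subset [OF u(2)]) auto
        show "?v holomorphic_on ball z (min \<delta> d)"
          by (intro holomorphic_on_add holomorphic_on_diff holomorphic_on_mult holomorphic_on_const
              holomorphic_on_power sh uh)
      qed (use u d evD in auto)
    next
      case 3
      let ?I = "ball ?k (\<epsilon>/2) \<inter> ball 0 k"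
      have sub: "?I \<subseteq> ball ?k \<epsilon> \<inter> ball 0 k" using e by auto
      \<comment> \<open>This is \<open>k^2 s^5\<close>, so two differentiations leave a multiple of
        \<open>s\<close>, which is bounded on the disc.\<close>
      let ?w = "\<lambda>t. (t - ?k)\<^sup>2 * ?s t"
      let ?w1 = "\<lambda>t. 5/2 * (t - ?k) * ?s t"
      let ?w2 = "\<lambda>t. 15/4 * ?s t"
      have s2: "(?s t)\<^sup>2 = 1 - t / ?k" for t by simp
      have tk: "t - ?k = - ?k * (?s t)\<^sup>2" for t using k by (simp add: field_simps)
      have s0: "?s t \<noteq> 0" if "t \<in> ?I" for t using sne [of t] that by force
      have sd: "(?s has_field_derivative (- 1 / (2 * ?k * ?s t))) (at t)" if "t \<in> ?I" for t
      proof -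
        have "norm t < k" using that by simp
        then have nn: "1 - t / ?k \<notin> \<real>\<^sub>\<le>\<^sub>0" by (intro Re_pos_not_nonpos sne)
        have "((\<lambda>t. 1 - t / ?k) has_field_derivative (- 1 / ?k)) (at t)"
          using k by (auto intro!: derivative_eq_intros)
        from has_field_derivative_csqrt' [OF this nn] show ?thesis
          by (rule DERIV_cong) (simp del: csqrt.simps)
      qed
      have w1: "(?w has_field_derivative ?w1 t) (at t)" if t: "t \<in> ?I" for t
      proof -
        have "((\<lambda>t. (t - ?k)\<^sup>2) has_field_derivative 2 * (t - ?k)) (at t)"
          by (auto intro!: derivative_eq_intros)
        from DERIV_mult [OF this sd [OF t]]
        have wd: "(?w has_field_derivative 2 * (t - ?k) * ?s t + (- 1 / (2 * ?k * ?s t)) * (t - ?k)\<^sup>2) (at t)" .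
        have e: "(- 1 / (2 * ?k * ?s t)) * (t - ?k)\<^sup>2 = 1/2 * (t - ?k) * ?s t"
        proof -
          have "(- 1 / (2 * ?k * ?s t)) * (t - ?k)\<^sup>2 = (- 1 / (2 * ?k * ?s t)) * ((t - ?k) * (- ?k * (?s t)\<^sup>2))"
            by (simp only: power2_eq_square [of "t - ?k"] tk [of t, symmetric])
          also have "\<dots> = 1/2 * (t - ?k) * ?s t" using k s0 [OF t] by (simp add: power2_eq_square del: power2_csqrt)
          finally show ?thesis .
        qed
        have "2 * a * b + 1/2 * a * b = 5/2 * a * b" for a b :: complex by (simp add: field_simps)
        then show ?thesis by (intro DERIV_cong [OF wd]) (simp only: e)
      qed
      have w2: "(?w1 has_field_derivative ?w2 t) (at t)" if t: "t \<in> ?I" for t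
      proof -
        have "((\<lambda>t. 5/2 * (t - ?k)) has_field_derivative 5/2) (at t)"
          by (auto intro!: derivative_eq_intros)
        from DERIV_mult [OF this sd [OF t]]
        have wd: "(?w1 has_field_derivative 5/2 * ?s t + (- 1 / (2 * ?k * ?s t)) * (5/2 * (t - ?k))) (at t)" .
        have e: "(- 1 / (2 * ?k * ?s t)) * (5/2 * (t - ?k)) = 5/4 * ?s t"
        proof -
          have "(- 1 / (2 * ?k * ?s t)) * (5/2 * (t - ?k)) = (- 1 / (2 * ?k * ?s t)) * (5/2 * (- ?k * (?s t)\<^sup>2))"
            by (simp only: tk [symmetric])
          also have "\<dots> = 5/4 * ?s t" using k s0 [OF t] by (simp add: power2_eq_square del: power2_csqrt)
          finally show ?thesis .
        qed
        have "5/2 * b + 5/4 * b = 15/4 * b" for b :: complex by (simp add: field_simps)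
        then show ?thesis by (intro DERIV_cong [OF wd]) (simp only: e)
      qed
      have hd: "(u has_field_derivative deriv u t) (at t)"
        if "u holomorphic_on ball ?k \<epsilon>" "t \<in> ?I" for u t
        using that sub by (intro holomorphic_derivI [of _ "ball ?k \<epsilon>"]) auto
      have hol': "deriv u holomorphic_on ball ?k \<epsilon>" if "u holomorphic_on ball ?k \<epsilon>" for u
        using that by (intro holomorphic_deriv) auto
      let ?f2 = "\<lambda>t. deriv (deriv g) t + deriv (deriv h2) t * ?w t + 2 * deriv h2 t * ?w1 t + h2 t * ?w2 t"
      have eq: "eval_fps ?D2 t = ?f2 t" if t: "t \<in> ?I" for t
      proof (rule second_deriv_eq [OF radD, of ?I "\<lambda>t. g t + h2 t * ?w t"
            "\<lambda>t. deriv g t + (deriv h2 t * ?w t + h2 t * ?w1 t)"])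
        fix t assume t: "t \<in> ?I"
        have "eval_fps D t = g t + (h ?k + (t - ?k) * (h1 ?k + (t - ?k) * h2 t)) * ?s t
            - h ?k * ?s t + ?k * h1 ?k * (?s t) ^ 3"
          using evD [of t] F [of t] h1(2) [of t] h2(2) [of t] t sub by auto
        also have "?k * h1 ?k * (?s t) ^ 3 = - (t - ?k) * h1 ?k * ?s t"
          unfolding tk [of t] by (simp add: power3_eq_cube power2_eq_square del: power2_csqrt)
        finally show "eval_fps D t = g t + h2 t * ?w t" by (simp add: algebra_simps power2_eq_square)
        show "((\<lambda>t. g t + h2 t * ?w t) has_field_derivative deriv g t + (deriv h2 t * ?w t + h2 t * ?w1 t)) (at t)"
          using DERIV_add [OF hd [OF hol(1) t] DERIV_mult [OF hd [OF h2(1) t] w1 [OF t]]]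
          by (simp add: mult.commute add.commute)
        show "((\<lambda>t. deriv g t + (deriv h2 t * ?w t + h2 t * ?w1 t)) has_field_derivative ?f2 t) (at t)"
          using DERIV_add [OF hd [OF hol' [OF hol(1)] t] DERIV_add [OF
              DERIV_mult [OF hd [OF hol' [OF h2(1)] t] w1 [OF t]] DERIV_mult [OF hd [OF h2(1) t] w2 [OF t]]]]
          by (rule DERIV_cong) (simp add: field_simps del: csqrt.simps)
      qed (use t in auto)
      have bs: "bounded_near ?s ?I"
        unfolding bounded_near_def
      proof (intro exI ballI)
        fix t assume "t \<in> ?I"
        then have "norm (t / ?k) \<le> 1" using k by (simp add: norm_divide)
        then have "norm (1 - t / ?k) \<le> 2" using norm_triangle_ineq4 [of 1 "t / ?k"] by simp
        then have "(norm (?s t))\<^sup>2 \<le> 2\<^sup>2" by (simp add: norm_power [symmetric])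
        then show "norm (?s t) \<le> 2" by (rule power2_le_imp_le) simp
      qed
      have bh: "bounded_near u ?I" if "u holomorphic_on ball ?k \<epsilon>" for u
        using that e by (intro bounded_near_holomorphic [of _ ?k \<epsilon>]) auto
      have "bounded_near ?f2 ?I"
        by (intro bounded_near_add bounded_near_mult bs bh hol' hol h2 holomorphic_intros)
      then have "bounded_near (eval_fps ?D2) ?I" using eq by (simp add: bounded_near_def)
      then show ?thesis using e 3 by (intro exI [of _ "ball ?k (\<epsilon>/2)"]) auto
    qed
  qed
  then obtain U where U: "\<And>z. z \<in> cball 0 k \<Longrightarrow> open (U z) \<and> z \<in> U z \<and> bounded_near (eval_fps ?D2) (U z \<inter> ball 0 k)"
    by metis
  \<comment> \<open>Finitely many of the local neighbourhoods cover the closed disc; the sum of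
    their bounds bounds the second derivative everywhere inside.\<close>
  obtain Z where Z: "Z \<subseteq> cball 0 k" "finite Z" "cball 0 k \<subseteq> (\<Union>z\<in>Z. U z)"
    by (rule compactE_image [OF compact_cball [of 0 k], of "cball 0 k" U]) (use U in auto)
  have "\<forall>z\<in>Z. \<exists>C. \<forall>t\<in>U z \<inter> ball 0 k. norm (eval_fps ?D2 t) \<le> C"
    using U Z(1) unfolding bounded_near_def by blast
  then obtain C where C: "\<And>z t. z \<in> Z \<Longrightarrow> t \<in> U z \<inter> ball 0 k \<Longrightarrow> norm (eval_fps ?D2 t) \<le> C z" by metis
  have "norm (eval_fps ?D2 t) \<le> (\<Sum>z\<in>Z. \<bar>C z\<bar>)" if t: "t \<in> ball 0 k" for t
  proof -
    obtain z where z: "z \<in> Z" "t \<in> U z" using t Z(3) by force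
    have "norm (eval_fps ?D2 t) \<le> \<bar>C z\<bar>" using C [of z t] z t by auto
    also have "\<dots> \<le> (\<Sum>z\<in>Z. \<bar>C z\<bar>)" using Z z by (intro member_le_sum) auto
    finally show ?thesis .
  qed
  then have cb: "norm (fps_nth ?D2 n) * k ^ n \<le> (\<Sum>z\<in>Z. \<bar>C z\<bar>)" for n
    by (rule coeff_bound_of_bounded [OF k(1) rad2])
  \<comment> \<open>The factor \<open>k^2\<close> comes from the index shift
    \<open>m = n + 2\<close> between \<open>D\<close> and its second derivative.\<close>
  define M where "M = (\<Sum>z\<in>Z. \<bar>C z\<bar>) * k\<^sup>2"
  have Db: "norm (fps_nth D m * of_real (k ^ m * real m powr (3/2))) \<le> M * real m powr (3/2) / (real m * (real m - 1))"
    if m: "2 \<le> m" for m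
  proof -
    obtain n where n: "m = n + 2" using m by (metis add.commute le_Suc_ex)
    have "norm (fps_nth ?D2 n) = real m * (real m - 1) * norm (fps_nth D m)"
    proof -
      have "fps_nth ?D2 n = of_nat ((n + 1) * (n + 2)) * fps_nth D m" by (simp add: n algebra_simps)
      then have "norm (fps_nth ?D2 n) = real ((n + 1) * (n + 2)) * norm (fps_nth D m)"
        by (simp only: norm_mult norm_of_nat)
      then show ?thesis by (simp add: n algebra_simps)
    qed
    then have "real m * (real m - 1) * norm (fps_nth D m) * k ^ n \<le> (\<Sum>z\<in>Z. \<bar>C z\<bar>)" using cb [of n] by simp
    then have "real m * (real m - 1) * norm (fps_nth D m) * k ^ n * k\<^sup>2 \<le> M"
      unfolding M_def by (intro mult_right_mono) auto
    then have "norm (fps_nth D m) * k ^ m * (real m * (real m - 1)) \<le> M"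
      by (simp add: n power2_eq_square mult_ac)
    then have "norm (fps_nth D m) * k ^ m \<le> M / (real m * (real m - 1))"
      using m by (simp add: pos_le_divide_eq)
    then have "norm (fps_nth D m) * k ^ m * real m powr (3/2) \<le> M / (real m * (real m - 1)) * real m powr (3/2)"
      by (rule mult_right_mono) simp
    then show ?thesis using k by (simp add: norm_mult norm_power)
  qed
  have D0: "(\<lambda>m. fps_nth D m * of_real (k ^ m * real m powr (3/2))) \<longlonglongrightarrow> 0"
  proof (rule Lim_null_comparison)
    show "eventually (\<lambda>m. norm (fps_nth D m * of_real (k ^ m * real m powr (3/2)))
        \<le> M * real m powr (3/2) / (real m * (real m - 1))) sequentially"
      using eventually_ge_at_top [of 2] by eventually_elim (rule Db)
    show "(\<lambda>m. M * real m powr (3/2) / (real m * (real m - 1))) \<longlonglongrightarrow> 0" by real_asymp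
  qed
  have coefS: "(\<lambda>m. (a gchoose m) * (- 1 / ?k) ^ m * of_real (k ^ m * real m powr (Re a + 1))) \<longlonglongrightarrow> inverse (Gamma (- a))"
    if "a \<in> \<real>" for a
  proof (rule Lim_transform_eventually [OF gbinomial_asymptotic [of a]])
    show "eventually (\<lambda>n. (a gchoose n) / ((-1)^n / exp ((a + 1) * of_real (ln (real n))))
        = (a gchoose n) * (- 1 / ?k) ^ n * of_real (k ^ n * real n powr (Re a + 1))) sequentially"
      using eventually_gt_at_top [of 0]
    proof eventually_elim
      case (elim n)
      have a: "a = of_real (Re a)" using that by (simp add: complex_is_Real_iff complex_eq_iff)
      have "exp ((a + 1) * of_real (ln (real n))) = of_real (real n powr (Re a + 1))"
        using elim by (subst a) (simp add: powr_def exp_of_real [symmetric] del: exp_of_real)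
      moreover have "(- 1 / ?k) ^ n * of_real (k ^ n) = (-1) ^ n"
      proof -
        have "(- 1 / ?k) ^ n * of_real (k ^ n) = ((- 1 / ?k) * ?k) ^ n"
          by (simp only: of_real_power power_mult_distrib)
        also have "(- 1 / ?k) * ?k = -1" using k by simp
        finally show ?thesis .
      qed
      moreover have "1 / ((-1)^n) = ((-1)^n :: complex)" by (simp add: field_simps power_mult_distrib [symmetric])
      moreover have "(a gchoose n) / ((-1)^n / exp ((a + 1) * of_real (ln (real n))))
          = (a gchoose n) * exp ((a + 1) * of_real (ln (real n))) * (1 / (-1)^n)"
        by (simp only: divide_divide_eq_right times_divide_eq_right mult_1_right)
      ultimately have "(a gchoose n) / ((-1)^n / exp ((a + 1) * of_real (ln (real n))))
          = (a gchoose n) * of_real (real n powr (Re a + 1)) * ((- 1 / ?k) ^ n * of_real (k ^ n))"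
        by (simp only:)
      then show ?case by (simp only: of_real_mult mult_ac)
    qed
  qed
  have T1: "(\<lambda>m. fps_nth S1 m * of_real (k ^ m * real m powr (3/2))) \<longlonglongrightarrow> - 1 / of_real (2 * sqrt pi)"
  proof -
    \<comment> \<open>The functional equation at \<open>- 1/2\<close> and
      \<open>Gamma (1/2) = sqrt pi\<close> give the source of the constant
      \<open>- 1 / (2 sqrt pi)\<close>.\<close>
    have G: "Gamma (- (1/2) :: complex) = of_real (- 2 * sqrt pi)"
    proof -
      have "Gamma (- (1/2) + 1 :: complex) = - (1/2) * Gamma (- (1/2))"
      proof (rule Gamma_plus1)
        show "- (1/2) \<notin> (\<int>\<^sub>\<le>\<^sub>0 :: complex set)"
        proof
          assume "- (1/2) \<in> (\<int>\<^sub>\<le>\<^sub>0 :: complex set)"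
          then obtain n where "- (1/2) = complex_of_int n" by (auto elim!: nonpos_Ints_cases)
          then have "complex_of_int (2 * n) = 2 * - (1/2)" by simp
          then have "complex_of_int (2 * n) = of_int (-1)" by simp
          then have "2 * n = -1" by (simp only: of_int_eq_iff)
          then show False by presburger
        qed
      qed
      then show ?thesis using Gamma_one_half_complex by simp
    qed
    show ?thesis using coefS [of "1/2"] G unfolding S1_def by (simp add: field_simps)
  qed
  have T3: "(\<lambda>m. fps_nth S3 m * of_real (k ^ m * real m powr (3/2))) \<longlonglongrightarrow> 0"
  proof -
    \<comment> \<open>The coefficients of the 3/2 power are of order \<open>m^(-5/2)\<close>, one
      factor \<open>m\<close> below the leading order.\<close>
    have "(\<lambda>m. fps_nth S3 m * of_real (k ^ m * real m powr (5/2)) * of_real (1 / real m))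
        \<longlonglongrightarrow> inverse (Gamma (- (3/2))) * of_real 0"
      using coefS [of "3/2"] unfolding S3_def
      by (intro tendsto_mult tendsto_of_real lim_1_over_n) simp_all
    then have *: "(\<lambda>m. fps_nth S3 m * of_real (k ^ m * real m powr (5/2)) * of_real (1 / real m)) \<longlonglongrightarrow> 0" by simp
    show ?thesis
    proof (rule Lim_transform_eventually [OF *])
      show "eventually (\<lambda>m. fps_nth S3 m * of_real (k ^ m * real m powr (5/2)) * of_real (1 / real m)
         = fps_nth S3 m * of_real (k ^ m * real m powr (3/2))) sequentially"
        using eventually_gt_at_top [of 0]
      proof eventually_elim
        case (elim m)
        have "real m powr (5/2) = real m powr (3/2) * real m" using elim powr_add [of "real m" "3/2" 1] by simp
        then show ?case using elim by (simp add: mult.assoc)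
      qed
    qed
  qed
  have "(\<lambda>m. fps_nth D m * of_real (k ^ m * real m powr (3/2)) + h ?k * (fps_nth S1 m * of_real (k ^ m * real m powr (3/2)))
      - ?k * h1 ?k * (fps_nth S3 m * of_real (k ^ m * real m powr (3/2))))
     \<longlonglongrightarrow> 0 + h ?k * (- 1 / of_real (2 * sqrt pi)) - ?k * h1 ?k * 0"
    by (intro tendsto_intros D0 T1 T3)
  then show ?thesis by (simp add: D_def algebra_simps)
qed

section \<open>Generating functions of walks with taboo steps\<close>

lemma UNIV_step: "(UNIV :: step set) = {East, North, West, South}"
  using step.exhaust by blast

section \<open>Weighted enumeration of sets of walks\<close>

definition step_weight :: "real \<Rightarrow> real \<Rightarrow> step \<Rightarrow> real" where
  "step_weight x y s = x powi dx s * y powi dy s"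

lemma end_simps [simp]: "end_x [] = 0" "end_y [] = 0" "end_x (s # w) = dx s + end_x w"
  "end_y (s # w) = dy s + end_y w" "end_x (v @ w) = end_x v + end_x w"
  "end_y (v @ w) = end_y v + end_y w"
  by (simp_all add: end_x_def end_y_def)

lemma finite_length_eq: "finite {w \<in> A. length (w :: step list) = n}"
  by (rule finite_subset [OF _ finite_lists_length_eq [of UNIV n]]) auto

lemma walk_gf_nth:
  "fps_nth (walk_gf A x y) n = (\<Sum>w\<in>{w \<in> A. length w = n}. x powi end_x w * y powi end_y w)"
  by (simp add: walk_gf_def)

lemma walk_gf_empty [simp]: "walk_gf {} x y = 0"
  by (simp add: fps_eq_iff walk_gf_nth)

lemma walk_gf_Nil [simp]: "walk_gf {[]} x y = 1"
proof -
  have "{w \<in> {[] :: step list}. length w = n} = (if n = 0 then {[]} else {})" for n by auto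
  then show ?thesis by (simp add: fps_eq_iff walk_gf_nth)
qed

lemma walk_gf_Cons:
  assumes "x \<noteq> 0" "y \<noteq> 0"
  shows "walk_gf ((#) s ` A) x y = fps_const (step_weight x y s) * fps_X * walk_gf A x y"
proof (rule fps_ext)
  fix n
  show "fps_nth (walk_gf ((#) s ` A) x y) n
      = fps_nth (fps_const (step_weight x y s) * fps_X * walk_gf A x y) n"
  proof (cases n)
    case 0
    have "{w \<in> (#) s ` A. length w = n} = {}" using 0 by auto
    then show ?thesis using 0 unfolding walk_gf_nth by simp
  next
    case (Suc m)
    have *: "{w \<in> (#) s ` A. length w = n} = (#) s ` {w \<in> A. length w = m}" using Suc by auto
    have "fps_nth (walk_gf ((#) s ` A) x y) n = step_weight x y s * fps_nth (walk_gf A x y) m"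
      unfolding walk_gf_nth * using assms
      by (subst sum.reindex) (auto simp: step_weight_def power_int_add sum_distrib_left mult_ac intro!: sum.cong)
    then show ?thesis using Suc by (simp add: mult.assoc)
  qed
qed

lemma walk_gf_snoc:
  assumes "x \<noteq> 0" "y \<noteq> 0"
  shows "walk_gf ((\<lambda>w. w @ [s]) ` A) x y = fps_const (step_weight x y s) * fps_X * walk_gf A x y"
proof (rule fps_ext)
  fix n
  show "fps_nth (walk_gf ((\<lambda>w. w @ [s]) ` A) x y) n
      = fps_nth (fps_const (step_weight x y s) * fps_X * walk_gf A x y) n"
  proof (cases n)
    case 0
    have "{w \<in> (\<lambda>w. w @ [s]) ` A. length w = n} = {}" using 0 by auto
    then show ?thesis using 0 unfolding walk_gf_nth by simp
  next
    case (Suc m)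
    have *: "{w \<in> (\<lambda>w. w @ [s]) ` A. length w = n} = (\<lambda>w. w @ [s]) ` {w \<in> A. length w = m}"
      using Suc by auto
    have "fps_nth (walk_gf ((\<lambda>w. w @ [s]) ` A) x y) n = step_weight x y s * fps_nth (walk_gf A x y) m"
      unfolding walk_gf_nth * using assms
      by (subst sum.reindex)
         (auto simp: step_weight_def power_int_add sum_distrib_left mult_ac inj_on_def intro!: sum.cong)
    then show ?thesis using Suc by (simp add: mult.assoc)
  qed
qed

lemma walk_gf_UN:
  assumes "finite I" "\<And>i j. i \<in> I \<Longrightarrow> j \<in> I \<Longrightarrow> i \<noteq> j \<Longrightarrow> A i \<inter> A j = {}"
  shows "walk_gf (\<Union>i\<in>I. A i) x y = (\<Sum>i\<in>I. walk_gf (A i) x y)"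
proof (rule fps_ext)
  fix n
  have "{w \<in> (\<Union>i\<in>I. A i). length w = n} = (\<Union>i\<in>I. {w \<in> A i. length w = n})" by auto
  then show "fps_nth (walk_gf (\<Union>i\<in>I. A i) x y) n = fps_nth (\<Sum>i\<in>I. walk_gf (A i) x y) n"
    unfolding walk_gf_nth fps_sum_nth using assms
    by (simp only:) (subst sum.UNION_disjoint, auto simp: finite_length_eq)
qed

lemma walk_gf_Un:
  assumes "A \<inter> B = {}"
  shows "walk_gf (A \<union> B) x y = walk_gf A x y + walk_gf B x y"
proof (rule fps_ext)
  fix n
  have "{w \<in> A \<union> B. length w = n} = {w \<in> A. length w = n} \<union> {w \<in> B. length w = n}" by auto
  then show "fps_nth (walk_gf (A \<union> B) x y) n = fps_nth (walk_gf A x y + walk_gf B x y) n"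
    unfolding walk_gf_nth fps_add_nth using assms
    by (simp only:) (subst sum.union_disjoint, auto simp: finite_length_eq)
qed

lemma walk_gf_Diff:
  assumes "B \<subseteq> A"
  shows "walk_gf (A - B) x y = walk_gf A x y - walk_gf B x y"
proof -
  have "walk_gf ((A - B) \<union> B) x y = walk_gf (A - B) x y + walk_gf B x y"
    by (rule walk_gf_Un) auto
  moreover have "(A - B) \<union> B = A" using assms by auto
  ultimately show ?thesis by simp
qed

lemma walk_gf_nonneg: "0 < x \<Longrightarrow> 0 < y \<Longrightarrow> nonneg_coeffs (walk_gf A x y)"
  by (auto simp: nonneg_coeffs_def walk_gf_nth intro!: sum_nonneg)

lemma walk_gf_nth_0: "[] \<notin> A \<Longrightarrow> fps_nth (walk_gf A x y) 0 = 0"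
  unfolding walk_gf_nth by (rule sum.neutral) auto

lemma walk_gf_nth_pos:
  assumes "0 < x" "0 < y" "w \<in> A"
  shows "0 < fps_nth (walk_gf A x y) (length w)"
  unfolding walk_gf_nth using assms
  by (intro sum_pos2 [of _ w]) (auto simp: finite_length_eq)

lemma walk_gf_height:
  assumes "\<And>w. w \<in> A \<Longrightarrow> end_y w = h"
  shows "walk_gf A x y = fps_const (y powi h) * walk_gf A x 1"
  using assms by (auto simp: fps_eq_iff walk_gf_nth sum_distrib_left mult_ac intro!: sum.cong)

lemma end_y_horizontal: "set v \<inter> {North, South} = {} \<Longrightarrow> end_y v = 0"
proof (induction v)
  case (Cons s v)
  then show ?case by (cases s) auto
qed simp

text \<open>The combinatorial analogue of taboo probabilities of a Markov chain. The step
  \<open>i\<close> precedes the walk and is neither listed nor weighted. Only the intermediate steps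
  avoid \<open>T\<close>, so \<open>j\<close> may belong to \<open>T\<close>.\<close>

definition taboo_walks :: "rule \<Rightarrow> step set \<Rightarrow> step \<Rightarrow> step \<Rightarrow> step list set" where
  "taboo_walks R T i j =
     {w. w \<noteq> [] \<and> successively R (i # w) \<and> last w = j \<and> set (butlast w) \<inter> T = {}}"

lemma taboo_walks_first_step:
  "taboo_walks R T i j = (if R i j then {[j]} else {}) \<union>
     (\<Union>k\<in>{k. R i k \<and> k \<notin> T}. (#) k ` taboo_walks R T k j)"
proof (rule set_eqI)
  fix w
  show "w \<in> taboo_walks R T i j \<longleftrightarrow> w \<in> (if R i j then {[j]} else {}) \<union>
     (\<Union>k\<in>{k. R i k \<and> k \<notin> T}. (#) k ` taboo_walks R T k j)"
  proof (cases w)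
    case (Cons k v)
    then show ?thesis
      by (cases v) (auto simp: taboo_walks_def image_iff)
  qed (auto simp: taboo_walks_def)
qed

text \<open>Every coefficient of the system carries a factor \<open>fps_X\<close>, so coefficient
  \<open>n + 1\<close> depends on coefficient \<open>n\<close> alone. Decompositions of walks can
  thus be verified by checking that both sides satisfy the same recursion, without a bijection of
  words.\<close>

lemma fps_linear_system_unique:
  fixes c :: "'i \<Rightarrow> 'i \<Rightarrow> real" and f :: "'i \<Rightarrow> real fps"
  assumes "\<And>i. f i = (\<Sum>k\<in>K. fps_const (c i k) * fps_X * f k)"
  shows "f i = 0"
proof -
  have "fps_nth (f i) n = 0" for n
  proof (induction n arbitrary: i)
    case 0
    show ?case by (subst assms) (simp add: fps_sum_nth mult.assoc)
  next
    case (Suc n)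
    show ?case by (subst assms) (simp add: fps_sum_nth mult.assoc Suc)
  qed
  then show ?thesis by (simp add: fps_eq_iff)
qed

section \<open>Decompositions of walks at visits to a given step\<close>

locale rule_weights =
  fixes R :: rule and x :: real
  assumes x_pos: "0 < x"
begin

definition unit_step :: "real \<Rightarrow> step \<Rightarrow> real fps" where
  "unit_step y k = fps_const (step_weight x y k) * fps_X"

definition edge :: "real \<Rightarrow> step \<Rightarrow> step \<Rightarrow> real fps" where
  "edge y i k = fps_const (step_weight x y k * of_bool (R i k)) * fps_X"

definition tgf :: "real \<Rightarrow> step set \<Rightarrow> step \<Rightarrow> step \<Rightarrow> real fps" where
  "tgf y T i j = walk_gf (taboo_walks R T i j) x y"

lemma edge_alt: "edge y i k = fps_const (of_bool (R i k)) * unit_step y k"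
  by (cases "R i k") (simp_all add: edge_def unit_step_def)

lemma tgf_nonneg: "0 < y \<Longrightarrow> nonneg_coeffs (tgf y T i j)"
  unfolding tgf_def by (intro walk_gf_nonneg x_pos)

lemma tgf_nth_0: "fps_nth (tgf y T i j) 0 = 0"
  unfolding tgf_def by (rule walk_gf_nth_0) (simp add: taboo_walks_def)

lemma tgf_first_step:
  assumes "0 < y"
  shows "tgf y T i j = edge y i j + (\<Sum>k\<in>-T. edge y i k * tgf y T k j)"
proof -
  have nz: "x \<noteq> 0" "y \<noteq> 0" using x_pos assms by auto
  have 1: "walk_gf (if R i j then {[j]} else {}) x y = edge y i j"
  proof -
    have "{[j]} = (#) j ` {[]}" by simp
    then have "walk_gf {[j]} x y = unit_step y j"
      unfolding unit_step_def by (simp only: walk_gf_Cons [OF nz] walk_gf_Nil) simp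
    then show ?thesis by (simp add: edge_def unit_step_def)
  qed
  have "walk_gf (\<Union>k\<in>{k. R i k \<and> k \<notin> T}. (#) k ` taboo_walks R T k j) x y
      = (\<Sum>k\<in>{k. R i k \<and> k \<notin> T}. walk_gf ((#) k ` taboo_walks R T k j) x y)"
    by (rule walk_gf_UN) auto
  also have "\<dots> = (\<Sum>k\<in>{k. R i k \<and> k \<notin> T}. edge y i k * tgf y T k j)"
    by (intro sum.cong) (auto simp: walk_gf_Cons nz edge_def tgf_def)
  also have "\<dots> = (\<Sum>k\<in>-T. edge y i k * tgf y T k j)"
    by (intro sum.mono_neutral_left) (auto simp: edge_def)
  finally have 2: "walk_gf (\<Union>k\<in>{k. R i k \<and> k \<notin> T}. (#) k ` taboo_walks R T k j) x y
      = (\<Sum>k\<in>-T. edge y i k * tgf y T k j)" .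
  have "tgf y T i j = walk_gf (if R i j then {[j]} else {}) x y +
     walk_gf (\<Union>k\<in>{k. R i k \<and> k \<notin> T}. (#) k ` taboo_walks R T k j) x y"
    unfolding tgf_def by (subst taboo_walks_first_step, rule walk_gf_Un) (auto simp: taboo_walks_def)
  then show ?thesis using 1 2 by simp
qed

text \<open>Either the walk reaches \<open>j\<close> with no visit to \<open>a\<close> in between,
  or it is cut at its first visit to \<open>a\<close>. The difference of the two sides satisfies the
  homogeneous first-step recursion and is therefore 0.\<close>

lemma tgf_first_visit:
  assumes "0 < y" "a \<notin> T"
  shows "tgf y T i j = tgf y (insert a T) i j + tgf y (insert a T) i a * tgf y T a j"
proof -
  let ?T = "insert a T"
  define f where "f i = tgf y T i j - tgf y ?T i j - tgf y ?T i a * tgf y T a j" for i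
  have S: "(\<Sum>k\<in>-T. h k) = h a + (\<Sum>k\<in>-?T. h k)" for h :: "step \<Rightarrow> real fps"
  proof -
    have "-T = insert a (-?T)" using assms(2) by auto
    then show ?thesis by simp
  qed
  have "f i = (\<Sum>k\<in>-?T. edge y i k * f k)" for i
  proof -
    have "f i = (edge y i j + (edge y i a * tgf y T a j + (\<Sum>k\<in>-?T. edge y i k * tgf y T k j)))
        - (edge y i j + (\<Sum>k\<in>-?T. edge y i k * tgf y ?T k j))
        - (edge y i a + (\<Sum>k\<in>-?T. edge y i k * tgf y ?T k a)) * tgf y T a j"
      unfolding f_def using tgf_first_step [OF assms(1), of T i j] tgf_first_step [OF assms(1), of ?T i j]
        tgf_first_step [OF assms(1), of ?T i a] by (simp only: S)
    also have "\<dots> = (\<Sum>k\<in>-?T. edge y i k * tgf y T k j) - (\<Sum>k\<in>-?T. edge y i k * tgf y ?T k j)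
        - (\<Sum>k\<in>-?T. edge y i k * tgf y ?T k a) * tgf y T a j"
      by (simp add: algebra_simps)
    also have "\<dots> = (\<Sum>k\<in>-?T. edge y i k * f k)"
      by (simp only: f_def sum_subtractf [symmetric] sum_distrib_right right_diff_distrib mult.assoc)
    finally show ?thesis .
  qed
  then have "f i = 0" unfolding edge_def by (rule fps_linear_system_unique)
  then show ?thesis by (simp add: f_def algebra_simps)
qed

text \<open>Returns to \<open>a\<close> may be repeated any number of times before the last
  piece.\<close>

lemma tgf_geometric:
  assumes "0 < y" "a \<notin> T"
  shows "tgf y T a j = tgf y (insert a T) a j * inverse (1 - tgf y (insert a T) a a)"
proof -
  let ?B = "tgf y (insert a T) a a"
  have 1: "tgf y T a j * (1 - ?B) = tgf y (insert a T) a j"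
    using tgf_first_visit [OF assms, of a j] by (simp add: algebra_simps)
  have 2: "(1 - ?B) * inverse (1 - ?B) = 1"
    by (rule inverse_mult_eq_1') (simp add: tgf_nth_0)
  have "tgf y T a j = tgf y T a j * ((1 - ?B) * inverse (1 - ?B))" by (simp only: 2 mult_1_right)
  also have "\<dots> = tgf y (insert a T) a j * inverse (1 - ?B)"
    by (simp only: mult.assoc [symmetric] 1)
  finally show ?thesis .
qed

text \<open>The mirror image of the first-step recursion. It is required because a half-plane walk
  can only be extended at its end, where its height is known.\<close>

lemma tgf_last_step:
  assumes "0 < y"
  shows "tgf y {} i j = edge y i j + (\<Sum>k\<in>UNIV. tgf y {} i k * edge y k j)"
proof -
  define f where "f i = tgf y {} i j - edge y i j - (\<Sum>k\<in>UNIV. tgf y {} i k * edge y k j)" for i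
  have fs: "tgf y {} i k = edge y i k + (\<Sum>l\<in>UNIV. edge y i l * tgf y {} l k)" for i k
    using tgf_first_step [OF assms, of "{}" i k] by simp
  have "f i = (\<Sum>k\<in>UNIV. edge y i k * f k)" for i
  proof -
    have "(\<Sum>k\<in>UNIV. tgf y {} i k * edge y k j)
        = (\<Sum>k\<in>UNIV. edge y i k * edge y k j)
          + (\<Sum>k\<in>UNIV. \<Sum>l\<in>UNIV. edge y i l * tgf y {} l k * edge y k j)"
      by (subst fs) (simp add: distrib_right sum.distrib sum_distrib_right)
    also have "(\<Sum>k\<in>UNIV. \<Sum>l\<in>UNIV. edge y i l * tgf y {} l k * edge y k j)
        = (\<Sum>l\<in>UNIV. edge y i l * (\<Sum>k\<in>UNIV. tgf y {} l k * edge y k j))"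
      by (subst sum.swap) (simp add: sum_distrib_left mult.assoc)
    finally have "f i = (\<Sum>l\<in>UNIV. edge y i l * tgf y {} l j) - (\<Sum>k\<in>UNIV. edge y i k * edge y k j)
       - (\<Sum>l\<in>UNIV. edge y i l * (\<Sum>k\<in>UNIV. tgf y {} l k * edge y k j))"
      unfolding f_def using fs [of i j] by (simp add: algebra_simps)
    also have "\<dots> = (\<Sum>k\<in>UNIV. edge y i k * f k)"
      by (simp add: f_def sum_subtractf [symmetric] right_diff_distrib)
    finally show ?thesis .
  qed
  then have "f i = 0" unfolding edge_def by (rule fps_linear_system_unique)
  then show ?thesis by (simp add: f_def algebra_simps)
qed

text \<open>Between consecutive vertical steps the height does not change, so heights enter these series only
  through the last step and it suffices to keep them at \<open>y = 1\<close>.\<close>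

definition g :: "step \<Rightarrow> step \<Rightarrow> real fps" where
  "g i j = tgf 1 {North, South} i j"

lemma tgf_horizontal:
  "tgf y {North, South} i j = fps_const (y powi dy j) * g i j"
  unfolding g_def tgf_def
proof (rule walk_gf_height)
  fix w assume w: "w \<in> taboo_walks R {North, South} i j"
  then have "end_y (butlast w) = 0" by (intro end_y_horizontal) (simp add: taboo_walks_def)
  moreover have w': "w \<noteq> []" "last w = j" using w by (auto simp: taboo_walks_def)
  moreover have "end_y (butlast w @ [last w]) = end_y w"
    by (simp only: append_butlast_last_id [OF w'(1)])
  ultimately show "end_y w = dy j" by (simp only: end_simps add_0 add.right_neutral)
qed

lemma g_nonneg: "nonneg_coeffs (g i j)"
  unfolding g_def by (rule tgf_nonneg) simp

lemma g_nth_0: "fps_nth (g i j) 0 = 0"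
  unfolding g_def by (rule tgf_nth_0)

text \<open>Weight of a run of North steps joined by horizontal pieces: one factor \<open>y\<close>,
  then arbitrarily many factors \<open>y g North North\<close>. Heights above a South step enter the
  return series through this quantity only.\<close>

definition zeta :: "real \<Rightarrow> real fps" where
  "zeta y = fps_const y * inverse (1 - fps_const y * g North North)"

lemma zeta_eq: "zeta y * (1 - fps_const y * g North North) = fps_const y"
proof -
  have "inverse (1 - fps_const y * g North North) * (1 - fps_const y * g North North) = 1"
    by (rule inverse_mult_eq_1) (simp add: g_nth_0)
  then show ?thesis by (simp only: zeta_def mult.assoc mult_1_right)
qed

lemma zeta_eq': "fps_const y * (1 + zeta y * g North North) = zeta y"
  using zeta_eq [of y] by (simp add: algebra_simps)

lemma tgf_South:
  assumes "0 < y"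
  shows "tgf y {South} i j = fps_const (y powi dy j) * (g i j + zeta y * g i North * g North j)"
proof -
  have "tgf y {South} i j = tgf y {North, South} i j +
      tgf y {North, South} i North * (tgf y {North, South} North j * inverse (1 - tgf y {North, South} North North))"
    using tgf_first_visit [OF assms, of North "{South}" i j] tgf_geometric [OF assms, of North "{South}" j]
    by simp
  also have "\<dots> = fps_const (y powi dy j) * (g i j + zeta y * g i North * g North j)"
    by (simp add: tgf_horizontal zeta_def algebra_simps)
  finally show ?thesis .
qed

definition loop :: "real \<Rightarrow> real fps" where
  "loop y = tgf y {South} South South"

text \<open>Here and in the next two definitions the case \<open>\<theta> = South\<close> is
  degenerate: the piece after the last, or before the first, South step is empty and has weight 1,
  and there is no passage that avoids South.\<close>

definition tail :: "real \<Rightarrow> step \<Rightarrow> real fps" where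
  "tail y \<theta> = (if \<theta> = South then 1 else tgf y {South} South \<theta>)"

definition entry :: "real \<Rightarrow> step \<Rightarrow> real fps" where
  "entry y \<theta> = (if \<theta> = South then 1 else tgf y {South} \<theta> South)"

definition detour :: "real \<Rightarrow> step \<Rightarrow> real fps" where
  "detour y \<theta> = (if \<theta> = South then 0 else 1 + tgf y {South} \<theta> \<theta>)"

text \<open>The weight of \<open>k\<close> itself is left out; the summand 1 is the empty
  continuation.\<close>

definition all_from :: "real \<Rightarrow> step \<Rightarrow> step \<Rightarrow> real fps" where
  "all_from y k \<theta> = (if k = \<theta> then 1 else 0) + tgf y {} k \<theta>"

definition no_South :: "real \<Rightarrow> step \<Rightarrow> real fps" where
  "no_South y \<theta> = (if \<theta> = South then 0 else
     (\<Sum>k\<in>-{South}. unit_step y k * ((if k = \<theta> then 1 else 0) + tgf y {South} k \<theta>)))"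

definition to_South :: "real \<Rightarrow> real fps" where
  "to_South y = (\<Sum>k\<in>-{South}. unit_step y k * tgf y {South} k South)"

lemma all_from_South:
  assumes "0 < y"
  shows "(1 - loop y) * all_from y South \<theta> = tail y \<theta>"
  using tgf_first_visit [OF assms, of South "{}" South \<theta>]
  by (auto simp: all_from_def loop_def tail_def algebra_simps)

text \<open>Cut at the first South step, if there is one.\<close>

lemma all_from_not_South:
  assumes "0 < y"
  shows "(\<Sum>k\<in>-{South}. unit_step y k * all_from y k \<theta>)
    = no_South y \<theta> + to_South y * all_from y South \<theta>"
proof -
  have "all_from y k \<theta> = (if \<theta> = South then 0 else (if k = \<theta> then 1 else 0) + tgf y {South} k \<theta>)
      + tgf y {South} k South * all_from y South \<theta>" if "k \<noteq> South" for k
    using that tgf_first_visit [OF assms, of South "{}" k \<theta>]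
    by (auto simp: all_from_def algebra_simps)
  then have "(\<Sum>k\<in>-{South}. unit_step y k * all_from y k \<theta>) =
      (\<Sum>k\<in>-{South}. unit_step y k * ((if \<theta> = South then 0 else (if k = \<theta> then 1 else 0) + tgf y {South} k \<theta>)
      + tgf y {South} k South * all_from y South \<theta>))"
    by (intro sum.cong) auto
  also have "\<dots> = (\<Sum>k\<in>-{South}. unit_step y k * (if \<theta> = South then 0 else (if k = \<theta> then 1 else 0) + tgf y {South} k \<theta>))
      + to_South y * all_from y South \<theta>"
    by (simp only: distrib_left sum.distrib to_South_def sum_distrib_right mult.assoc)
  also have "(\<Sum>k\<in>-{South}. unit_step y k * (if \<theta> = South then 0 else (if k = \<theta> then 1 else 0) + tgf y {South} k \<theta>))
      = no_South y \<theta>"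
    by (simp add: no_South_def)
  finally show ?thesis .
qed

text \<open>Between two consecutive South steps there is either one horizontal piece or a run of
  North steps between two such pieces. The factor \<open>y\<close> clears the weight of the South
  step.\<close>

lemma loop_eq:
  "0 < y \<Longrightarrow> fps_const y * loop y = g South South + zeta y * (g South North * g North South)"
  by (simp add: loop_def tgf_South power_int_minus mult.assoc [symmetric])

text \<open>The series up to the first South step, after a first step that is not South, becomes
  affine in \<open>zeta\<close> when multiplied by \<open>y\<close>: \<open>q0\<close> collects the
  walks without North steps, \<open>n1\<close> is the coefficient of \<open>zeta\<close> for those
  with some.\<close>

definition q0 :: "real fps" where
  "q0 = unit_step 1 East * g East South + unit_step 1 West * g West South"

definition n1 :: "real fps" where
  "n1 = (fps_X + unit_step 1 East * g East North + unit_step 1 West * g West North) * g North South"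

lemma to_South_eq:
  assumes "0 < y"
  shows "fps_const y * to_South y = q0 + n1 * zeta y"
proof -
  have U: "- {South} = {East, North, West}" using UNIV_step by auto
  have E: "unit_step y East = unit_step 1 East" "unit_step y West = unit_step 1 West"
    "unit_step y North = fps_const y * fps_X"
    by (simp_all add: unit_step_def step_weight_def)
  have c: "fps_const y * tgf y {South} k South = g k South + zeta y * g k North * g North South" for k
    using assms by (simp add: tgf_South power_int_minus mult.assoc [symmetric])
  have "fps_const y * to_South y = unit_step 1 East * (fps_const y * tgf y {South} East South)
      + unit_step 1 West * (fps_const y * tgf y {South} West South)
      + fps_const y * fps_X * (fps_const y * tgf y {South} North South)"
    unfolding to_South_def U by (simp add: E algebra_simps)
  \<comment> \<open>A first step North is already the beginning of a run:
    \<open>y (1 + zeta g North North) = zeta\<close>.\<close>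
  also have "fps_const y * fps_X * (fps_const y * tgf y {South} North South)
     = fps_X * g North South * (fps_const y * (1 + zeta y * g North North))"
    by (simp only: c) (simp add: algebra_simps)
  also have "\<dots> = fps_X * g North South * zeta y" by (simp only: zeta_eq')
  finally show ?thesis unfolding c q0_def n1_def by (simp add: algebra_simps)
qed

text \<open>The numerator of \<open>all_from y \<theta> \<theta>\<close> over
  \<open>1 - loop\<close>, and hence a common denominator of \<open>B\<close>, \<open>C\<close> and
  \<open>D\<close>. For \<open>\<theta> = South\<close> it is 1.\<close>

definition den :: "real \<Rightarrow> step \<Rightarrow> real fps" where
  "den y \<theta> = detour y \<theta> * (1 - loop y) + entry y \<theta> * tail y \<theta>"

lemma all_from_self:
  assumes "0 < y"
  shows "all_from y \<theta> \<theta> * (1 - loop y) = den y \<theta>"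
proof -
  have "all_from y \<theta> \<theta> = detour y \<theta> + entry y \<theta> * all_from y South \<theta>"
    using tgf_first_visit [OF assms, of South "{}" \<theta> \<theta>]
    by (auto simp: all_from_def detour_def entry_def algebra_simps)
  then have "all_from y \<theta> \<theta> * (1 - loop y)
      = detour y \<theta> * (1 - loop y) + entry y \<theta> * ((1 - loop y) * all_from y South \<theta>)"
    by (simp add: algebra_simps)
  then show ?thesis by (simp only: all_from_South [OF assms] den_def)
qed

lemma B_walks_eq: "B_walks R \<theta> = taboo_walks R {\<theta>} \<theta> \<theta>"
  by (auto simp: B_walks_def taboo_walks_def walks_def ends_at_first_def successively_Cons)

lemma first_visit_walks:
  assumes "0 < y"
  shows "walk_gf {w \<in> walks R. ends_at_first \<theta> w \<and> hd w = k} x y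
    = unit_step y k * (if k = \<theta> then 1 else tgf y {\<theta>} k \<theta>)"
proof -
  have nz: "x \<noteq> 0" "y \<noteq> 0" using x_pos assms by auto
  have "{w \<in> walks R. ends_at_first \<theta> w \<and> hd w = k}
      = (#) k ` (if k = \<theta> then {[]} else taboo_walks R {\<theta>} k \<theta>)" (is "?L = ?M")
  proof (rule set_eqI)
    fix w show "w \<in> ?L \<longleftrightarrow> w \<in> ?M"
    proof (cases w)
      case (Cons j v)
      then show ?thesis
        by (cases "v = []") (auto simp: taboo_walks_def walks_def ends_at_first_def image_iff)
    qed (auto simp: walks_def)
  qed
  then show ?thesis by (simp only: walk_gf_Cons [OF nz]) (simp add: unit_step_def tgf_def)
qed

lemma C_walks_gf:
  assumes "0 < y"
  shows "walk_gf (C_walks R \<theta>) x y = (\<Sum>k\<in>-{South}. unit_step y k * (if k = \<theta> then 1 else tgf y {\<theta>} k \<theta>))"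
proof -
  have "C_walks R \<theta> = (\<Union>k\<in>-{South}. {w \<in> walks R. ends_at_first \<theta> w \<and> hd w = k})"
    by (auto simp: C_walks_def)
  then have "walk_gf (C_walks R \<theta>) x y
      = (\<Sum>k\<in>-{South}. walk_gf {w \<in> walks R. ends_at_first \<theta> w \<and> hd w = k} x y)"
    by (simp only:) (rule walk_gf_UN, auto)
  then show ?thesis by (simp only: first_visit_walks [OF assms])
qed

lemma D_walks_gf:
  assumes "0 < y"
  shows "walk_gf (D_walks R \<theta>) x y = unit_step y South * (if \<theta> = South then 1 else tgf y {\<theta>} South \<theta>)"
  using first_visit_walks [OF assms, of \<theta> South] by (auto simp: D_walks_def)

lemma first_visit_all_from:
  assumes "0 < y"
  shows "(if k = \<theta> then 1 else tgf y {\<theta>} k \<theta>) * all_from y \<theta> \<theta> = all_from y k \<theta>"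
  using tgf_first_visit [OF assms, of \<theta> "{}" k \<theta>] by (auto simp: all_from_def algebra_simps)

lemma B_all_from:
  assumes "0 < y"
  shows "(1 - walk_gf (B_walks R \<theta>) x y) * all_from y \<theta> \<theta> = 1"
  using tgf_first_visit [OF assms, of \<theta> "{}" \<theta> \<theta>]
  by (auto simp: B_walks_eq all_from_def tgf_def algebra_simps)

text \<open>First returns to \<open>\<theta>\<close> generate
  \<open>all_from y \<theta> \<theta> = 1 / (1 - B)\<close>. Where \<open>den\<close> is finite and
  nonzero, \<open>B = 1\<close> is therefore equivalent to \<open>loop = 1\<close>, which does not
  involve \<open>\<theta>\<close>.\<close>

lemma B_den:
  assumes "0 < y"
  shows "(1 - walk_gf (B_walks R \<theta>) x y) * den y \<theta> = 1 - loop y"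
  using B_all_from [OF assms, of \<theta>]
  by (simp only: all_from_self [OF assms, symmetric] mult.assoc [symmetric] mult_1_left)

lemma D_all_from:
  assumes "0 < y"
  shows "walk_gf (D_walks R \<theta>) x y * all_from y \<theta> \<theta> = unit_step y South * all_from y South \<theta>"
proof -
  have "walk_gf (D_walks R \<theta>) x y = unit_step y South * (if South = \<theta> then 1 else tgf y {\<theta>} South \<theta>)"
    using D_walks_gf [OF assms, of \<theta>] by (auto split: if_splits)
  then show ?thesis by (simp only: first_visit_all_from [OF assms] mult.assoc)
qed

lemma D_den:
  assumes "0 < y"
  shows "walk_gf (D_walks R \<theta>) x y * den y \<theta> = unit_step y South * tail y \<theta>"
proof -
  have "walk_gf (D_walks R \<theta>) x y * den y \<theta>
      = (walk_gf (D_walks R \<theta>) x y * all_from y \<theta> \<theta>) * (1 - loop y)"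
    by (simp only: all_from_self [OF assms, symmetric] mult.assoc)
  also have "\<dots> = unit_step y South * ((1 - loop y) * all_from y South \<theta>)"
    by (simp only: D_all_from [OF assms]) (simp only: mult_ac)
  finally show ?thesis by (simp only: all_from_South [OF assms])
qed

lemma C_den:
  assumes "0 < y"
  shows "walk_gf (C_walks R \<theta>) x y * den y \<theta> = no_South y \<theta> * (1 - loop y) + to_South y * tail y \<theta>"
proof -
  have "walk_gf (C_walks R \<theta>) x y * all_from y \<theta> \<theta> = (\<Sum>k\<in>-{South}. unit_step y k * all_from y k \<theta>)"
    by (simp only: C_walks_gf [OF assms] sum_distrib_right mult.assoc first_visit_all_from [OF assms])
  also have "\<dots> = no_South y \<theta> + to_South y * all_from y South \<theta>"
    by (rule all_from_not_South [OF assms])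
  finally have "walk_gf (C_walks R \<theta>) x y * all_from y \<theta> \<theta> * (1 - loop y)
     = no_South y \<theta> * (1 - loop y) + to_South y * ((1 - loop y) * all_from y South \<theta>)"
    by (simp add: algebra_simps)
  then show ?thesis by (simp only: all_from_South [OF assms] mult.assoc all_from_self [OF assms])
qed

text \<open>The factor \<open>den\<close> cancels in the quotient, so a common pole of
  \<open>B\<close> and \<open>D\<close> leaves no trace; only \<open>1 - loop\<close> can produce a
  pole.\<close>

lemma D_over_B:
  assumes "0 < y"
  shows "walk_gf (D_walks R \<theta>) x y / (1 - walk_gf (B_walks R \<theta>) x y) * (1 - loop y) = unit_step y South * tail y \<theta>"
proof -
  let ?B = "1 - walk_gf (B_walks R \<theta>) x y" and ?D = "walk_gf (D_walks R \<theta>) x y"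
  have b0: "fps_nth ?B 0 \<noteq> 0" by (simp add: B_walks_eq walk_gf_nth_0 taboo_walks_def)
  have "?D / ?B = ?D * inverse ?B" by (rule fps_divide_unit [OF b0])
  moreover have "inverse ?B = all_from y \<theta> \<theta>"
    by (rule fps_inverse_unique) (rule B_all_from [OF assms])
  ultimately have "?D / ?B = unit_step y South * all_from y South \<theta>" by (simp only: D_all_from [OF assms])
  then have "?D / ?B * (1 - loop y) = unit_step y South * ((1 - loop y) * all_from y South \<theta>)"
    by (simp only: mult_ac)
  then show ?thesis by (simp only: all_from_South [OF assms])
qed

section \<open>The functional equation of the half-plane series\<close>

lemma half_plane_last_step:
  "half_plane_walks R \<theta> = (if \<theta> = South then {} else {[\<theta>]}) \<union>
     (\<Union>i\<in>{i. R i \<theta>}. (\<lambda>w. w @ [\<theta>]) `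
        (half_plane_walks R i - (if \<theta> = South then {w \<in> half_plane_walks R i. end_y w = 0} else {})))"
    (is "?L = ?M")
proof (rule set_eqI)
  fix w
  have dyS: "dy s = -1 \<longleftrightarrow> s = South" "-1 \<le> dy s" for s by (cases s; simp)+
  show "w \<in> ?L \<longleftrightarrow> w \<in> ?M"
  proof (cases w rule: rev_cases)
    case Nil
    then show ?thesis by (auto simp: half_plane_walks_def walks_def)
  next
    case (snoc u s)
    have all_snoc: "(\<forall>k\<le>length w. 0 \<le> end_y (take k w)) \<longleftrightarrow>
        (\<forall>k\<le>length u. 0 \<le> end_y (take k u)) \<and> 0 \<le> end_y u + dy s"
    proof safe
      fix k assume *: "\<forall>k\<le>length w. 0 \<le> end_y (take k w)" and "k \<le> length u"
      then have "k \<le> length w" using snoc by simp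
      then have "0 \<le> end_y (take k w)" using * by blast
      then show "0 \<le> end_y (take k u)" using snoc \<open>k \<le> length u\<close> by simp
    next
      assume "\<forall>k\<le>length w. 0 \<le> end_y (take k w)"
      then have "0 \<le> end_y (take (length w) w)" by blast
      then show "0 \<le> end_y u + dy s" using snoc by simp
    next
      fix k assume "\<forall>k\<le>length u. 0 \<le> end_y (take k u)" "0 \<le> end_y u + dy s" "k \<le> length w"
      then show "0 \<le> end_y (take k w)" using snoc by (cases "k \<le> length u") auto
    qed
    show ?thesis
    proof (cases "u = []")
      case True
      have "dy \<theta> < 0 \<longleftrightarrow> \<theta> = South" by (cases \<theta>) auto
      then have "0 \<le> dy \<theta> \<longleftrightarrow> \<theta> \<noteq> South" by (metis not_le)
      then show ?thesis using True snoc all_snoc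
        by (auto simp: half_plane_walks_def walks_def)
    next
      case False
      have *: "w \<in> ?L \<longleftrightarrow> s = \<theta> \<and> R (last u) \<theta> \<and> u \<in> half_plane_walks R (last u) \<and> 0 \<le> end_y u + dy \<theta>"
        using False snoc all_snoc
        by (auto simp: half_plane_walks_def walks_def successively_append_iff)
      \<comment> \<open>A step lowers the height by at most 1, so only a South step taken at height
        0 leaves the half-plane.\<close>
      have "0 \<le> end_y u + dy \<theta> \<longleftrightarrow> \<not> (\<theta> = South \<and> end_y u = 0)"
        if "u \<in> half_plane_walks R (last u)"
      proof -
        have "0 \<le> end_y (take (length u) u)" using that unfolding half_plane_walks_def by blast
        then have "0 \<le> end_y u" by simp
        then show ?thesis by (cases \<theta>) auto
      qed
      moreover have last_u: "i = last u" if "u \<in> half_plane_walks R i" for i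
        using that by (simp add: half_plane_walks_def)
      moreover have "w \<in> ?M \<longleftrightarrow> s = \<theta> \<and> R (last u) \<theta> \<and> u \<in> half_plane_walks R (last u)
          \<and> \<not> (\<theta> = South \<and> end_y u = 0)"
      proof
        assume "w \<in> ?M"
        moreover have "w \<noteq> [\<theta>]" using False snoc by simp
        ultimately have "w \<in> (\<Union>i\<in>{i. R i \<theta>}. (\<lambda>w. w @ [\<theta>]) ` (half_plane_walks R i -
            (if \<theta> = South then {w \<in> half_plane_walks R i. end_y w = 0} else {})))"
          by (simp split: if_splits)
        then obtain i where i: "R i \<theta>" "w \<in> (\<lambda>w. w @ [\<theta>]) ` (half_plane_walks R i -
            (if \<theta> = South then {w \<in> half_plane_walks R i. end_y w = 0} else {}))"
          by blast
        from i(2) obtain v where v: "w = v @ [\<theta>]" "v \<in> half_plane_walks R i"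
          "v \<notin> (if \<theta> = South then {w \<in> half_plane_walks R i. end_y w = 0} else {})"
          by blast
        then have "v = u" "s = \<theta>" using snoc by auto
        moreover have "i = last u" using v last_u \<open>v = u\<close> by blast
        ultimately show "s = \<theta> \<and> R (last u) \<theta> \<and> u \<in> half_plane_walks R (last u)
          \<and> \<not> (\<theta> = South \<and> end_y u = 0)" using i(1) v by auto
      next
        assume *: "s = \<theta> \<and> R (last u) \<theta> \<and> u \<in> half_plane_walks R (last u)
          \<and> \<not> (\<theta> = South \<and> end_y u = 0)"
        then have "u \<in> half_plane_walks R (last u) -
            (if \<theta> = South then {w \<in> half_plane_walks R (last u). end_y w = 0} else {})" by auto
        with * snoc show "w \<in> ?M" by blast
      qed
      ultimately show ?thesis using * by blast
    qed
  qed
qed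

definition H :: "real \<Rightarrow> step \<Rightarrow> real fps" where
  "H y \<theta> = walk_gf (half_plane_walks R \<theta>) x y"

text \<open>The unknown of the kernel method: walks back at height 0 that may be followed by a South
  step. Their height is 0, so the series is independent of \<open>y\<close> and is recorded at
  \<open>y = 1\<close>.\<close>

definition K :: "real fps" where
  "K = (\<Sum>i\<in>UNIV. fps_const (of_bool (R i South)) * walk_gf {w \<in> half_plane_walks R i. end_y w = 0} x 1)"

lemma H_last_step:
  assumes "0 < y"
  shows "H y \<theta> = (if \<theta> = South then - unit_step y South * K else unit_step y \<theta>)
    + (\<Sum>i\<in>UNIV. H y i * edge y i \<theta>)"
proof -
  have nz: "x \<noteq> 0" "y \<noteq> 0" using x_pos assms by auto
  let ?Z = "\<lambda>i. {w \<in> half_plane_walks R i. end_y w = 0}"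
  let ?A = "\<lambda>i. half_plane_walks R i - (if \<theta> = South then ?Z i else {})"
  have Z: "walk_gf (?Z i) x y = walk_gf (?Z i) x 1" for i
    using walk_gf_height [of "?Z i" 0 x y] by simp
  have 1: "walk_gf (if \<theta> = South then {} else {[\<theta>]}) x y = (if \<theta> = South then 0 else unit_step y \<theta>)"
  proof -
    have "{[\<theta>]} = (#) \<theta> ` {[]}" by simp
    then have "walk_gf {[\<theta>]} x y = unit_step y \<theta>"
      unfolding unit_step_def by (simp only: walk_gf_Cons [OF nz] walk_gf_Nil) simp
    then show ?thesis by simp
  qed
  have A: "walk_gf (?A i) x y = H y i - (if \<theta> = South then walk_gf (?Z i) x 1 else 0)" for i
    unfolding H_def by (subst walk_gf_Diff) (auto simp: Z)
  have "walk_gf (\<Union>i\<in>{i. R i \<theta>}. (\<lambda>w. w @ [\<theta>]) ` ?A i) x y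
      = (\<Sum>i\<in>{i. R i \<theta>}. walk_gf ((\<lambda>w. w @ [\<theta>]) ` ?A i) x y)"
    by (rule walk_gf_UN) (auto simp: half_plane_walks_def)
  also have "\<dots> = (\<Sum>i\<in>{i. R i \<theta>}. edge y i \<theta> * walk_gf (?A i) x y)"
    by (intro sum.cong refl) (simp only: walk_gf_snoc [OF nz], simp add: edge_def)
  also have "\<dots> = (\<Sum>i\<in>UNIV. edge y i \<theta> * walk_gf (?A i) x y)"
    by (intro sum.mono_neutral_left) (auto simp: edge_def)
  also have "\<dots> = (\<Sum>i\<in>UNIV. H y i * edge y i \<theta>)
      - (if \<theta> = South then (\<Sum>i\<in>UNIV. edge y i \<theta> * walk_gf (?Z i) x 1) else 0)"
    by (simp add: A right_diff_distrib sum_subtractf mult.commute)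
  also have "(if \<theta> = South then (\<Sum>i\<in>UNIV. edge y i \<theta> * walk_gf (?Z i) x 1) else 0)
      = (if \<theta> = South then unit_step y South * K else 0)"
    by (auto simp: K_def edge_alt sum_distrib_left mult_ac)
  finally have 2: "walk_gf (\<Union>i\<in>{i. R i \<theta>}. (\<lambda>w. w @ [\<theta>]) ` ?A i) x y =
     (\<Sum>i\<in>UNIV. H y i * edge y i \<theta>) - (if \<theta> = South then unit_step y South * K else 0)" .
  have "H y \<theta> = walk_gf (if \<theta> = South then {} else {[\<theta>]}) x y +
      walk_gf (\<Union>i\<in>{i. R i \<theta>}. (\<lambda>w. w @ [\<theta>]) ` ?A i) x y"
    unfolding H_def
    by (subst half_plane_last_step, rule walk_gf_Un) (auto simp: half_plane_walks_def walks_def)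
  then show ?thesis using 1 2 by simp
qed

text \<open>Among all walks whose first step is not South, those that leave the half-plane consist
  of a walk ending at height 0, a South step, and an arbitrary continuation. The recursion on the
  last step proves this inclusion-exclusion.\<close>

lemma H_all_from:
  assumes "0 < y"
  shows "H y \<theta> = (\<Sum>k\<in>-{South}. unit_step y k * all_from y k \<theta>) - unit_step y South * K * all_from y South \<theta>"
proof -
  define f where "f \<theta> = H y \<theta> - ((\<Sum>k\<in>-{South}. unit_step y k * all_from y k \<theta>)
      - unit_step y South * K * all_from y South \<theta>)" for \<theta>
  have af: "all_from y k \<theta> = (if k = \<theta> then 1 else 0) + (\<Sum>i\<in>UNIV. all_from y k i * edge y i \<theta>)" for k \<theta>
  proof -
    have "(\<Sum>i\<in>UNIV. (if k = i then 1 else 0) * edge y i \<theta>) = (\<Sum>i\<in>UNIV. if k = i then edge y i \<theta> else 0)"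
      by (intro sum.cong) auto
    then show ?thesis using tgf_last_step [OF assms, of k \<theta>]
      by (simp add: all_from_def distrib_right sum.distrib)
  qed
  have "f \<theta> = (\<Sum>i\<in>UNIV. edge y i \<theta> * f i)" for \<theta>
  proof -
    have 1: "(\<Sum>k\<in>-{South}. unit_step y k * all_from y k \<theta>) = (if \<theta> = South then 0 else unit_step y \<theta>)
        + (\<Sum>i\<in>UNIV. (\<Sum>k\<in>-{South}. unit_step y k * all_from y k i) * edge y i \<theta>)"
    proof -
      have "(\<Sum>k\<in>-{South}. unit_step y k * all_from y k \<theta>) =
          (\<Sum>k\<in>-{South}. unit_step y k * (if k = \<theta> then 1 else 0))
          + (\<Sum>k\<in>-{South}. \<Sum>i\<in>UNIV. unit_step y k * all_from y k i * edge y i \<theta>)"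
        by (subst af) (simp only: distrib_left sum.distrib sum_distrib_left mult.assoc)
      also have "(\<Sum>k\<in>-{South}. unit_step y k * (if k = \<theta> then 1 else 0))
          = (\<Sum>k\<in>-{South}. if k = \<theta> then unit_step y k else 0)"
        by (intro sum.cong) auto
      also have "\<dots> = (if \<theta> = South then 0 else unit_step y \<theta>)" by (subst sum.delta) auto
      also have "(\<Sum>k\<in>-{South}. \<Sum>i\<in>UNIV. unit_step y k * all_from y k i * edge y i \<theta>)
          = (\<Sum>i\<in>UNIV. (\<Sum>k\<in>-{South}. unit_step y k * all_from y k i) * edge y i \<theta>)"
        by (subst sum.swap) (simp only: sum_distrib_right)
      finally show ?thesis .
    qed
    have 2: "unit_step y South * K * all_from y South \<theta> = (if \<theta> = South then unit_step y South * K else 0)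
        + (\<Sum>i\<in>UNIV. unit_step y South * K * all_from y South i * edge y i \<theta>)"
      by (subst af) (auto simp: distrib_left sum_distrib_left mult.assoc)
    have "f \<theta> = (\<Sum>i\<in>UNIV. H y i * edge y i \<theta>)
       - (\<Sum>i\<in>UNIV. (\<Sum>k\<in>-{South}. unit_step y k * all_from y k i) * edge y i \<theta>)
       + (\<Sum>i\<in>UNIV. unit_step y South * K * all_from y South i * edge y i \<theta>)"
      unfolding f_def using H_last_step [OF assms, of \<theta>] 1 2 by auto
    also have "\<dots> = (\<Sum>i\<in>UNIV. edge y i \<theta> * f i)"
      unfolding sum_subtractf [symmetric] sum.distrib [symmetric] f_def
      by (intro sum.cong) (simp_all only: algebra_simps)
    finally show ?thesis .
  qed
  then have "f \<theta> = 0" unfolding edge_def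
    by (rule fps_linear_system_unique [where c = "\<lambda>\<theta> i. step_weight x y \<theta> * of_bool (R i \<theta>)"])
  then show ?thesis by (simp add: f_def)
qed

text \<open>Walks without South steps never leave the half-plane and are split off. For the rest,
  \<open>1 - loop\<close> is the kernel and \<open>K\<close> the only unknown on the right, common
  to all \<open>y\<close> and all \<open>\<theta>\<close>.\<close>

lemma H_eq:
  assumes "0 < y"
  shows "(H y \<theta> - no_South y \<theta>) * (1 - loop y) = (to_South y - unit_step y South * K) * tail y \<theta>"
proof -
  have "H y \<theta> - no_South y \<theta> = (to_South y - unit_step y South * K) * all_from y South \<theta>"
    unfolding H_all_from [OF assms] all_from_not_South [OF assms] by (simp add: algebra_simps)
  then have "(H y \<theta> - no_South y \<theta>) * (1 - loop y)
      = (to_South y - unit_step y South * K) * ((1 - loop y) * all_from y South \<theta>)"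
    by (simp only: mult_ac)
  then show ?thesis by (simp only: all_from_South [OF assms])
qed

end

section \<open>The critical point of the kernel\<close>

lemma conv_at_coeff_le:
  assumes "nonneg_coeffs F" "\<And>n. fps_nth F n \<le> fps_nth G n" "conv_at G t" "0 \<le> t"
  shows "conv_at F t"
proof -
  obtain s where s: "t < s" "conv_at G s" using conv_at_enlarge [OF assms(3)] .
  have "summable (\<lambda>n. fps_nth G n * s ^ n)"
    using s assms(4) by (intro summable_fps) (simp add: conv_at_def)
  then have "summable (\<lambda>n. fps_nth F n * s ^ n)"
  proof (rule summable_comparison_test' [of _ 0])
    show "norm (fps_nth F n * s ^ n) \<le> fps_nth G n * s ^ n" for n
      using assms s by (simp add: abs_mult nonneg_coeffs_def mult_right_mono)
  qed
  then have "ereal (norm s) \<le> fps_conv_radius F"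
    unfolding fps_conv_radius_def by (rule conv_radius_geI)
  moreover have "ereal t < ereal (norm s)" using s assms(4) by simp
  ultimately show ?thesis unfolding conv_at_def by (rule less_le_trans [rotated])
qed

lemma eval_coeff_mono:
  assumes "\<And>n. fps_nth F n \<le> fps_nth G n" "conv_at F t" "conv_at G t" "0 \<le> t"
  shows "eval_fps F t \<le> eval_fps (G :: real fps) t"
  unfolding eval_fps_def using assms
  by (intro suminf_le summable_fps) (auto simp: conv_at_def intro!: mult_right_mono)

text \<open>The combinatorial content of the hypotheses on the rule: passages between any two steps,
  a South-South passage without North (the rule is not north-bound) and a North-North passage
  without South (it is not south-bound). They make \<open>G\<close>, \<open>A\<close> and
  \<open>N\<close> nonzero.\<close>

locale vertical_rule = rule_weights +
  assumes irreducible: "\<And>i j. taboo_walks R {} i j \<noteq> {}"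
    and South_loop: "taboo_walks R {North} South South \<noteq> {}"
    and North_loop: "taboo_walks R {South} North North \<noteq> {}"
begin

lemma tgf_nonzero:
  assumes "0 < y" "taboo_walks R T i j \<noteq> {}"
  shows "tgf y T i j \<noteq> 0"
proof -
  obtain w where "w \<in> taboo_walks R T i j" using assms by auto
  then have "0 < fps_nth (tgf y T i j) (length w)"
    unfolding tgf_def by (intro walk_gf_nth_pos x_pos assms)
  then show ?thesis by (metis fps_zero_nth less_irrefl)
qed

lemma tgf_from_South_nonzero: "0 < y \<Longrightarrow> tgf y {South} South \<theta> \<noteq> 0"
  using tgf_nonzero [OF _ irreducible, of y South \<theta>] tgf_geometric [of y South "{}" \<theta>] by auto

lemma tgf_to_South_nonzero: "0 < y \<Longrightarrow> tgf y {South} \<theta> South \<noteq> 0"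
  using tgf_nonzero [OF _ irreducible, of y \<theta> South] tgf_first_visit [of y South "{}" \<theta> South] by auto

lemma g_South_North: "g South North \<noteq> 0"
  using tgf_from_South_nonzero [of 1 North] tgf_South [of 1 South North] by auto

lemma g_North_South: "g North South \<noteq> 0"
  using tgf_to_South_nonzero [of 1 North] tgf_South [of 1 North South] by auto

lemma g_South_South: "g South South \<noteq> 0"
  using tgf_nonzero [OF _ South_loop, of 1] tgf_geometric [of 1 South "{North}" South]
  by (auto simp: g_def insert_commute)

lemma g_North_North: "g North North \<noteq> 0"
  using tgf_nonzero [OF _ North_loop, of 1] tgf_geometric [of 1 North "{South}" North]
  by (auto simp: g_def)

text \<open>On a walk from South to \<open>k\<close>, the piece after the last vertical step before
  \<open>k\<close> is horizontal up to its end.\<close>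

lemma g_entry:
  obtains i where "i \<in> {North, South}" "g i k \<noteq> 0"
proof (cases "g North k = 0")
  case True
  then have "g South k \<noteq> 0"
    using tgf_from_South_nonzero [of 1 k] tgf_South [of 1 South k] by auto
  then show ?thesis using that by auto
qed (use that in auto)

lemma g_exit:
  obtains j where "j \<in> {North, South}" "g k j \<noteq> 0"
proof (cases "g k North = 0")
  case True
  then have "g k South \<noteq> 0"
    using tgf_to_South_nonzero [of 1 k] tgf_South [of 1 k South] by auto
  then show ?thesis using that by auto
qed (use that in auto)

lemma tgf_visit:
  assumes "0 < y" "a \<notin> T"
  shows "tgf y T i j = tgf y (insert a T) i j
      + tgf y (insert a T) i a * tgf y (insert a T) a j * inverse (1 - tgf y (insert a T) a a)"
  by (subst tgf_first_visit [OF assms], subst tgf_geometric [OF assms]) (simp add: mult.assoc)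

text \<open>Lifting the taboo on one step keeps convergence as long as its return series is below 1.
  Lifting it on East and then on West leads from single steps to the series
  \<open>g\<close>.\<close>

lemma conv_at_step:
  assumes "0 < y" "a \<notin> T" "0 \<le> t" "\<And>i j. conv_at (tgf y (insert a T) i j) t"
    "eval_fps (tgf y (insert a T) a a) t < 1"
  shows "conv_at (tgf y T i j) t"
  unfolding tgf_visit [OF assms(1,2), of i j] using assms
  by (intro conv_at_add conv_at_mult conv_at_geometric tgf_nonneg tgf_nth_0)

lemma rational_tgf_step:
  assumes "0 < y" "a \<notin> T" "\<And>i j. rational_fps (tgf y (insert a T) i j)"
  shows "rational_fps (tgf y T i j)"
  unfolding tgf_visit [OF assms(1,2), of i j] using assms
  by (intro rational_fps_add rational_fps_mult rational_fps_geometric tgf_nth_0)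

lemma tgf_all_taboo: "0 < y \<Longrightarrow> tgf y {East, West, North, South} i j = edge y i j"
proof -
  assume y: "0 < y"
  have "{East, West, North, South} = UNIV" using UNIV_step by auto
  then show ?thesis using tgf_first_step [OF y, of "{East, West, North, South}" i j] by simp
qed

lemma rational_g: "rational_fps (g i j)"
proof -
  have 1: "rational_fps (tgf 1 {East, West, North, South} i j)" for i j
    by (simp only: tgf_all_taboo edge_def zero_less_one)
       (rule rational_fps_mult rational_fps_const rational_fps_X)+
  have 2: "rational_fps (tgf 1 {West, North, South} i j)" for i j
    by (rule rational_tgf_step [of 1 East]) (use 1 in simp_all)
  show ?thesis unfolding g_def by (rule rational_tgf_step [of 1 West]) (use 2 in simp_all)
qed

lemma conv_at_g:
  assumes "0 \<le> t" "eval_fps (tgf 1 {East, West, North, South} East East) t < 1"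
    "eval_fps (tgf 1 {West, North, South} West West) t < 1"
  shows "conv_at (tgf 1 {West, North, South} i j) t" "conv_at (g i j) t"
proof -
  have 1: "conv_at (tgf 1 {East, West, North, South} i j) t" for i j
    by (simp only: tgf_all_taboo edge_def zero_less_one) (intro conv_at_mult conv_at_simps)
  show 2: "conv_at (tgf 1 {West, North, South} i j) t" for i j
    by (rule conv_at_step [of 1 East]) (use 1 assms in simp_all)
  show "conv_at (g i j) t"
    unfolding g_def by (rule conv_at_step [of 1 West]) (use 2 assms in simp_all)
qed

section \<open>The common domain of convergence and the existence of the critical point\<close>

lemma coeff_tgf_mono:
  assumes "T \<subseteq> T'"
  shows "fps_nth (tgf 1 T' i j) n \<le> fps_nth (tgf 1 T i j) n"
proof -
  have "{w \<in> taboo_walks R T' i j. length w = n} \<subseteq> {w \<in> taboo_walks R T i j. length w = n}"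
    using assms by (auto simp: taboo_walks_def)
  then show ?thesis unfolding tgf_def walk_gf_nth using x_pos
    by (intro sum_mono2) (auto simp: finite_length_eq)
qed

text \<open>If \<open>X = F / (1 - F)\<close> is bounded by \<open>C\<close> below \<open>t\<close>,
  then \<open>F = X / (1 + X)\<close> is at most \<open>C / (1 + C)\<close> there, and by continuity
  also at \<open>t\<close>.\<close>

lemma geometric_bounded:
  assumes F: "nonneg_coeffs F" "fps_nth F 0 = 0" "conv_at F t" "0 < t"
    and X: "\<And>s. 0 \<le> s \<Longrightarrow> s < t \<Longrightarrow> conv_at (F * inverse (1 - F)) s"
      "\<And>s. 0 \<le> s \<Longrightarrow> s < t \<Longrightarrow> eval_fps (F * inverse (1 - F)) s \<le> C"
  shows "eval_fps F t < 1"
proof -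
  let ?X = "F * inverse (1 - F)"
  have nnX: "nonneg_coeffs ?X" using F by (intro nonneg_coeffs_mult nonneg_coeffs_geometric)
  have C: "0 \<le> C"
    using X(1,2) [of 0] F(4) eval_nonneg [OF nnX, of 0] by force
  have "inverse (1 - F) * (1 - F) = 1" by (rule inverse_mult_eq_1) (simp add: F)
  then have XF: "?X * (1 - F) = F" by (simp only: mult.assoc mult_1_right)
  have le: "eval_fps F s \<le> C / (1 + C)" if s: "0 \<le> s" "s < t" for s
  proof -
    have cF: "conv_at F s" using F(3) s conv_at_mono by (metis less_imp_le)
    have "eval_fps (?X * (1 - F)) s = eval_fps ?X s * (1 - eval_fps F s)"
      using X(1) s cF by (simp add: ev_mult [of _ s] ev_diff [of _ s] conv_at_diff)
    then have eq: "eval_fps F s = eval_fps ?X s * (1 - eval_fps F s)" by (simp only: XF)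
    have nn: "0 \<le> eval_fps ?X s" "0 \<le> eval_fps F s"
      using eval_nonneg nnX X(1) F(1) cF s by auto
    have "eval_fps F s < 1"
    proof (rule ccontr)
      assume "\<not> eval_fps F s < 1"
      then have "eval_fps ?X s * (1 - eval_fps F s) \<le> 0" using nn by (intro mult_nonneg_nonpos) auto
      then show False using eq \<open>\<not> eval_fps F s < 1\<close> by linarith
    qed
    then have "eval_fps ?X s * (1 - eval_fps F s) \<le> C * (1 - eval_fps F s)"
      using X(2) s by (intro mult_right_mono) auto
    then have "eval_fps F s * (1 + C) \<le> C" using eq by (simp add: algebra_simps)
    then show ?thesis using C by (simp add: pos_le_divide_eq)
  qed
  have "isCont (eval_fps F) t" by (rule isCont_eval) (use F in simp)
  then have "(eval_fps F \<longlongrightarrow> eval_fps F t) (at_left t)"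
    unfolding isCont_def by (rule tendsto_within_subset) simp
  moreover have "eventually (\<lambda>s. eval_fps F s \<le> C / (1 + C)) (at_left t)"
    using le F(4) by (intro eventually_at_leftI [of 0]) auto
  ultimately have "eval_fps F t \<le> C / (1 + C)"
    by (intro tendsto_upperbound [of _ _ "at_left t"]) auto
  also have "\<dots> < 1" using C by simp
  finally show ?thesis .
qed

definition conv_dom :: "real \<Rightarrow> bool" where
  "conv_dom t \<longleftrightarrow> 0 \<le> t \<and> (\<forall>i j. conv_at (g i j) t)"

definition gv :: "step \<Rightarrow> step \<Rightarrow> real \<Rightarrow> real" where
  "gv i j t = eval_fps (g i j) t"

lemma domD: "conv_dom t \<Longrightarrow> conv_at (g i j) t" "conv_dom t \<Longrightarrow> 0 \<le> t"
  by (auto simp: conv_dom_def)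

lemma dom_mono: "conv_dom t \<Longrightarrow> 0 \<le> s \<Longrightarrow> s \<le> t \<Longrightarrow> conv_dom s"
  by (auto simp: conv_dom_def intro: conv_at_mono)

lemma dom_0: "conv_dom 0"
proof -
  have "eval_fps (tgf 1 T k k) 0 = 0" for T k by (simp add: eval_fps_at_0 tgf_nth_0)
  then have "conv_at (g i j) 0" for i j by (intro conv_at_g) auto
  then show ?thesis by (simp add: conv_dom_def)
qed

lemma dom_enlarge:
  assumes "conv_dom t"
  obtains s where "t < s" "conv_dom s"
proof -
  have "\<exists>s. t < s \<and> conv_at (g i j) s" for i j
    using conv_at_enlarge [OF domD(1) [OF assms, of i j]] by metis
  then obtain f where f: "\<And>i j. t < f i j \<and> conv_at (g i j) (f i j)" by metis
  define s where "s = Min ((\<lambda>(i, j). f i j) ` UNIV)"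
  have "s \<le> f i j" for i j unfolding s_def by (rule Min_le) auto
  then have "conv_at (g i j) s" for i j using f conv_at_mono by blast
  moreover have "t < s" unfolding s_def using f by (subst Min_gr_iff) auto
  ultimately show ?thesis using that domD(2) [OF assms] by (auto simp: conv_dom_def)
qed

lemma gv_nonneg: "conv_dom t \<Longrightarrow> 0 \<le> gv i j t"
  unfolding gv_def conv_dom_def by (auto intro!: eval_nonneg g_nonneg)

lemma gv_pos: "conv_dom t \<Longrightarrow> 0 < t \<Longrightarrow> g i j \<noteq> 0 \<Longrightarrow> 0 < gv i j t"
  unfolding gv_def conv_dom_def by (auto intro!: eval_pos g_nonneg)

lemma gv_mono: "conv_dom t \<Longrightarrow> 0 \<le> s \<Longrightarrow> s \<le> t \<Longrightarrow> gv i j s \<le> gv i j t"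
  unfolding gv_def conv_dom_def by (auto intro!: eval_mono g_nonneg)

lemma gv_strict_mono: "conv_dom t \<Longrightarrow> 0 \<le> s \<Longrightarrow> s < t \<Longrightarrow> g i j \<noteq> 0 \<Longrightarrow> gv i j s < gv i j t"
  unfolding gv_def conv_dom_def by (auto intro!: eval_strict_mono g_nonneg g_nth_0)

lemma gv_0: "gv i j 0 = 0"
  by (simp add: gv_def eval_fps_at_0 g_nth_0)

lemma gv_deriv: "conv_dom t \<Longrightarrow> (gv i j has_real_derivative eval_fps (fps_deriv (g i j)) t) (at t)"
  unfolding gv_def conv_dom_def by (intro has_field_derivative_eval_fps) (auto simp: conv_at_def)

lemma gv_isCont: "conv_dom t \<Longrightarrow> isCont (gv i j) t"
  using gv_deriv DERIV_isCont by blast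

lemma gv_deriv_pos:
  assumes "conv_dom t" "0 < t" "g i j \<noteq> 0"
  shows "0 < eval_fps (fps_deriv (g i j)) t"
proof -
  have "conv_at (fps_deriv (g i j)) t"
    using assms fps_conv_radius_deriv [of "g i j"] unfolding conv_dom_def conv_at_def by (metis less_le_trans)
  moreover have "nonneg_coeffs (fps_deriv (g i j))"
    using g_nonneg by (auto simp: nonneg_coeffs_def)
  moreover have "fps_deriv (g i j) \<noteq> 0"
  proof
    assume "fps_deriv (g i j) = 0"
    then have "g i j = fps_const (fps_nth (g i j) 0)" by (simp only: fps_deriv_eq_0_iff)
    then show False using assms(3) by (simp add: g_nth_0)
  qed
  ultimately show ?thesis using assms by (intro eval_pos) auto
qed

text \<open>A return from \<open>k\<close> to \<open>k\<close> can be inserted into a fixed passage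
  from a vertical step through \<open>k\<close> to a vertical step. So \<open>g k k\<close> cannot
  blow up unless one of the four series between vertical steps does.\<close>

lemma g_via:
  assumes "k \<in> {East, West}"
  shows "\<exists>P i j. P \<noteq> 0 \<and> nonneg_coeffs P \<and> i \<in> {North, South} \<and> j \<in> {North, South} \<and>
    (\<forall>t. conv_dom t \<longrightarrow> conv_at P t \<and> eval_fps P t * gv k k t \<le> gv i j t)"
proof -
  obtain i where i: "i \<in> {North, South}" "g i k \<noteq> 0" by (rule g_entry)
  obtain j where j: "j \<in> {North, South}" "g k j \<noteq> 0" by (rule g_exit)
  let ?T = "{k, North, South}"
  let ?f = "tgf 1 ?T"
  have k: "k \<notin> {North, South}" using assms by auto
  have nn: "nonneg_coeffs (?f a b)" for a b by (intro tgf_nonneg) simp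
  have 1: "g i' k = ?f i' k + ?f i' k * g k k" for i'
    using tgf_first_visit [OF _ k, of 1 i' k] by (simp add: g_def)
  have 2: "g i' j = ?f i' j + ?f i' k * g k j" for i'
    using tgf_first_visit [OF _ k, of 1 i' j] by (simp add: g_def)
  have 3: "g k j = ?f k j * inverse (1 - ?f k k)" "g k k = ?f k k * inverse (1 - ?f k k)"
    using tgf_geometric [OF _ k, of 1] by (simp_all add: g_def)
  have I: "(1 - ?f k k) * inverse (1 - ?f k k) = 1"
    by (rule inverse_mult_eq_1') (simp add: tgf_nth_0)
  have 4: "g k j = ?f k j + ?f k j * g k k"
  proof -
    have "1 + g k k = inverse (1 - ?f k k)" using I 3(2) by (simp add: algebra_simps)
    then have "g k j = ?f k j * (1 + g k k)" using 3(1) by (simp only:)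
    then show ?thesis by (simp add: distrib_left)
  qed
  have n1: "?f i k \<noteq> 0" using 1 [of i] i by auto
  have n2: "?f k j \<noteq> 0" using 4 j by auto
  have cf: "conv_at (?f a b) t" if "conv_dom t" for a b t
  proof -
    have "fps_nth (?f a b) n \<le> fps_nth (g a b) n" for n
      unfolding g_def by (rule coeff_tgf_mono) auto
    then show ?thesis using conv_at_coeff_le [OF nn] domD [OF that] by blast
  qed
  show ?thesis
  proof (intro exI conjI allI impI)
    show "?f i k * ?f k j \<noteq> 0" using n1 n2 by simp
    show "nonneg_coeffs (?f i k * ?f k j)" using nn by blast
    fix t assume t: "conv_dom t"
    show c: "conv_at (?f i k * ?f k j) t" using cf [OF t] by blast
    have "g i j = ?f i j + ?f i k * ?f k j + ?f i k * ?f k j * g k k"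
      by (subst 2, subst 4) (simp add: algebra_simps)
    then have "gv i j t = eval_fps (?f i j + ?f i k * ?f k j + ?f i k * ?f k j * g k k) t"
      by (simp add: gv_def)
    also have "\<dots> = eval_fps (?f i j) t + eval_fps (?f i k * ?f k j) t + eval_fps (?f i k * ?f k j) t * gv k k t"
      using cf [OF t] c t domD [OF t] by (simp add: ev_add [of _ t] ev_mult [of _ t] conv_at_add conv_at_mult gv_def)
    also have "\<dots> \<ge> eval_fps (?f i k * ?f k j) t * gv k k t"
      using eval_nonneg [OF nn cf [OF t]] eval_nonneg [OF _ c] nn domD(2) [OF t] by (simp add: nonneg_coeffs_mult)
    finally show "eval_fps (?f i k * ?f k j) t * gv k k t \<le> gv i j t" .
  qed (use i j in auto)
qed

text \<open>Splitting a return to \<open>South\<close> at its \<open>North\<close> steps gives the return series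
  \<open>A / y + G / (1 - y N)\<close>.  Equating it to 1 is the kernel equation \<open>N y\<^sup>2 - (1 + A N - G) y + A = 0\<close>,
  with discriminant \<open>(1 - (sqrt (A N) + sqrt G)\<^sup>2) (1 - (sqrt (A N) - sqrt G)\<^sup>2)\<close>; hence its two
  roots first meet where \<open>crit\<close> reaches 1.\<close>

definition A where "A t = gv South South t"
definition N where "N t = gv North North t"
definition G where "G t = gv South North t * gv North South t"
definition crit where "crit t = sqrt (A t * N t) + sqrt (G t)"

text \<open>Bounds on the four series between vertical steps bound the horizontal returns. These
  bounds keep the East loop, and then the West loop, below 1 at \<open>t\<close> itself, so no
  series diverges at \<open>t\<close>.\<close>

lemma dom_extend:
  assumes "0 < t" "\<And>s. 0 \<le> s \<Longrightarrow> s < t \<Longrightarrow> conv_dom s"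
    and "\<And>s i j. 0 \<le> s \<Longrightarrow> s < t \<Longrightarrow> i \<in> {North, South} \<Longrightarrow> j \<in> {North, South} \<Longrightarrow> gv i j s \<le> C"
  shows "conv_dom t"
proof -
  have bd: "\<exists>C'. \<forall>s. 0 \<le> s \<and> s < t \<longrightarrow> gv k k s \<le> C'" if k: "k \<in> {East, West}" for k
  proof -
    obtain P i j where P: "P \<noteq> 0" "nonneg_coeffs P" "i \<in> {North, South}" "j \<in> {North, South}"
      "\<And>t. conv_dom t \<Longrightarrow> conv_at P t \<and> eval_fps P t * gv k k t \<le> gv i j t"
      using g_via [OF k] by blast
    \<comment> \<open>On \<open>[t/2, t)\<close> the factor \<open>P\<close> is at least its
      positive value at \<open>t/2\<close>; below \<open>t/2\<close> monotonicity of
      \<open>gv\<close> suffices.\<close>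
    define p where "p = eval_fps P (t/2)"
    have dp: "conv_dom (t/2)" using assms by auto
    have p: "0 < p" unfolding p_def using P dp assms by (intro eval_pos) auto
    have "gv k k s \<le> C / p" if s: "t/2 \<le> s" "s < t" for s
    proof -
      have ds: "conv_dom s" using assms s by auto
      have "p * gv k k s \<le> eval_fps P s * gv k k s"
        unfolding p_def using P ds s assms by (intro mult_right_mono eval_mono gv_nonneg) auto
      also have "\<dots> \<le> gv i j s" using P(5) ds by blast
      also have "\<dots> \<le> C" using assms s P by auto
      finally show ?thesis using p by (simp add: pos_le_divide_eq mult.commute)
    qed note 1 = this
    have "gv k k s \<le> C / p" if s: "0 \<le> s" "s < t" for s
    proof (cases "t/2 \<le> s")
      case False
      then have "gv k k s \<le> gv k k (t/2)" using s dp by (intro gv_mono) auto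
      also have "\<dots> \<le> C / p" using 1 [of "t/2"] assms by auto
      finally show ?thesis .
    qed (use 1 s in auto)
    then show ?thesis by blast
  qed
  obtain CE CW where CE: "\<And>s. 0 \<le> s \<Longrightarrow> s < t \<Longrightarrow> gv East East s \<le> CE"
    and CW: "\<And>s. 0 \<le> s \<Longrightarrow> s < t \<Longrightarrow> gv West West s \<le> CW"
    using bd [of East] bd [of West] by blast
  let ?E = "{East, West, North, South}" and ?W = "{West, North, South}"
  have gE: "tgf 1 ?W East East = tgf 1 ?E East East * inverse (1 - tgf 1 ?E East East)"
    using tgf_geometric [of 1 East ?W East] by simp
  have gW: "g West West = tgf 1 ?W West West * inverse (1 - tgf 1 ?W West West)"
    unfolding g_def using tgf_geometric [of 1 West "{North, South}" West] by simp
  have coE: "fps_nth (tgf 1 ?W a b) n \<le> fps_nth (g a b) n" for a b n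
    unfolding g_def by (rule coeff_tgf_mono) auto
  have cW: "conv_at (tgf 1 ?W a b) s" if "conv_dom s" for a b s
  proof -
    have "nonneg_coeffs (tgf 1 ?W a b)" by (intro tgf_nonneg) simp
    then show ?thesis using conv_at_coeff_le coE domD [OF that] by blast
  qed
  have cE: "conv_at (tgf 1 ?E a b) t" for a b
    by (simp only: tgf_all_taboo edge_def zero_less_one) (intro conv_at_mult conv_at_simps)
  have 1: "eval_fps (tgf 1 ?E East East) t < 1"
  proof (rule geometric_bounded [of _ _ CE])
    fix s assume s: "0 \<le> s" "s < t"
    show "conv_at (tgf 1 ?E East East * inverse (1 - tgf 1 ?E East East)) s"
      using cW assms s gE by metis
    have "eval_fps (tgf 1 ?W East East) s \<le> gv East East s"
      unfolding gv_def using assms s coE cW by (intro eval_coeff_mono domD) auto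
    then show "eval_fps (tgf 1 ?E East East * inverse (1 - tgf 1 ?E East East)) s \<le> CE"
      unfolding gE using CE s by force
  qed (use assms cE in \<open>simp_all add: tgf_nonneg tgf_nth_0\<close>)
  have c: "conv_at (tgf 1 ?W a b) t" for a b
    by (rule conv_at_step [of 1 East]) (use 1 assms cE in simp_all)
  have 2: "eval_fps (tgf 1 ?W West West) t < 1"
  proof (rule geometric_bounded [of _ _ CW])
    fix s assume s: "0 \<le> s" "s < t"
    show "conv_at (tgf 1 ?W West West * inverse (1 - tgf 1 ?W West West)) s"
      using assms s gW domD(1) by metis
    show "eval_fps (tgf 1 ?W West West * inverse (1 - tgf 1 ?W West West)) s \<le> CW"
      using CW s gW by (simp add: gv_def)
  qed (use assms c in \<open>auto simp: tgf_nonneg tgf_nth_0\<close>)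
  show ?thesis unfolding conv_dom_def using assms conv_at_g(2) 1 2 by (auto simp: less_imp_le)
qed

lemma ANG_pos: "conv_dom t \<Longrightarrow> 0 < t \<Longrightarrow> 0 < A t" "conv_dom t \<Longrightarrow> 0 < t \<Longrightarrow> 0 < N t"
   "conv_dom t \<Longrightarrow> 0 < t \<Longrightarrow> 0 < G t"
  unfolding A_def N_def G_def
  using gv_pos g_South_South g_North_North g_South_North g_North_South by auto

text \<open>If \<open>crit\<close> stayed below 1, then \<open>A N\<close> and \<open>G\<close>
  would be below 1. Since each factor is bounded below away from 0, all four series would stay
  bounded and the domain could be extended without end. But then \<open>A N\<close> is unbounded on
  the half-line, a contradiction.\<close>

lemma crit_reaches_1: "\<exists>t. conv_dom t \<and> 0 < t \<and> 1 \<le> crit t"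
proof (rule ccontr)
  assume "\<not> ?thesis"
  then have lt: "crit t < 1" if "conv_dom t" "0 < t" for t using that by auto
  have AN: "A t * N t < 1" and G1: "G t < 1" if "conv_dom t" "0 < t" for t
  proof -
    have "sqrt (A t * N t) < 1" "sqrt (G t) < 1"
      using lt [OF that] ANG_pos [OF that] unfolding crit_def by (smt (verit) mult_pos_pos real_sqrt_gt_zero)+
    then show "A t * N t < 1" "G t < 1" by simp_all
  qed
  obtain t0 where t0: "0 < t0" "conv_dom t0" using dom_enlarge [OF dom_0] by metis
  have bound: "\<exists>C. \<forall>s i j. 0 \<le> s \<and> conv_dom s \<and> i \<in> {North, South} \<and> j \<in> {North, South} \<longrightarrow> gv i j s \<le> C"
  proof -
    define C where "C = 1 / A t0 + 1 / N t0 + 1 / gv South North t0 + 1 / gv North South t0"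
    have p: "0 < A t0" "0 < N t0" "0 < gv South North t0" "0 < gv North South t0"
      using ANG_pos t0 gv_pos g_South_North g_North_South by auto
    \<comment> \<open>A product below 1 with one factor bounded away from 0 bounds the other
      factor.\<close>
    have le: "u \<le> 1 / v" if "u * v' < 1" "v \<le> v'" "0 < v" "0 \<le> u" for u v v' :: real
    proof -
      have "u * v \<le> u * v'" using that by (intro mult_left_mono) auto
      then show ?thesis using that by (simp add: pos_le_divide_eq)
    qed
    have C: "gv i j s \<le> C" if s: "conv_dom s" "t0 \<le> s" and ij: "i \<in> {North, South}" "j \<in> {North, South}" for s i j
    proof -
      have s0: "0 < s" using s t0 by auto
      have m: "gv a b t0 \<le> gv a b s" for a b using s t0 by (intro gv_mono) auto
      have nn: "0 \<le> gv a b s" for a b using gv_nonneg s by blast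
      have "A s \<le> 1 / N t0" using AN [OF s(1) s0] m [of North North] p nn [of South South]
        by (intro le [of _ "N s"]) (auto simp: N_def A_def)
      moreover have "N s \<le> 1 / A t0" using AN [OF s(1) s0] m [of South South] p nn [of North North]
        by (intro le [of _ "A s"]) (auto simp: N_def A_def mult.commute)
      moreover have "gv South North s \<le> 1 / gv North South t0"
        using G1 [OF s(1) s0] m [of North South] p nn [of South North]
        by (intro le [of _ "gv North South s"]) (auto simp: G_def)
      moreover have "gv North South s \<le> 1 / gv South North t0"
        using G1 [OF s(1) s0] m [of South North] p nn [of North South]
        by (intro le [of _ "gv South North s"]) (auto simp: G_def mult.commute)
      moreover have "0 < 1 / A t0" "0 < 1 / N t0" "0 < 1 / gv South North t0" "0 < 1 / gv North South t0"
        using p by auto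
      ultimately have "A s \<le> C" "N s \<le> C" "gv South North s \<le> C" "gv North South s \<le> C"
        unfolding C_def by linarith+
      then show ?thesis using ij unfolding A_def N_def by auto
    qed
    have "gv i j s \<le> C" if s: "conv_dom s" "0 \<le> s" and ij: "i \<in> {North, South}" "j \<in> {North, South}" for s i j
    proof (cases "t0 \<le> s")
      case False
      then have "gv i j s \<le> gv i j t0" using s t0 by (intro gv_mono) auto
      also have "\<dots> \<le> C" using C t0 ij by blast
      finally show ?thesis .
    qed (use C s ij in auto)
    then show ?thesis by blast
  qed
  then obtain C where C: "\<And>s i j. conv_dom s \<Longrightarrow> i \<in> {North, South} \<Longrightarrow> j \<in> {North, South} \<Longrightarrow> gv i j s \<le> C"
    using domD(2) by metis
  have all: "conv_dom t" if "0 \<le> t" for t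
  proof (rule ccontr)
    assume nt: "\<not> conv_dom t"
    define S where "S = {s. conv_dom s}"
    have bdd: "bdd_above S" unfolding S_def
      by (rule bdd_aboveI [of _ t]) (use nt dom_mono that in \<open>force\<close>)
    define u where "u = Sup S"
    have "t0 \<le> u" unfolding u_def S_def using t0 bdd by (intro cSup_upper) (auto simp: S_def)
    moreover have ds: "conv_dom s" if s: "0 \<le> s" "s < u" for s
    proof -
      obtain r where "r \<in> S" "s < r" using s(2) less_cSup_iff [OF _ bdd] t0 unfolding u_def S_def by auto
      then show ?thesis using s dom_mono unfolding S_def by auto
    qed
    ultimately have "conv_dom u" using t0 C by (intro dom_extend [of u C]) auto
    then obtain r where "u < r" "conv_dom r" using dom_enlarge by blast
    then have "r \<le> u" unfolding u_def using bdd by (intro cSup_upper) (auto simp: S_def)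
    with \<open>u < r\<close> show False by simp
  qed
  obtain m where m: "fps_nth (g South South) m \<noteq> 0" using g_South_South by (auto simp: fps_eq_iff)
  then have "m \<noteq> 0" using g_nth_0 by (cases m) auto
  have cpos: "0 < fps_nth (g South South) m" using m g_nonneg by (metis nonneg_coeffs_def less_eq_real_def)
  have N1: "0 < N 1" using ANG_pos(2) all by simp
  \<comment> \<open>Chosen so that a single term of \<open>A\<close>, of degree at least 1, already
    gives \<open>A N \<ge> 1\<close>; taking \<open>t \<ge> 1\<close> allows \<open>t\<close> to be
    replaced by \<open>t^m\<close>.\<close>
  define t where "t = max 1 (1 / (fps_nth (g South South) m * N 1))"
  have t: "1 \<le> t" "1 / (fps_nth (g South South) m * N 1) \<le> t" by (auto simp: t_def)
  have "1 \<le> fps_nth (g South South) m * t * N 1" using t(2) cpos N1 by (simp add: field_simps)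
  also have "\<dots> \<le> fps_nth (g South South) m * t ^ m * N t"
  proof (intro mult_mono)
    show "t \<le> t ^ m" using t(1) \<open>m \<noteq> 0\<close> by (simp add: self_le_power)
    show "N 1 \<le> N t" unfolding N_def using all t by (intro gv_mono) auto
  qed (use cpos N1 t in auto)
  also have "\<dots> \<le> A t * N t"
  proof (rule mult_right_mono)
    show "fps_nth (g South South) m * t ^ m \<le> A t"
      unfolding A_def gv_def using all [of t] t by (intro eval_nonneg_ge g_nonneg domD(1)) auto
    show "0 \<le> N t" using all [of t] t by (simp add: N_def gv_nonneg)
  qed
  also have "\<dots> < 1" using AN all t by auto
  finally show False by simp
qed

lemma ANG_isCont:
  assumes "conv_dom t" shows "isCont A t" "isCont N t" "isCont G t" "isCont crit t"
proof -
  have e: "A = gv South South" "N = gv North North" "G = (\<lambda>t. gv South North t * gv North South t)"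
    "crit = (\<lambda>t. sqrt (gv South South t * gv North North t) + sqrt (gv South North t * gv North South t))"
    by (auto simp: A_def N_def G_def crit_def)
  show "isCont A t" "isCont N t" "isCont G t" "isCont crit t"
    unfolding e using gv_isCont [OF assms] by (auto intro!: continuous_intros)
qed

lemma ex_kap: "\<exists>t. conv_dom t \<and> 0 < t \<and> crit t = 1"
proof -
  obtain t where t: "conv_dom t" "0 < t" "1 \<le> crit t" using crit_reaches_1 by blast
  have "crit 0 = 0" by (simp add: crit_def A_def N_def G_def gv_0)
  then have "\<exists>s. 0 \<le> s \<and> s \<le> t \<and> crit s = 1"
    using t ANG_isCont(4) dom_mono [OF t(1)] by (intro IVT) auto
  then obtain s where s: "0 \<le> s" "s \<le> t" "crit s = 1" by blast
  then have "s \<noteq> 0" using \<open>crit 0 = 0\<close> by auto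
  then show ?thesis using s dom_mono t by (intro exI [of _ s]) auto
qed

text \<open>The choice is harmless: \<open>kappa_eq\<close> identifies whatever point is chosen with
  \<open>kappa R x\<close>.\<close>

definition kappa0 :: real where "kappa0 = (SOME t. conv_dom t \<and> 0 < t \<and> crit t = 1)"

lemma kappa0: "conv_dom kappa0" "0 < kappa0" "crit kappa0 = 1"
  using someI_ex [OF ex_kap] unfolding kappa0_def by auto

definition tau0 :: real where "tau0 = sqrt (A kappa0 / N kappa0)"

end

section \<open>Full-plane walks\<close>

lemma rat_val_sum:
  "(\<And>i. i \<in> I \<Longrightarrow> rat_val (F i) t (f i)) \<Longrightarrow> rat_val (\<Sum>i\<in>I. F i) t (\<Sum>i\<in>I. f i)"
  using rat_val_const [of 0 t]
  by (induction I rule: infinite_finite_induct) (simp_all add: rat_val_add)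

lemma rat_val_one: "rat_val 1 t 1" and rat_val_zero: "rat_val 0 t 0"
  using rat_val_const [of 1 t] rat_val_const [of 0 t] by simp_all

lemma rat_val_nonzero: "rat_val U t u \<Longrightarrow> u \<noteq> 0 \<Longrightarrow> U \<noteq> 0"
  using rat_eval_eq rat_val_zero by blast

lemma rat_val_div:
  assumes "F * U = X" "rat_val U t u" "rat_val X t v" "u \<noteq> 0"
  shows "rat_val F t (v / u)"
  using rat_val_quotient [OF assms(2,4) rat_val_nonzero [OF assms(2,4)] assms(3,1)] .

text \<open>At a zero of the numerator the quotient rule needs only continuity of the denominator.
  This avoids differentiating \<open>den\<close> in \<open>t\<close> and the composite denominators
  involving \<open>rho0\<close>.\<close>

lemma deriv_quotient_at_zero:
  fixes f :: "real \<Rightarrow> real"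
  assumes f: "(f has_real_derivative D) (at a)" "f a = 0" and m: "isCont m a" "m a \<noteq> 0"
    and F: "eventually (\<lambda>v. F v = c + f v / m v) (nhds a)"
  shows "(F has_real_derivative D / m a) (at a)"
proof -
  have Fa: "F a = c" using eventually_nhds_x_imp_x [OF F] f by simp
  have "((\<lambda>v. (f v - f a) / (v - a) / m v) \<longlongrightarrow> D / m a) (at a)"
    using f m unfolding has_field_derivative_iff isCont_def by (intro tendsto_divide)
  moreover have "eventually (\<lambda>v. (f v - f a) / (v - a) / m v = (F v - F a) / (v - a)) (at a)"
    using F unfolding eventually_at_filter
    by eventually_elim (simp add: f Fa)
  ultimately show ?thesis
    unfolding has_field_derivative_iff by (rule Lim_transform_eventually)
qed

lemma eventually_positive: "0 < (y :: real) \<Longrightarrow> eventually (\<lambda>v. 0 < v) (nhds y)"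
  using eventually_nhds_in_open [of "{0<..}" y] by simp

context vertical_rule
begin

definition zv :: "real \<Rightarrow> real \<Rightarrow> real" where
  "zv t y = y / (1 - y * N t)"

text \<open>The condition \<open>y N(t) < 1\<close> is convergence of the geometric series in
  \<open>zeta\<close>. The return series \<open>loop\<close> then converges as well, but it may
  exceed 1.\<close>

definition admissible :: "real \<Rightarrow> real \<Rightarrow> bool" where
  "admissible t y \<longleftrightarrow> conv_dom t \<and> 0 < t \<and> 0 < y \<and> y * N t < 1"

definition sv :: "step \<Rightarrow> step \<Rightarrow> real \<Rightarrow> real \<Rightarrow> real" where
  "sv i j t y = y powi dy j * (gv i j t + zv t y * gv i North t * gv North j t)"

lemma zeta_conv:
  assumes "admissible t y"
  shows "conv_at (zeta y) t" "norm z \<le> t \<Longrightarrow> (1 - y * eval_fps (g North North) z) * eval_fps (zeta y) z = y"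
    "nonneg_coeffs (zeta y)"
proof -
  let ?F = "fps_const y * g North North"
  have t: "0 < t" "0 < y" "y * N t < 1" "conv_dom t" using assms by (auto simp: admissible_def)
  have cF: "conv_at ?F t" using t domD by blast
  have F0: "fps_nth ?F 0 = 0" by (simp add: g_nth_0)
  have nn: "nonneg_coeffs ?F" using t g_nonneg by (intro nonneg_coeffs_mult) auto
  have ev: "eval_fps ?F z = y * eval_fps (g North North) z" if "norm z \<le> t" for z
    using that t domD(1) by (simp add: ev_mult [of _ t])
  have cI: "conv_at (inverse (1 - ?F)) t"
    using nn F0 cF t ev [of t] by (intro conv_at_geometric) (auto simp: N_def gv_def)
  show "conv_at (zeta y) t" unfolding zeta_def using cI by blast
  show "nonneg_coeffs (zeta y)" unfolding zeta_def
    using nn F0 t by (intro nonneg_coeffs_mult nonneg_coeffs_geometric) (auto intro: g_nonneg)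
  show "(1 - y * eval_fps (g North North) z) * eval_fps (zeta y) z = y" if z: "norm z \<le> t"
  proof -
    have "(1 - eval_fps ?F z) * eval_fps (inverse (1 - ?F)) z = 1"
      by (rule ev_geometric [OF F0 cF cI z])
    then show ?thesis unfolding zeta_def ev [OF z] using cI z by (simp add: ev_mult [of _ t])
  qed
qed

lemma zeta_val: "admissible t y \<Longrightarrow> eval_fps (zeta y) t = zv t y"
  using zeta_conv(2) [of t y t] by (auto simp: admissible_def zv_def N_def gv_def field_simps)

lemma rational_zeta: "rational_fps (zeta y)"
  unfolding zeta_def by (intro rational_fps_mult rational_fps_geometric rational_fps_const rational_g)
    (simp add: g_nth_0)

lemma tgf_South_val:
  assumes "admissible t y"
  shows "conv_at (tgf y {South} i j) t" "eval_fps (tgf y {South} i j) t = sv i j t y"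
    "rat_val (tgf y {South} i j) t (sv i j t y)"
proof -
  have y: "0 < y" "conv_dom t" "0 < t" using assms by (auto simp: admissible_def)
  note c = domD(1) [OF y(2)] zeta_conv(1) [OF assms]
  show 1: "conv_at (tgf y {South} i j) t"
    unfolding tgf_South [OF y(1)] by (intro conv_at_mult conv_at_add c conv_at_simps)
  show 2: "eval_fps (tgf y {South} i j) t = sv i j t y"
    unfolding tgf_South [OF y(1)] sv_def using y
    by (simp add: ev_mult [of _ t] ev_add [of _ t] conv_at_mult conv_at_add c zeta_val [OF assms] gv_def)
  have "rational_fps (tgf y {South} i j)"
    unfolding tgf_South [OF y(1)]
    by (intro rational_fps_mult rational_fps_add rational_fps_const rational_g rational_zeta)
  from rat_val_eval [OF this, of t] show "rat_val (tgf y {South} i j) t (sv i j t y)" using 1 2 y by simp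
qed

text \<open>The names ending in \<open>v\<close> are the values of the series defined before, as
  explicit functions of \<open>t\<close> and \<open>y\<close>.\<close>

definition lv where "lv t y = sv South South t y"
definition tailv where "tailv \<theta> t y = (if \<theta> = South then 1 else sv South \<theta> t y)"
definition entryv where "entryv \<theta> t y = (if \<theta> = South then 1 else sv \<theta> South t y)"
definition detourv where "detourv \<theta> t y = (if \<theta> = South then 0 else 1 + sv \<theta> \<theta> t y)"
definition nosv where "nosv \<theta> t y = (if \<theta> = South then 0 else
     (\<Sum>k\<in>-{South}. step_weight x y k * t * ((if k = \<theta> then 1 else 0) + sv k \<theta> t y)))"
definition tosv where "tosv t y = (\<Sum>k\<in>-{South}. step_weight x y k * t * sv k South t y)"
definition denv where "denv \<theta> t y = detourv \<theta> t y * (1 - lv t y) + entryv \<theta> t y * tailv \<theta> t y"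

lemma rat_val_unit_step: "rat_val (unit_step y k) t (step_weight x y k * t)"
  unfolding unit_step_def by (intro rat_val_mult rat_val_const rat_val_X)

lemma rat_val_parts:
  assumes "admissible t y"
  shows "rat_val (loop y) t (lv t y)" "rat_val (tail y \<theta>) t (tailv \<theta> t y)"
    "rat_val (no_South y \<theta>) t (nosv \<theta> t y)" "rat_val (to_South y) t (tosv t y)"
    "rat_val (den y \<theta>) t (denv \<theta> t y)"
proof -
  note 1 = tgf_South_val(3) [OF assms]
  show l: "rat_val (loop y) t (lv t y)" unfolding loop_def lv_def by (rule 1)
  show t: "rat_val (tail y \<theta>) t (tailv \<theta> t y)" unfolding tail_def tailv_def by (simp add: 1 rat_val_one)
  have e: "rat_val (entry y \<theta>) t (entryv \<theta> t y)" unfolding entry_def entryv_def by (simp add: 1 rat_val_one)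
  have d: "rat_val (detour y \<theta>) t (detourv \<theta> t y)"
    unfolding detour_def detourv_def by (simp add: 1 rat_val_one rat_val_zero rat_val_add)
  have "rat_val (if k = \<theta> then 1 else 0) t (if k = \<theta> then 1 else 0)" for k
    by (simp add: rat_val_one rat_val_zero)
  then have "rat_val (\<Sum>k\<in>-{South}. unit_step y k * ((if k = \<theta> then 1 else 0) + tgf y {South} k \<theta>)) t
     (\<Sum>k\<in>-{South}. step_weight x y k * t * ((if k = \<theta> then 1 else 0) + sv k \<theta> t y))"
    by (intro rat_val_sum rat_val_mult rat_val_unit_step rat_val_add 1)
  then show "rat_val (no_South y \<theta>) t (nosv \<theta> t y)"
    unfolding no_South_def nosv_def by (simp add: rat_val_zero)
  show "rat_val (to_South y) t (tosv t y)"
    unfolding to_South_def tosv_def by (intro rat_val_sum rat_val_mult rat_val_unit_step 1)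
  show "rat_val (den y \<theta>) t (denv \<theta> t y)"
    unfolding den_def denv_def by (intro rat_val_add rat_val_mult rat_val_diff rat_val_one e d l t)
qed

text \<open>The right-hand side contains only convergent series, whereas the series of
  \<open>B\<close> itself may diverge at \<open>t\<close>.\<close>

lemma B_fun_eq:
  assumes "admissible t y" "denv \<theta> t y \<noteq> 0"
  shows "B_fun R \<theta> t x y = 1 - (1 - lv t y) / denv \<theta> t y"
proof -
  have y: "0 < y" using assms by (simp add: admissible_def)
  have "rat_val (1 - walk_gf (B_walks R \<theta>) x y) t ((1 - lv t y) / denv \<theta> t y)"
    by (rule rat_val_div [OF B_den [OF y] rat_val_parts(5) [OF assms(1)]
        rat_val_diff [OF rat_val_one rat_val_parts(1) [OF assms(1)]] assms(2)])
  from rat_val_diff [OF rat_val_one this]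
  have "rat_val (walk_gf (B_walks R \<theta>) x y) t (1 - (1 - lv t y) / denv \<theta> t y)" by simp
  then show ?thesis unfolding B_fun_def by (rule rat_eval_eq)
qed

lemma D_fun_eq:
  assumes "admissible t y" "denv \<theta> t y \<noteq> 0"
  shows "D_fun R \<theta> t x y = t / y * tailv \<theta> t y / denv \<theta> t y"
proof -
  have y: "0 < y" using assms by (simp add: admissible_def)
  have "rat_val (walk_gf (D_walks R \<theta>) x y) t (step_weight x y South * t * tailv \<theta> t y / denv \<theta> t y)"
    by (rule rat_val_div [OF D_den [OF y] rat_val_parts(5) [OF assms(1)]
        rat_val_mult [OF rat_val_unit_step rat_val_parts(2) [OF assms(1)]] assms(2)])
  then show ?thesis unfolding D_fun_def
    by (subst rat_eval_eq) (auto simp: step_weight_def power_int_minus field_simps)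
qed

lemma C_fun_eq:
  assumes "admissible t y" "denv \<theta> t y \<noteq> 0"
  shows "C_fun R \<theta> t x y = (nosv \<theta> t y * (1 - lv t y) + tosv t y * tailv \<theta> t y) / denv \<theta> t y"
  unfolding C_fun_def using assms
  by (intro rat_eval_eq rat_val_div [OF C_den rat_val_parts(5)] rat_val_add rat_val_mult rat_val_diff
      rat_val_one rat_val_parts) (auto simp: admissible_def)

text \<open>In contrast to the formulas for \<open>B\<close>, \<open>C\<close> and \<open>D\<close>,
  no condition on \<open>denv\<close> appears, because \<open>den\<close> has cancelled.\<close>

lemma D_over_eq:
  assumes "admissible t y" "lv t y \<noteq> 1"
  shows "D_over_one_minus_B R \<theta> t x y = t / y * tailv \<theta> t y / (1 - lv t y)"
proof -
  have y: "0 < y" using assms by (simp add: admissible_def)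
  have "rat_val (walk_gf (D_walks R \<theta>) x y / (1 - walk_gf (B_walks R \<theta>) x y)) t
      (step_weight x y South * t * tailv \<theta> t y / (1 - lv t y))"
    by (rule rat_val_div [OF D_over_B [OF y] rat_val_diff [OF rat_val_one rat_val_parts(1) [OF assms(1)]]
        rat_val_mult [OF rat_val_unit_step rat_val_parts(2) [OF assms(1)]]]) (use assms in simp)
  then show ?thesis unfolding D_over_one_minus_B_def
    by (subst rat_eval_eq) (auto simp: step_weight_def power_int_minus field_simps)
qed

lemma lv_eq: "admissible t y \<Longrightarrow> lv t y = (A t + G t * zv t y) / y"
  by (simp add: lv_def sv_def A_def G_def power_int_minus field_simps)

definition q0v where "q0v t = eval_fps q0 t"
definition n1v where "n1v t = eval_fps n1 t"

lemma conv_unit_step: "conv_at (unit_step y k) t"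
  unfolding unit_step_def by (intro conv_at_mult conv_at_simps)

lemma conv_q0_n1:
  assumes "conv_dom t" shows "conv_at q0 t" "conv_at n1 t"
  unfolding q0_def n1_def
  by (intro conv_at_add conv_at_mult conv_unit_step conv_at_simps domD(1) [OF assms])+

lemma n1_nonneg: "nonneg_coeffs n1"
  unfolding n1_def unit_step_def using x_pos
  by (intro nonneg_coeffs_mult nonneg_coeffs_add g_nonneg nonneg_coeffs_simps) (auto simp: step_weight_def)

lemma n1v_pos:
  assumes "conv_dom t" "0 < t" shows "0 < n1v t"
  unfolding n1v_def
proof (rule eval_pos [OF n1_nonneg conv_q0_n1(2) [OF assms(1)] assms(2)])
  let ?U = "fps_X + unit_step 1 East * g East North + unit_step 1 West * g West North"
  have "fps_nth ?U 1 = 1"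
    by (simp add: unit_step_def mult.assoc g_nth_0)
  then have "?U \<noteq> 0" by (metis fps_zero_nth zero_neq_one)
  then show "n1 \<noteq> 0" unfolding n1_def using g_North_South by simp
qed

lemma tosv_eq:
  assumes "admissible t y"
  shows "tosv t y = (q0v t + n1v t * zv t y) / y"
proof -
  have y: "0 < y" "conv_dom t" "0 < t" using assms by (auto simp: admissible_def)
  have c: "conv_at (q0 + n1 * zeta y) t"
    using conv_q0_n1 [OF y(2)] zeta_conv(1) [OF assms] by blast
  have "rational_fps (q0 + n1 * zeta y)"
    unfolding q0_def n1_def unit_step_def
    by (intro rational_fps_add rational_fps_mult rational_fps_const rational_fps_X rational_g rational_zeta)
  from rat_val_eval [OF this, of t] have "rat_val (q0 + n1 * zeta y) t (eval_fps (q0 + n1 * zeta y) t)"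
    using c y by simp
  moreover have "eval_fps (q0 + n1 * zeta y) t = q0v t + n1v t * zv t y"
    using conv_q0_n1 [OF y(2)] zeta_conv(1) [OF assms] y
    by (simp add: ev_add [of _ t] ev_mult [of _ t] conv_at_mult q0v_def n1v_def zeta_val [OF assms])
  ultimately have "rat_val (q0 + n1 * zeta y) t (q0v t + n1v t * zv t y)" by simp
  moreover have "rat_val (q0 + n1 * zeta y) t (y * tosv t y)"
    unfolding to_South_eq [OF y(1), symmetric] by (intro rat_val_mult rat_val_const rat_val_parts assms)
  ultimately have "q0v t + n1v t * zv t y = y * tosv t y" using rat_eval_eq by metis
  then show ?thesis using y by (simp add: field_simps)
qed

lemma sv_pos:
  assumes "admissible t y" "tgf y {South} i j \<noteq> 0"
  shows "0 < sv i j t y"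
proof -
  have "0 < eval_fps (tgf y {South} i j) t"
    using assms tgf_South_val(1) [OF assms(1)] by (intro eval_pos tgf_nonneg) (auto simp: admissible_def)
  then show ?thesis using tgf_South_val(2) [OF assms(1)] by simp
qed

lemma sv_nonneg:
  assumes "admissible t y"
  shows "0 \<le> sv i j t y"
proof -
  have "0 \<le> eval_fps (tgf y {South} i j) t"
    using assms tgf_South_val(1) [OF assms(1)] by (intro eval_nonneg tgf_nonneg) (auto simp: admissible_def)
  then show ?thesis using tgf_South_val(2) [OF assms(1)] by simp
qed

lemma tailv_pos: "admissible t y \<Longrightarrow> 0 < tailv \<theta> t y"
  unfolding tailv_def by (auto intro!: sv_pos tgf_from_South_nonzero simp: admissible_def)

lemma entryv_pos: "admissible t y \<Longrightarrow> 0 < entryv \<theta> t y"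
  unfolding entryv_def by (auto intro!: sv_pos tgf_to_South_nonzero simp: admissible_def)

text \<open>Up to the point where the loop equals 1, both summands of \<open>den\<close> are
  products of nonnegative factors, and the second is positive by irreducibility.\<close>

lemma denv_pos: "admissible t y \<Longrightarrow> lv t y \<le> 1 \<Longrightarrow> 0 < denv \<theta> t y"
  unfolding denv_def using tailv_pos entryv_pos sv_nonneg
  by (intro add_nonneg_pos mult_nonneg_nonneg mult_pos_pos) (auto simp: detourv_def intro: add_nonneg_nonneg)

section \<open>The kernel as a quadratic in \<open>y\<close>, and the radius
  \<open>\<rho>\<close>\<close>

definition bv where "bv t = 1 + A t * N t - G t"
definition kv where "kv t y = N t * y\<^sup>2 - bv t * y + A t"

text \<open>The factor \<open>y (1 - y N)\<close> is positive for admissible pairs, so the sign of a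
  quadratic polynomial decides whether the loop is below or above 1.\<close>

lemma kv_eq: "admissible t y \<Longrightarrow> kv t y = y * (1 - y * N t) * (lv t y - 1)"
  unfolding kv_def bv_def
  by (simp add: lv_eq zv_def admissible_def field_simps power2_eq_square)

lemma kv_sign:
  assumes "admissible t y"
  shows "lv t y < 1 \<longleftrightarrow> kv t y < 0" "lv t y = 1 \<longleftrightarrow> kv t y = 0" "1 < lv t y \<longleftrightarrow> 0 < kv t y"
proof -
  have "0 < y * (1 - y * N t)" using assms by (simp add: admissible_def)
  then show "lv t y < 1 \<longleftrightarrow> kv t y < 0" "lv t y = 1 \<longleftrightarrow> kv t y = 0" "1 < lv t y \<longleftrightarrow> 0 < kv t y"
    unfolding kv_eq [OF assms] by (auto simp: mult_less_0_iff zero_less_mult_iff)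
qed

lemma N_mono: "conv_dom t \<Longrightarrow> 0 \<le> s \<Longrightarrow> s < t \<Longrightarrow> N s < N t"
  unfolding N_def by (intro gv_strict_mono g_North_North)

lemma ok_mono:
  assumes "admissible t y" "0 < s" "s \<le> t" shows "admissible s y"
proof -
  have "N s \<le> N t" unfolding N_def using assms by (intro gv_mono) (auto simp: admissible_def)
  then have "y * N s \<le> y * N t" using assms by (intro mult_left_mono) (auto simp: admissible_def)
  then have "y * N s < 1" using assms unfolding admissible_def by linarith
  moreover have "conv_dom s" using dom_mono [of t s] assms by (auto simp: admissible_def)
  ultimately show ?thesis using assms by (auto simp: admissible_def)
qed

lemma ok_mono_y:
  assumes "admissible t y" "0 < u" "u \<le> y" shows "admissible t u"
proof -
  have "u * N t \<le> y * N t" using assms ANG_pos(2) [of t] unfolding admissible_def by (intro mult_right_mono) auto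
  then show ?thesis using assms unfolding admissible_def by force
qed

lemma lv_strict_mono:
  assumes "admissible t y" "0 < s" "s < t" shows "lv s y < lv t y"
proof -
  have s: "admissible s y" using ok_mono assms by simp
  have st: "conv_at (tgf y {South} South South) t" "conv_at (tgf y {South} South South) s"
    using tgf_South_val(1) assms(1) s by blast+
  have "eval_fps (tgf y {South} South South) s < eval_fps (tgf y {South} South South) t"
    using assms st by (intro eval_strict_mono tgf_nonneg tgf_nth_0 tgf_from_South_nonzero) (auto simp: admissible_def)
  then show ?thesis using tgf_South_val(2) s assms(1) by (simp add: lv_def)
qed

text \<open>The critical equation gives \<open>sqrt G = 1 - sqrt (A N)\<close>, hence
  \<open>bv = 2 sqrt (A N)\<close>: the discriminant vanishes and the kernel is a perfect
  square.\<close>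

lemma kap_values:
  shows "sqrt (G kappa0) = 1 - sqrt (A kappa0 * N kappa0)" "bv kappa0 = 2 * sqrt (A kappa0 * N kappa0)"
    "kv kappa0 y = (sqrt (N kappa0) * y - sqrt (A kappa0))\<^sup>2" "sqrt (A kappa0 * N kappa0) < 1"
    "tau0 * N kappa0 = sqrt (A kappa0 * N kappa0)" "0 < tau0"
proof -
  note p = ANG_pos [OF kappa0(1,2)]
  show 1: "sqrt (G kappa0) = 1 - sqrt (A kappa0 * N kappa0)" using kappa0(3) by (simp add: crit_def)
  then have "G kappa0 = (1 - sqrt (A kappa0 * N kappa0))\<^sup>2" using p(3) by (metis abs_of_pos real_sqrt_abs real_sqrt_pow2 less_imp_le)
  then show 2: "bv kappa0 = 2 * sqrt (A kappa0 * N kappa0)" using p by (simp add: bv_def power2_diff)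
  show "kv kappa0 y = (sqrt (N kappa0) * y - sqrt (A kappa0))\<^sup>2"
    unfolding kv_def 2 using p by (simp add: power2_diff power_mult_distrib real_sqrt_mult)
  have "0 < sqrt (G kappa0)" using p by simp
  then show "sqrt (A kappa0 * N kappa0) < 1" using 1 by simp
  have "N kappa0 = sqrt (N kappa0) * sqrt (N kappa0)" using p by simp
  then show "tau0 * N kappa0 = sqrt (A kappa0 * N kappa0)" unfolding tau0_def using p
    by (simp add: real_sqrt_divide real_sqrt_mult field_simps)
  show "0 < tau0" using p by (simp add: tau0_def)
qed

lemma kv_kap_nonneg: "0 \<le> kv kappa0 y" by (simp add: kap_values)

lemma kv_kap_zero: "kv kappa0 y = 0 \<longleftrightarrow> y = tau0"
proof -
  have p: "0 < sqrt (N kappa0)" using ANG_pos [OF kappa0(1,2)] by simp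
  have "kv kappa0 y = 0 \<longleftrightarrow> sqrt (N kappa0) * y = sqrt (A kappa0)" by (simp add: kap_values)
  also have "\<dots> \<longleftrightarrow> y = tau0" using p by (simp add: tau0_def real_sqrt_divide field_simps)
  finally show ?thesis .
qed

definition is_rho where "is_rho y t \<longleftrightarrow> admissible t y \<and> lv t y = 1"

lemma is_rho_unique: "is_rho y s \<Longrightarrow> is_rho y t \<Longrightarrow> s = t"
  unfolding is_rho_def using lv_strict_mono [of t y s] lv_strict_mono [of s y t]
  by (metis less_irrefl linorder_neqE_linordered_idom admissible_def)

lemma kv_isCont: "conv_dom t \<Longrightarrow> isCont (\<lambda>t. kv t y) t"
  unfolding kv_def bv_def using ANG_isCont by (intro continuous_intros)

text \<open>At \<open>t = 0\<close> the kernel equals \<open>- y\<close>. It is nonnegative at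
  \<open>kappa0\<close>, or, if \<open>y N\<close> reaches 1 no later than that, positive at the
  point where this happens; a zero lies in between.\<close>

lemma ex_rho: assumes y: "0 < y" shows "\<exists>t. is_rho y t \<and> t \<le> kappa0"
proof -
  have "\<exists>u. 0 < u \<and> u \<le> kappa0 \<and> 0 \<le> kv u y \<and> (\<forall>t. 0 \<le> t \<and> t < u \<longrightarrow> y * N t < 1) \<and> (kv u y = 0 \<longrightarrow> y * N u < 1)"
  proof (cases "y * N kappa0 < 1")
    case True
    have "y * N t < 1" if "0 \<le> t" "t < kappa0" for t
    proof -
      have "y * N t < y * N kappa0" using N_mono [OF kappa0(1)] that y by (intro mult_strict_left_mono) auto
      then show ?thesis using True by simp
    qed
    then show ?thesis using kappa0 True kv_kap_nonneg by (intro exI [of _ kappa0]) auto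
  next
    case False
    have "\<exists>u. 0 \<le> u \<and> u \<le> kappa0 \<and> y * N u = 1"
    proof (rule IVT)
      show "y * N 0 \<le> 1" by (simp add: N_def gv_0)
      show "\<forall>u. 0 \<le> u \<and> u \<le> kappa0 \<longrightarrow> isCont (\<lambda>u. y * N u) u"
        using ANG_isCont(2) dom_mono [OF kappa0(1)] by (auto intro!: continuous_intros)
    qed (use False kappa0 in auto)
    then obtain u where u: "0 \<le> u" "u \<le> kappa0" "y * N u = 1" by blast
    have "u \<noteq> 0" using u by (auto simp: N_def gv_0)
    then have u0: "0 < u" using u by simp
    have du: "conv_dom u" using dom_mono [OF kappa0(1)] u by blast
    \<comment> \<open>Where \<open>y N = 1\<close> the kernel collapses to \<open>G y\<close>, so
      the zero is met before the pole of \<open>zv\<close>.\<close>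
    have "kv u y = (y * N u) * y - y - (y * N u) * A u + G u * y + A u"
      by (simp add: kv_def bv_def algebra_simps power2_eq_square)
    then have k: "kv u y = G u * y" using u by simp
    then have "0 < kv u y" using ANG_pos(3) [OF du u0] y by simp
    moreover have "y * N t < 1" if "0 \<le> t" "t < u" for t
    proof -
      have "y * N t < y * N u" using N_mono [OF du] that y by (intro mult_strict_left_mono) auto
      then show ?thesis using u by simp
    qed
    ultimately show ?thesis using u0 u by (intro exI [of _ u]) auto
  qed
  then obtain u where u: "0 < u" "u \<le> kappa0" "0 \<le> kv u y" "\<And>t. 0 \<le> t \<Longrightarrow> t < u \<Longrightarrow> y * N t < 1"
    "kv u y = 0 \<Longrightarrow> y * N u < 1" by blast
  have "\<exists>t. 0 \<le> t \<and> t \<le> u \<and> kv t y = 0"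
  proof (rule IVT)
    show "kv 0 y \<le> 0" using y by (simp add: kv_def bv_def A_def N_def G_def gv_0)
    show "\<forall>t. 0 \<le> t \<and> t \<le> u \<longrightarrow> isCont (\<lambda>t. kv t y) t"
      using kv_isCont dom_mono [OF kappa0(1)] u by auto
  qed (use u in auto)
  then obtain t where t: "0 \<le> t" "t \<le> u" "kv t y = 0" by blast
  have "t \<noteq> 0" using t y by (auto simp: kv_def bv_def A_def N_def G_def gv_0)
  moreover have "y * N t < 1" using u t by (cases "t = u") auto
  ultimately have "admissible t y" using t y u dom_mono [OF kappa0(1)] by (auto simp: admissible_def)
  then show ?thesis using t u kv_sign(2) by (auto simp: is_rho_def)
qed

definition rho0 where "rho0 y = (THE t. is_rho y t)"

lemma rho0:
  assumes "0 < y" shows "is_rho y (rho0 y)" "rho0 y \<le> kappa0"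
proof -
  obtain t where t: "is_rho y t" "t \<le> kappa0" using ex_rho [OF assms] by blast
  then have "rho0 y = t" unfolding rho0_def using is_rho_unique by (intro the_equality) auto
  with t show "is_rho y (rho0 y)" "rho0 y \<le> kappa0" by auto
qed

lemma rh_ok: "0 < y \<Longrightarrow> admissible (rho0 y) y" "0 < y \<Longrightarrow> lv (rho0 y) y = 1" "0 < y \<Longrightarrow> conv_dom (rho0 y)" "0 < y \<Longrightarrow> 0 < rho0 y"
    "0 < y \<Longrightarrow> kv (rho0 y) y = 0"
  using rho0(1) [of y] kv_sign(2) by (auto simp: is_rho_def admissible_def)

lemma rh_eqI: "is_rho y t \<Longrightarrow> rho0 y = t"
  unfolding rho0_def using is_rho_unique by (intro the_equality) auto

text \<open>As long as the loop is at most 1, \<open>den\<close> is positive, so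
  \<open>B = 1\<close> holds exactly when the loop equals 1, for all \<open>\<theta>\<close>
  alike.\<close>

lemma rho_eq:
  assumes "0 < y" shows "rho R x y = rho0 y"
proof -
  have B1: "B_fun R \<theta> (rho0 y) x y = 1" for \<theta>
    using rh_ok [OF assms] denv_pos [of "rho0 y" y \<theta>] by (subst B_fun_eq) auto
  have B2: "B_fun R \<theta> t x y \<noteq> 1" if t: "0 < t" "t < rho0 y" for \<theta> t
  proof -
    have o: "admissible t y" using ok_mono [OF rh_ok(1) [OF assms]] t by simp
    have l: "lv t y < 1" using lv_strict_mono [OF rh_ok(1) [OF assms] t] rh_ok(2) [OF assms] by simp
    have "0 < denv \<theta> t y" using denv_pos o l by simp
    then show ?thesis using l by (subst B_fun_eq [OF o]) auto
  qed
  show ?thesis unfolding rho_def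
  proof (rule the_equality)
    show "\<forall>\<theta>. 0 < rho0 y \<and> B_fun R \<theta> (rho0 y) x y = 1 \<and> (\<forall>t. 0 < t \<and> t < rho0 y \<longrightarrow> B_fun R \<theta> t x y \<noteq> 1)"
      using B1 B2 rh_ok(4) [OF assms] by blast
    fix r assume "\<forall>\<theta>. 0 < r \<and> B_fun R \<theta> r x y = 1 \<and> (\<forall>t. 0 < t \<and> t < r \<longrightarrow> B_fun R \<theta> t x y \<noteq> 1)"
    then show "r = rho0 y" using B1 B2 rh_ok(4) [OF assms]
      by (metis linorder_neqE_linordered_idom)
  qed
qed

lemma lv_isCont_y: "admissible t y \<Longrightarrow> isCont (lv t) y"
  unfolding lv_def sv_def zv_def by (intro continuous_intros) (auto simp: admissible_def)

lemma ok_eventually_y: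
  assumes "admissible t y" shows "eventually (\<lambda>v. admissible t v) (nhds y)"
proof -
  have "((\<lambda>v. v * N t) \<longlongrightarrow> y * N t) (nhds y)" "((\<lambda>v. v) \<longlongrightarrow> y) (nhds y)"
    by (auto intro!: tendsto_intros filterlim_ident)
  then have "eventually (\<lambda>v. v * N t < 1) (nhds y)" "eventually (\<lambda>v. 0 < v) (nhds y)"
    using assms by (auto simp: admissible_def order_tendsto_iff)
  then show ?thesis by eventually_elim (use assms in \<open>auto simp: admissible_def\<close>)
qed

lemma ok_enlarge:
  assumes "admissible t y" obtains s where "t < s" "admissible s y"
proof -
  have d: "conv_at (g North North) t" "0 \<le> t" "conv_dom t" "0 < y" "0 < t" using assms domD by (auto simp: admissible_def)
  have "eval_fps (g North North) t < 1 / y" using assms by (simp add: admissible_def N_def gv_def field_simps)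
  from ex_right_less [OF d(1,2) this] obtain s1 where s1: "t < s1" "conv_at (g North North) s1"
    "eval_fps (g North North) s1 < 1 / y" .
  obtain s2 where s2: "t < s2" "conv_dom s2" using dom_enlarge [OF d(3)] .
  define s where "s = min s1 s2"
  have s: "t < s" "conv_dom s" using s1 s2 d dom_mono [OF s2(2), of s] by (auto simp: s_def)
  have "N s \<le> eval_fps (g North North) s1" unfolding N_def gv_def
    using s1 s d by (intro eval_mono g_nonneg) (auto simp: s_def)
  then have "N s < 1 / y" using s1 by simp
  then have "admissible s y" using s d by (auto simp: admissible_def field_simps)
  then show ?thesis using that s by blast
qed

text \<open>The loop is strictly increasing in \<open>t\<close> and continuous in \<open>y\<close>.
  Strict inequalities for it on either side of \<open>rho0 y\<close> survive small changes of
  \<open>y\<close> and enclose the nearby roots.\<close>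

lemma rh_isCont: assumes y: "0 < y" shows "isCont rho0 y"
  unfolding isCont_def
proof (rule order_tendstoI)
  note r = rh_ok [OF y]
  have ev0: "eventually (\<lambda>v. 0 < v) (nhds y)" using y by (rule eventually_positive)
  fix a assume a: "a < rho0 y"
  \<comment> \<open>The bound \<open>rho0 y / 2\<close> keeps \<open>t1\<close> positive, as
    admissibility demands.\<close>
  define t1 where "t1 = max a (rho0 y / 2)"
  have t1: "0 < t1" "t1 < rho0 y" "a \<le> t1" using a r by (auto simp: t1_def)
  have o: "admissible t1 y" using ok_mono [OF r(1)] t1 by simp
  have "lv t1 y < 1" using lv_strict_mono [OF r(1) t1(1,2)] r by simp
  then have "eventually (\<lambda>v. lv t1 v < 1) (nhds y)"
    using lv_isCont_y [OF o] unfolding continuous_at_imp_continuous_at_within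
    by (metis isCont_def order_tendstoD(2) tendsto_at_iff_tendsto_nhds)
  with ok_eventually_y [OF o] ev0 have "eventually (\<lambda>v. a < rho0 v) (nhds y)"
  proof eventually_elim
    case (elim v)
    show ?case
    proof (rule ccontr)
      assume "\<not> a < rho0 v"
      then have "rho0 v \<le> t1" using t1 by simp
      then have "lv (rho0 v) v \<le> lv t1 v"
        using lv_strict_mono [OF elim(1), of "rho0 v"] rh_ok(4) [OF elim(2)] by (cases "rho0 v = t1") auto
      then show False using elim rh_ok(2) [of v] by simp
    qed
  qed
  then show "eventually (\<lambda>v. a < rho0 v) (at y)" by (simp add: eventually_at_filter eventually_mono)
next
  note r = rh_ok [OF y]
  have ev0: "eventually (\<lambda>v. 0 < v) (nhds y)" using y by (rule eventually_positive)
  fix a assume a: "rho0 y < a"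
  obtain s where s: "rho0 y < s" "admissible s y" using ok_enlarge [OF r(1)] .
  define t2 where "t2 = min a s"
  have t2: "rho0 y < t2" "t2 \<le> a" "0 < t2" using a s r by (auto simp: t2_def)
  have o: "admissible t2 y" using ok_mono [OF s(2)] t2 by (simp add: t2_def)
  have "1 < lv t2 y" using lv_strict_mono [OF o r(4) t2(1)] r by simp
  then have "eventually (\<lambda>v. 1 < lv t2 v) (nhds y)"
    using lv_isCont_y [OF o]
    by (metis isCont_def order_tendstoD(1) tendsto_at_iff_tendsto_nhds)
  with ok_eventually_y [OF o] ev0 have "eventually (\<lambda>v. rho0 v < a) (nhds y)"
  proof eventually_elim
    case (elim v)
    show ?case
    proof (rule ccontr)
      assume "\<not> rho0 v < a"
      then have "t2 \<le> rho0 v" using t2 by simp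
      then have "lv t2 v \<le> lv (rho0 v) v"
        using lv_strict_mono [OF rh_ok(1) [OF elim(2)] t2(3)] by (cases "rho0 v = t2") auto
      then show False using elim rh_ok(2) [of v] by simp
    qed
  qed
  then show "eventually (\<lambda>v. rho0 v < a) (at y)" by (simp add: eventually_at_filter eventually_mono)
qed

section \<open>Implicit differentiation of \<open>\<rho>\<close> in \<open>y\<close>\<close>

definition A' where "A' t = eval_fps (fps_deriv (g South South)) t"
definition N' where "N' t = eval_fps (fps_deriv (g North North)) t"
definition G' where "G' t = eval_fps (fps_deriv (g South North)) t * gv North South t
   + eval_fps (fps_deriv (g North South)) t * gv South North t"
definition b' where "b' t = A' t * N t + N' t * A t - G' t"
definition kt where "kt t y = N' t * y\<^sup>2 - b' t * y + A' t"

lemma ANG_deriv: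
  assumes "conv_dom t"
  shows "(A has_real_derivative A' t) (at t)" "(N has_real_derivative N' t) (at t)"
    "(G has_real_derivative G' t) (at t)" "(bv has_real_derivative b' t) (at t)"
    "((\<lambda>t. kv t y) has_real_derivative kt t y) (at t)"
proof -
  have e: "A = gv South South" "N = gv North North" "G = (\<lambda>t. gv South North t * gv North South t)"
    by (auto simp: A_def N_def G_def)
  show A: "(A has_real_derivative A' t) (at t)" unfolding e A'_def by (rule gv_deriv [OF assms])
  show N: "(N has_real_derivative N' t) (at t)" unfolding e N'_def by (rule gv_deriv [OF assms])
  show G: "(G has_real_derivative G' t) (at t)" unfolding e G'_def
    by (rule DERIV_mult [OF gv_deriv [OF assms] gv_deriv [OF assms]])
  have "((\<lambda>t. 1 + A t * N t - G t) has_real_derivative (0 + (A' t * N t + N' t * A t) - G' t)) (at t)"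
    by (intro DERIV_add DERIV_diff DERIV_mult DERIV_const A N G)
  then show b: "(bv has_real_derivative b' t) (at t)" by (simp add: bv_def [abs_def] b'_def)
  have "((\<lambda>t. N t * y\<^sup>2 - bv t * y + A t) has_real_derivative (N' t * y\<^sup>2 - b' t * y + A' t)) (at t)"
    by (intro DERIV_add DERIV_diff DERIV_cmult_right A N b)
  then show "((\<lambda>t. kv t y) has_real_derivative kt t y) (at t)" by (simp add: kv_def kt_def)
qed

text \<open>At a zero of the kernel, \<open>(1 - y N) (y - A) = G y\<close> is positive, so
  \<open>y > A\<close>. The derivative in \<open>t\<close> then regroups into positive
  terms.\<close>

lemma kt_pos:
  assumes "admissible t y" "kv t y = 0" shows "0 < kt t y"
proof -
  have t: "conv_dom t" "0 < t" "0 < y" "y * N t < 1" using assms by (auto simp: admissible_def)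
  have p: "0 < A' t" "0 < N' t" unfolding A'_def N'_def
    using t by (auto intro!: gv_deriv_pos g_South_South g_North_North)
  have G: "0 < G' t" unfolding G'_def using t
    by (intro add_pos_pos mult_pos_pos gv_deriv_pos gv_pos g_South_North g_North_South) auto
  have "(1 - y * N t) * (y - A t) = G t * y"
    using assms(2) by (simp add: kv_def bv_def algebra_simps power2_eq_square)
  moreover have "0 < G t * y" using ANG_pos(3) t by simp
  ultimately have yA: "0 < y - A t" using t zero_less_mult_pos [of "1 - y * N t" "y - A t"] by simp
  have "kt t y = N' t * y * (y - A t) + A' t * (1 - y * N t) + G' t * y"
    by (simp add: kt_def b'_def algebra_simps power2_eq_square)
  then show ?thesis using p G yA t by (simp add: add_pos_pos)
qed

text \<open>The implicit function theorem by divided differences: Caratheodory factors of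
  \<open>A\<close>, \<open>N\<close> and \<open>bv\<close> give
  \<open>(rho0 v - rho0 y) E v = f v\<close> with \<open>E\<close> continuous at \<open>y\<close>,
  where continuity of \<open>rho0\<close> is what makes \<open>E\<close> continuous.\<close>

lemma rh_deriv:
  assumes y: "0 < y"
  shows "(rho0 has_real_derivative (bv (rho0 y) - 2 * N (rho0 y) * y) / kt (rho0 y) y) (at y)"
proof -
  let ?r = "rho0 y"
  have d: "conv_dom ?r" using rh_ok y by blast
  obtain a where a: "\<And>z. A z - A ?r = a z * (z - ?r)" "isCont a ?r" "a ?r = A' ?r"
    using ANG_deriv(1) [OF d] unfolding CARAT_DERIV by blast
  obtain n where n: "\<And>z. N z - N ?r = n z * (z - ?r)" "isCont n ?r" "n ?r = N' ?r"
    using ANG_deriv(2) [OF d] unfolding CARAT_DERIV by blast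
  obtain b where b: "\<And>z. bv z - bv ?r = b z * (z - ?r)" "isCont b ?r" "b ?r = b' ?r"
    using ANG_deriv(4) [OF d] unfolding CARAT_DERIV by blast
  define E where "E v = n (rho0 v) * v\<^sup>2 - b (rho0 v) * v + a (rho0 v)" for v
  have rc: "isCont rho0 y" by (rule rh_isCont [OF y])
  have EC: "isCont E y" unfolding E_def using rc a n b by (intro continuous_intros isCont_o2 [OF rc]) auto
  have Ey: "E y = kt ?r y" by (simp add: E_def kt_def a n b)
  have E0: "E y \<noteq> 0" using kt_pos [OF rh_ok(1) rh_ok(5)] y Ey by force
  \<comment> \<open>The change of the kernel between \<open>v\<close> and \<open>y\<close> at the
    fixed length variable \<open>rho0 y\<close>.\<close>
  define f where "f v = (v - y) * (bv ?r - N ?r * (v + y))" for v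
  have key: "(rho0 v - ?r) * E v = f v" if "0 < v" for v
  proof -
    have "kv (rho0 v) v - kv ?r v = (N (rho0 v) - N ?r) * v\<^sup>2 - (bv (rho0 v) - bv ?r) * v + (A (rho0 v) - A ?r)"
      by (simp add: kv_def algebra_simps)
    also have "\<dots> = (rho0 v - ?r) * E v" unfolding a n b E_def by (simp add: algebra_simps)
    finally have "(rho0 v - ?r) * E v = - kv ?r v" using rh_ok(5) that by simp
    also have "\<dots> = kv ?r y - kv ?r v" using rh_ok(5) y by simp
    also have "\<dots> = f v" by (simp add: kv_def f_def algebra_simps power2_eq_square)
    finally show ?thesis .
  qed
  have fd: "(f has_real_derivative (bv ?r - 2 * N ?r * y)) (at y)"
    unfolding f_def by (auto intro!: derivative_eq_intros simp: algebra_simps)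
  have "eventually (\<lambda>v. E v \<noteq> 0) (nhds y)"
    using EC E0 by (simp add: continuous_at_avoid isCont_def tendsto_at_iff_tendsto_nhds tendsto_imp_eventually_ne)
  moreover have "eventually (\<lambda>v. 0 < v) (nhds y)" using y by (rule eventually_positive)
  ultimately have "eventually (\<lambda>v. rho0 v = ?r + f v / E v) (nhds y)"
  proof eventually_elim
    case (elim v)
    have "f v / E v = rho0 v - ?r" unfolding key [OF elim(2), symmetric] using elim(1) by simp
    then show ?case by simp
  qed
  from deriv_quotient_at_zero [OF fd _ EC E0 this] show ?thesis by (simp add: f_def Ey)
qed

lemma is_rho_ta: "is_rho tau0 kappa0" "admissible kappa0 tau0"
proof -
  show o: "admissible kappa0 tau0" using kappa0 kap_values by (simp add: admissible_def)
  show "is_rho tau0 kappa0" using o kv_sign(2) [OF o] kv_kap_zero by (simp add: is_rho_def)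
qed

lemma rh_ta: "rho0 tau0 = kappa0" using is_rho_ta rh_eqI by blast

text \<open>For \<open>y \<noteq> tau0\<close> the kernel at \<open>t = rho0 y < kappa0\<close>
  vanishes at \<open>y\<close> and is negative at \<open>tau0\<close>. So \<open>y\<close> is the
  root on the far side of the vertex from \<open>tau0\<close>'s interior position: the smaller root
  for \<open>y < tau0\<close>, the larger one for \<open>y > tau0\<close>.\<close>

lemma ky_sign:
  assumes "0 < y"
  shows "y < tau0 \<Longrightarrow> 2 * N (rho0 y) * y < bv (rho0 y)" "tau0 < y \<Longrightarrow> bv (rho0 y) < 2 * N (rho0 y) * y"
    "y \<noteq> tau0 \<Longrightarrow> rho0 y < kappa0"
proof -
  let ?r = "rho0 y"
  show lt: "?r < kappa0" if "y \<noteq> tau0"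
    using rho0(2) [OF assms] rh_ok(5) [OF assms] kv_kap_zero [of y] that by (metis order_less_le)
  have "(tau0 - y) * (N ?r * (tau0 + y) - bv ?r) < 0" if ne: "y \<noteq> tau0"
  proof -
    have o: "admissible ?r tau0" using ok_mono [OF is_rho_ta(2)] lt [OF ne] rh_ok(4) [OF assms] by simp
    have "lv ?r tau0 < 1" using lv_strict_mono [OF is_rho_ta(2) rh_ok(4) [OF assms] lt [OF ne]] is_rho_ta(1)
      by (simp add: is_rho_def)
    then have "kv ?r tau0 - kv ?r y < 0" using kv_sign(1) [OF o] rh_ok(5) [OF assms] by simp
    then show ?thesis by (simp add: kv_def algebra_simps power2_eq_square)
  qed
  note * = this
  have N: "0 < N ?r" using ANG_pos(2) rh_ok(3,4) assms by blast
  show "2 * N ?r * y < bv ?r" if "y < tau0"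
  proof -
    have "N ?r * (tau0 + y) < bv ?r" using * that by (simp add: mult_less_0_iff)
    moreover have "N ?r * (2 * y) < N ?r * (tau0 + y)" using that N by (intro mult_strict_left_mono) auto
    ultimately show ?thesis by simp
  qed
  show "bv ?r < 2 * N ?r * y" if "tau0 < y"
  proof -
    have "bv ?r < N ?r * (tau0 + y)" using * that by (simp add: mult_less_0_iff)
    moreover have "N ?r * (tau0 + y) < N ?r * (2 * y)" using that N by (intro mult_strict_left_mono) auto
    ultimately show ?thesis by simp
  qed
qed

lemma ky_ta: "2 * N kappa0 * tau0 = bv kappa0"
  using kap_values by (simp add: mult.commute)

lemma rho_deriv:
  assumes "0 < y"
  shows "(rho R x has_real_derivative (bv (rho0 y) - 2 * N (rho0 y) * y) / kt (rho0 y) y) (at y)"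
  by (rule has_field_derivative_transform_within_open [OF rh_deriv [OF assms], of "{0<..}"])
     (use assms rho_eq in auto)

text \<open>A zero of the derivative of \<open>\<rho>\<close> places \<open>y\<close> at the vertex
  of the kernel parabola, which \<open>ky_sign\<close> excludes for every \<open>y\<close> other
  than \<open>tau0\<close>.\<close>

lemma tau_eq: "tau R x = tau0"
  unfolding tau_def
proof (rule the_equality)
  show "0 < tau0 \<and> ((\<lambda>v. rho R x v) has_real_derivative 0) (at tau0)"
    using rho_deriv [of tau0] kap_values(6) ky_ta rh_ta by simp
  fix y assume y: "0 < y \<and> ((\<lambda>v. rho R x v) has_real_derivative 0) (at y)"
  then have "(bv (rho0 y) - 2 * N (rho0 y) * y) / kt (rho0 y) y = 0"
    using rho_deriv DERIV_unique by blast
  moreover have "kt (rho0 y) y \<noteq> 0" using kt_pos rh_ok y by (metis less_irrefl)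
  ultimately have "bv (rho0 y) = 2 * N (rho0 y) * y" by simp
  then show "y = tau0" using ky_sign(1,2) [of y] y by (metis less_irrefl linorder_neqE_linordered_idom)
qed

lemma kappa_eq: "kappa R x = kappa0"
  unfolding kappa_def tau_eq using rho_eq rh_ta kap_values(6) by simp

section \<open>The vertical drift and the constant of the square-root term\<close>

lemma sv_diff_y: "admissible t y \<Longrightarrow> (\<lambda>v. sv i j t v) differentiable (at y)"
  unfolding sv_def zv_def by (intro derivative_intros) (auto simp: admissible_def)

lemma step_weight_diff: "0 < y \<Longrightarrow> (\<lambda>v. step_weight x v k) differentiable (at y)"
  unfolding step_weight_def by (intro derivative_intros) auto

lemma parts_diff_y:
  assumes "admissible t y"
  shows "(\<lambda>v. lv t v) differentiable (at y)" "(\<lambda>v. tailv \<theta> t v) differentiable (at y)"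
    "(\<lambda>v. nosv \<theta> t v) differentiable (at y)" "(\<lambda>v. tosv t v) differentiable (at y)"
    "(\<lambda>v. denv \<theta> t v) differentiable (at y)"
proof -
  note 1 = sv_diff_y [OF assms]
  have y: "0 < y" using assms by (simp add: admissible_def)
  show l: "(\<lambda>v. lv t v) differentiable (at y)" unfolding lv_def by (rule 1)
  show t: "(\<lambda>v. tailv \<theta> t v) differentiable (at y)" unfolding tailv_def by (cases "\<theta> = South") (simp_all add: 1)
  have e: "(\<lambda>v. entryv \<theta> t v) differentiable (at y)" unfolding entryv_def by (cases "\<theta> = South") (simp_all add: 1)
  have d: "(\<lambda>v. detourv \<theta> t v) differentiable (at y)" unfolding detourv_def
    by (cases "\<theta> = South") (simp_all add: 1)
  show "(\<lambda>v. tosv t v) differentiable (at y)" unfolding tosv_def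
    by (auto intro!: differentiable_sum differentiable_mult differentiable_const step_weight_diff y 1)
  show "(\<lambda>v. nosv \<theta> t v) differentiable (at y)" unfolding nosv_def
    by (cases "\<theta> = South")
       (auto intro!: differentiable_sum differentiable_mult differentiable_add differentiable_const step_weight_diff y 1)
  show "(\<lambda>v. denv \<theta> t v) differentiable (at y)" unfolding denv_def
    by (intro differentiable_add differentiable_mult differentiable_diff differentiable_const l t e d)
qed

lemma sv_isCont_t:
  assumes "admissible t y" shows "isCont (\<lambda>s. sv i j s y) t"
proof -
  have d: "conv_dom t" "1 - y * N t \<noteq> 0" using assms by (auto simp: admissible_def)
  show ?thesis unfolding sv_def zv_def
    by (intro continuous_intros gv_isCont ANG_isCont(2) d)
qed

lemma denv_isCont_t:
  assumes "admissible t y" shows "isCont (\<lambda>s. denv \<theta> s y) t"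
  unfolding denv_def lv_def tailv_def entryv_def detourv_def
  by (cases "\<theta> = South") (simp_all add: sv_isCont_t [OF assms] continuous_intros)

lemma ok_eventually_t:
  assumes "admissible t y" shows "eventually (\<lambda>s. admissible s y) (nhds t)"
proof -
  obtain s where s: "t < s" "admissible s y" using ok_enlarge [OF assms] .
  have "eventually (\<lambda>u. u \<in> {0<..<s}) (nhds t)"
    using s assms by (intro eventually_nhds_in_open) (auto simp: admissible_def)
  then show ?thesis by eventually_elim (use ok_mono [OF s(2)] in auto)
qed

lemma isCont_eventually_ne: "isCont f (a :: real) \<Longrightarrow> f a \<noteq> (0 :: real) \<Longrightarrow> eventually (\<lambda>v. f v \<noteq> 0) (nhds a)"
  by (simp add: isCont_def tendsto_at_iff_tendsto_nhds tendsto_imp_eventually_ne)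

text \<open>Near its zero, \<open>B - 1\<close> is the kernel divided by a positive factor that is
  common to both partial derivatives. The drift thus has the sign of the \<open>y\<close>-derivative
  of the kernel at its smaller root.\<close>

lemma drift_neg:
  assumes "0 < y" "y < tau0"
  shows "drift_y R \<theta> x y < 0"
proof -
  let ?r = "rho0 y"
  note r = rh_ok [OF assms(1)]
  have dp: "0 < denv \<theta> ?r y" using denv_pos [OF r(1)] r by simp
  define m where "m = y * (1 - y * N ?r) * denv \<theta> ?r y"
  have m: "0 < m" using r(1) dp by (simp add: m_def admissible_def)
  have form: "B_fun R \<theta> t x v = 1 + kv t v / (v * (1 - v * N t) * denv \<theta> t v)"
    if "admissible t v" "denv \<theta> t v \<noteq> 0" for t v
    using that by (subst B_fun_eq [OF that], subst kv_eq [OF that(1)]) (simp add: admissible_def field_simps)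
  have c1: "isCont (\<lambda>v. denv \<theta> ?r v) y"
    by (rule differentiable_imp_continuous_within) (rule parts_diff_y(5) [OF r(1)])
  have c2: "isCont (\<lambda>t. denv \<theta> t y) ?r" by (rule denv_isCont_t [OF r(1)])
  have "((\<lambda>v. B_fun R \<theta> ?r x v) has_real_derivative (2 * N ?r * y - bv ?r) / (y * (1 - y * N ?r) * denv \<theta> ?r y)) (at y)"
  proof (rule deriv_quotient_at_zero [where m = "\<lambda>v. v * (1 - v * N ?r) * denv \<theta> ?r v" and f = "kv ?r" and c = 1])
    show "(kv ?r has_real_derivative 2 * N ?r * y - bv ?r) (at y)"
      unfolding kv_def [abs_def] by (auto intro!: derivative_eq_intros)
    show "eventually (\<lambda>v. B_fun R \<theta> ?r x v = 1 + kv ?r v / (v * (1 - v * N ?r) * denv \<theta> ?r v)) (nhds y)"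
      using ok_eventually_y [OF r(1)] isCont_eventually_ne [OF c1 less_imp_neq [OF dp, symmetric]]
      by eventually_elim (rule form)
  qed (use r m c1 in \<open>auto simp: m_def intro!: continuous_intros\<close>)
  then have 1: "deriv (\<lambda>v. B_fun R \<theta> ?r x v) y = (2 * N ?r * y - bv ?r) / m"
    unfolding m_def by (rule DERIV_imp_deriv)
  have "((\<lambda>t. B_fun R \<theta> t x y) has_real_derivative kt ?r y / (y * (1 - y * N ?r) * denv \<theta> ?r y)) (at ?r)"
  proof (rule deriv_quotient_at_zero [where m = "\<lambda>t. y * (1 - y * N t) * denv \<theta> t y" and f = "\<lambda>t. kv t y" and c = 1])
    show "((\<lambda>t. kv t y) has_real_derivative kt ?r y) (at ?r)" by (rule ANG_deriv [OF r(3)])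
    show "eventually (\<lambda>t. B_fun R \<theta> t x y = 1 + kv t y / (y * (1 - y * N t) * denv \<theta> t y)) (nhds ?r)"
      using ok_eventually_t [OF r(1)] isCont_eventually_ne [OF c2 less_imp_neq [OF dp, symmetric]]
      by eventually_elim (rule form)
  qed (use r m c2 ANG_isCont(2) [OF r(3)] in \<open>auto simp: m_def intro!: continuous_intros\<close>)
  then have 2: "deriv (\<lambda>t. B_fun R \<theta> t x y) ?r = kt ?r y / m"
    unfolding m_def by (rule DERIV_imp_deriv)
  have "2 * N ?r * y - bv ?r < 0" using ky_sign(1) assms by simp
  then show ?thesis unfolding drift_y_def rho_eq [OF assms(1)] 1 2
    using m r(4) kt_pos [OF r(1) r(5)] by (simp add: divide_neg_pos)
qed

text \<open>The first derivative is \<open>f / m\<close> with \<open>f\<close> vanishing at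
  \<open>tau0\<close>. As \<open>\<rho>\<close> is stationary there, only the explicit
  \<open>v\<close> in \<open>f\<close> contributes to the derivative of \<open>f\<close>.\<close>

lemma mu_deriv2: "(deriv ^^ 2) (\<lambda>v. mu R x v) tau0 = 2 * N kappa0 / (kt kappa0 tau0 * kappa0\<^sup>2)"
proof -
  have tau0: "0 < tau0" by (rule kap_values)
  define f where "f v = 2 * N (rho0 v) * v - bv (rho0 v)" for v
  define m where "m v = kt (rho0 v) v * (rho0 v)\<^sup>2" for v
  have mu1: "((\<lambda>v. mu R x v) has_real_derivative f v / m v) (at v)" if v: "0 < v" for v
  proof -
    have "((\<lambda>v. 1 / rho R x v) has_real_derivative
        - ((bv (rho0 v) - 2 * N (rho0 v) * v) / kt (rho0 v) v) / (rho0 v)\<^sup>2) (at v)"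
      using rho_deriv [OF v] rho_eq [OF v] rh_ok(4) [OF v]
      by (auto intro!: derivative_eq_intros simp: power2_eq_square)
    moreover have "- ((bv (rho0 v) - 2 * N (rho0 v) * v) / kt (rho0 v) v) / (rho0 v)\<^sup>2 = f v / m v"
      unfolding f_def m_def minus_divide_left minus_diff_eq by (simp only: divide_divide_eq_left)
    ultimately show ?thesis by (simp add: mu_def)
  qed
  have rd: "(rho0 has_real_derivative 0) (at tau0)"
    using rh_deriv [OF tau0] ky_ta rh_ta by simp
  have dk: "conv_dom (rho0 tau0)" using kappa0 rh_ta by simp
  have Nd: "((\<lambda>v. N (rho0 v)) has_real_derivative 0) (at tau0)"
    using DERIV_chain2 [OF ANG_deriv(2) [OF dk] rd] by simp
  have bd: "((\<lambda>v. bv (rho0 v)) has_real_derivative 0) (at tau0)"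
    using DERIV_chain2 [OF ANG_deriv(4) [OF dk] rd] by simp
  have fd: "(f has_real_derivative 2 * N kappa0) (at tau0)"
    unfolding f_def using Nd bd rh_ta by (auto intro!: derivative_eq_intros)
  have rc: "isCont rho0 tau0" by (rule rh_isCont [OF tau0])
  have dc: "isCont (\<lambda>v. eval_fps (fps_deriv (g i j)) (rho0 v)) tau0" for i j
  proof -
    have "conv_at (fps_deriv (g i j)) kappa0"
      using kappa0(1) fps_conv_radius_deriv [of "g i j"] unfolding conv_dom_def conv_at_def by (metis less_le_trans)
    then have "isCont (eval_fps (fps_deriv (g i j))) (rho0 tau0)"
      using kappa0(2) rh_ta by (intro isCont_eval) simp
    then show ?thesis by (rule isCont_o2 [OF rc])
  qed
  have gc: "isCont (\<lambda>v. gv i j (rho0 v)) tau0" for i j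
    by (rule isCont_o2 [OF rc gv_isCont [OF dk]])
  have mc: "isCont m tau0"
    unfolding m_def kt_def b'_def A'_def N'_def G'_def A_def N_def
    by (intro continuous_intros dc gc rc)
  have m0: "m tau0 \<noteq> 0" using kt_pos [OF rh_ok(1,5)] rh_ok(4) tau0 by (auto simp: m_def less_le)
  have q: "((\<lambda>v. f v / m v) has_real_derivative 2 * N kappa0 / m tau0) (at tau0)"
    by (rule deriv_quotient_at_zero [where c = 0, OF fd _ mc m0]) (auto simp: f_def rh_ta ky_ta)
  have e: "f v / m v = deriv (\<lambda>v. mu R x v) v" if "v \<in> {0<..}" for v
    using DERIV_imp_deriv [OF mu1 [of v]] that by simp
  have "(deriv (\<lambda>v. mu R x v) has_real_derivative 2 * N kappa0 / m tau0) (at tau0)"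
    by (rule has_field_derivative_transform_within_open [OF q open_greaterThan _ e]) (use tau0 in simp_all)
  then have "deriv (deriv (\<lambda>v. mu R x v)) tau0 = 2 * N kappa0 / m tau0" by (rule DERIV_imp_deriv)
  then show ?thesis by (simp add: numeral_2_eq_2 m_def rh_ta)
qed

text \<open>For \<open>y < tau0\<close> the point \<open>kappa0\<close> lies past the zero of
  \<open>1 - loop\<close>, yet the loop itself still converges there.\<close>

lemma lv_kap:
  assumes "0 < y" "y < tau0"
  shows "admissible kappa0 y" "1 < lv kappa0 y"
proof -
  show o: "admissible kappa0 y" by (rule ok_mono_y [OF is_rho_ta(2)]) (use assms in auto)
  have "0 < kv kappa0 y" using kv_kap_nonneg kv_kap_zero assms by (metis less_eq_real_def less_irrefl)
  then show "1 < lv kappa0 y" using kv_sign(3) [OF o] by simp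
qed

text \<open>\<open>C\<close> and \<open>D\<close> have the common denominator \<open>den\<close>,
  whose derivative cancels in the bracket. The derivative of the loop at the double root is 0, so
  only the dependence of the first-South series on \<open>zeta\<close> remains; it yields
  \<open>n1\<close>.\<close>

lemma c_minus_eq:
  assumes y: "0 < y" "y < tau0"
  shows "c_minus R \<theta> x y = sqrt (kappa0 * kt kappa0 tau0 / N kappa0) *
    (kappa0 / y * tailv \<theta> kappa0 y / (1 - lv kappa0 y)) * (n1v kappa0 / (kappa0 * G kappa0))"
proof -
  note o = is_rho_ta(2)
  have tau0: "0 < tau0" by (rule kap_values)
  have l1: "lv kappa0 tau0 = 1" using is_rho_ta(1) by (simp add: is_rho_def)
  have dp: "0 < denv \<theta> kappa0 tau0" using denv_pos [OF o] l1 by simp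
  let ?d = "denv \<theta> kappa0" and ?T = "tailv \<theta> kappa0" and ?n = "nosv \<theta> kappa0" and ?o = "tosv kappa0"
  obtain d' T' n' o' l' where D: "(?d has_real_derivative d') (at tau0)" "(?T has_real_derivative T') (at tau0)"
    "(?n has_real_derivative n') (at tau0)" "(?o has_real_derivative o') (at tau0)" "(lv kappa0 has_real_derivative l') (at tau0)"
    using parts_diff_y(1,4) [OF o] parts_diff_y(2,3,5) [OF o, of \<theta>]
    unfolding real_differentiable_def by blast
  have ev: "eventually (\<lambda>v. admissible kappa0 v \<and> ?d v \<noteq> 0) (nhds tau0)"
    using ok_eventually_y [OF o] isCont_eventually_ne [OF DERIV_isCont [OF D(1)] less_imp_neq [OF dp, symmetric]]
    by eventually_elim simp
  \<comment> \<open>This is proportional to the derivative of the kernel, which is 0 at its double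
    root. The term with \<open>nosv\<close> therefore drops out of the derivative of the numerator
    of \<open>C\<close>.\<close>
  have "(lv kappa0 has_real_derivative (2 * N kappa0 * tau0 - bv kappa0) / (tau0 * (1 - tau0 * N kappa0))) (at tau0)"
  proof (rule deriv_quotient_at_zero [where m = "\<lambda>v. v * (1 - v * N kappa0)" and f = "kv kappa0" and c = 1])
    show "(kv kappa0 has_real_derivative 2 * N kappa0 * tau0 - bv kappa0) (at tau0)"
      unfolding kv_def [abs_def] by (auto intro!: derivative_eq_intros)
    show "eventually (\<lambda>v. lv kappa0 v = 1 + kv kappa0 v / (v * (1 - v * N kappa0))) (nhds tau0)"
      using ok_eventually_y [OF o] by eventually_elim (subst kv_eq, simp_all add: admissible_def)
  qed (use kv_kap_zero tau0 o in \<open>auto simp: admissible_def intro!: continuous_intros\<close>)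
  then have l0: "l' = 0" using D(5) ky_ta DERIV_unique by fastforce
  define X where "X v = ?n v * (1 - lv kappa0 v) + ?o v * ?T v" for v
  define Y where "Y v = kappa0 / v * ?T v" for v
  have Xd: "(X has_real_derivative (o' * ?T tau0 + T' * ?o tau0)) (at tau0)"
    unfolding X_def using D l0 l1 by (auto intro!: derivative_eq_intros)
  define Y' where "Y' = kappa0 / tau0 * T' - kappa0 / tau0\<^sup>2 * ?T tau0"
  have Yd: "(Y has_real_derivative Y') (at tau0)"
    unfolding Y_def Y'_def using D tau0 by (auto intro!: derivative_eq_intros simp: power2_eq_square diff_divide_distrib mult.commute)
  have Cd: "((\<lambda>v. X v / ?d v) has_real_derivative
     ((o' * ?T tau0 + T' * ?o tau0) * ?d tau0 - X tau0 * d') / (?d tau0 * ?d tau0)) (at tau0)"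
    using dp by (intro DERIV_divide Xd D) auto
  have Dd: "((\<lambda>v. Y v / ?d v) has_real_derivative (Y' * ?d tau0 - Y tau0 * d') / (?d tau0 * ?d tau0)) (at tau0)"
    using dp by (intro DERIV_divide Yd D) auto
  have Cev: "eventually (\<lambda>v. C_fun R \<theta> kappa0 x v = X v / ?d v) (nhds tau0)"
    using ev by eventually_elim (simp add: C_fun_eq X_def)
  have Dev: "eventually (\<lambda>v. D_fun R \<theta> kappa0 x v = Y v / ?d v) (nhds tau0)"
    using ev by eventually_elim (simp add: D_fun_eq Y_def)
  have C1: "deriv (\<lambda>v. C_fun R \<theta> kappa0 x v) tau0 = ((o' * ?T tau0 + T' * ?o tau0) * ?d tau0 - X tau0 * d') / (?d tau0 * ?d tau0)"
    using DERIV_imp_deriv Cd DERIV_cong_ev [OF refl Cev refl] by blast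
  have D1: "deriv (\<lambda>v. D_fun R \<theta> kappa0 x v) tau0 = (Y' * ?d tau0 - Y tau0 * d') / (?d tau0 * ?d tau0)"
    using DERIV_imp_deriv Dd DERIV_cong_ev [OF refl Dev refl] by blast
  have C0: "C_fun R \<theta> kappa0 x tau0 = X tau0 / ?d tau0" using eventually_nhds_x_imp_x [OF Cev] .
  have D0: "D_fun R \<theta> kappa0 x tau0 = Y tau0 / ?d tau0" using eventually_nhds_x_imp_x [OF Dev] .
  have T0: "0 < ?T tau0" using tailv_pos [OF o] .
  have X0: "X tau0 = ?o tau0 * ?T tau0" by (simp add: X_def l1)
  have Y0: "Y tau0 = kappa0 / tau0 * ?T tau0" by (simp add: Y_def)
  \<comment> \<open>Here \<open>1 / (1 - y N)^2\<close> is the derivative of \<open>zeta\<close> in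
    \<open>y\<close>; at the critical point it equals \<open>1 / G\<close>.\<close>
  have od: "o' = (n1v kappa0 / (1 - tau0 * N kappa0)\<^sup>2 - ?o tau0) / tau0"
  proof -
    have q: "1 - tau0 * N kappa0 \<noteq> 0" using o by (simp add: admissible_def)
    have zd: "((\<lambda>v. zv kappa0 v) has_real_derivative 1 / (1 - tau0 * N kappa0)\<^sup>2) (at tau0)"
      unfolding zv_def using q by (auto intro!: derivative_eq_intros simp: power2_eq_square)
    have "((\<lambda>v. (q0v kappa0 + n1v kappa0 * zv kappa0 v) / v) has_real_derivative
       (n1v kappa0 * (1 / (1 - tau0 * N kappa0)\<^sup>2) * tau0 - (q0v kappa0 + n1v kappa0 * zv kappa0 tau0)) / (tau0 * tau0)) (at tau0)"
      using tau0 by (auto intro!: derivative_eq_intros zd)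
    note zq = this
    have zev: "eventually (\<lambda>v. ?o v = (q0v kappa0 + n1v kappa0 * zv kappa0 v) / v) (nhds tau0)"
      using ok_eventually_y [OF o] by eventually_elim (rule tosv_eq)
    have "(?o has_real_derivative
       (n1v kappa0 * (1 / (1 - tau0 * N kappa0)\<^sup>2) * tau0 - (q0v kappa0 + n1v kappa0 * zv kappa0 tau0)) / (tau0 * tau0)) (at tau0)"
      by (rule iffD2 [OF DERIV_cong_ev [OF refl zev refl] zq])
    then have "o' = (n1v kappa0 * (1 / (1 - tau0 * N kappa0)\<^sup>2) * tau0 - (q0v kappa0 + n1v kappa0 * zv kappa0 tau0)) / (tau0 * tau0)"
      using D(4) DERIV_unique by blast
    also have "q0v kappa0 + n1v kappa0 * zv kappa0 tau0 = ?o tau0 * tau0" using tosv_eq [OF o] tau0 by simp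
    also have "(n1v kappa0 * (1 / (1 - tau0 * N kappa0)\<^sup>2) * tau0 - ?o tau0 * tau0) / (tau0 * tau0)
        = (n1v kappa0 * (1 / (1 - tau0 * N kappa0)\<^sup>2) - ?o tau0) / tau0"
      unfolding left_diff_distrib [symmetric] using tau0 by simp
    finally show ?thesis by simp
  qed
  have G: "(1 - tau0 * N kappa0)\<^sup>2 = G kappa0"
  proof -
    have "1 - tau0 * N kappa0 = sqrt (G kappa0)" using kap_values by simp
    then show ?thesis using ANG_pos(3) [OF kappa0(1,2)] by simp
  qed
  \<comment> \<open>The right-hand side no longer contains \<open>e\<close>, the derivative of the
    common denominator.\<close>
  have alg: "E / (Y0 / d) * ((X' * d - X0 * e) / (d * d) - (Y1 * d - Y0 * e) / (d * d) * ((X0 / d) / (Y0 / d)))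
      = E * ((X' - Y1 * X0 / Y0) / Y0)" if "d \<noteq> 0" "Y0 \<noteq> 0" for E Y0 d X' X0 e Y1 :: real
    using that by (simp add: field_simps)
  have "((o' * ?T tau0 + T' * ?o tau0) - Y' * X tau0 / Y tau0) / Y tau0 = n1v kappa0 / (kappa0 * G kappa0)"
    unfolding X0 Y0 Y'_def od G using T0 tau0 kappa0(2) ANG_pos(3) [OF kappa0(1,2)]
    by (simp add: field_simps power2_eq_square)
  moreover have "D_over_one_minus_B R \<theta> kappa0 x y = kappa0 / y * tailv \<theta> kappa0 y / (1 - lv kappa0 y)"
    using lv_kap [OF y] by (intro D_over_eq) auto
  moreover have "2 / (kappa0 * (2 * N kappa0 / (kt kappa0 tau0 * kappa0\<^sup>2))) = kappa0 * kt kappa0 tau0 / N kappa0"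
    using kappa0(2) ANG_pos(2) [OF kappa0(1,2)] kt_pos [OF o] kv_kap_zero [of tau0] by (simp add: field_simps power2_eq_square)
  moreover have "Y tau0 \<noteq> 0" using Y0 T0 tau0 kappa0 by simp
  ultimately show ?thesis
    unfolding c_minus_def Let_def kappa_eq tau_eq mu_deriv2 C1 D1 C0 D0
    using dp by (simp only: mult.assoc) (subst alg, simp_all)
qed

end

section \<open>The half-plane series\<close>

definition ce :: "real fps \<Rightarrow> complex \<Rightarrow> complex" where
  "ce F z = eval_fps (cfps F) z"

lemma ce_add: "conv_at F t \<Longrightarrow> conv_at G t \<Longrightarrow> norm z \<le> t \<Longrightarrow> ce (F + G) z = ce F z + ce G z"
  and ce_diff: "conv_at F t \<Longrightarrow> conv_at G t \<Longrightarrow> norm z \<le> t \<Longrightarrow> ce (F - G) z = ce F z - ce G z"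
  and ce_mult: "conv_at F t \<Longrightarrow> conv_at G t \<Longrightarrow> norm z \<le> t \<Longrightarrow> ce (F * G) z = ce F z * ce G z"
  unfolding ce_def cfps_add cfps_diff cfps_mult
  by (rule ev_add ev_diff ev_mult; simp)+

lemma ce_simps: "ce (fps_const a) z = of_real a" "ce fps_X z = z" "ce 1 z = 1"
  by (simp_all add: ce_def cfps_const cfps_X cfps_1)

lemma ce_real: "conv_at F t \<Longrightarrow> 0 \<le> t \<Longrightarrow> ce F (of_real t) = of_real (eval_fps F t)"
  unfolding ce_def by (rule eval_cfps_real) simp

lemma norm_ce_le: "nonneg_coeffs F \<Longrightarrow> conv_at F (norm z) \<Longrightarrow> norm (ce F z) \<le> eval_fps F (norm z)"
  unfolding ce_def by (rule norm_eval_cfps_le)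

lemma ce_0: "ce F 0 = of_real (fps_nth F 0)"
  by (simp add: ce_def eval_fps_at_0)

lemma ce_holomorphic: "ereal r \<le> fps_conv_radius F \<Longrightarrow> ce F holomorphic_on ball 0 r"
  unfolding ce_def [abs_def] by (rule holomorphic_on_eval_fps) (simp add: ball_eball_mono)

lemma conv_at_radius: "conv_at F r \<Longrightarrow> ereal r \<le> fps_conv_radius F"
  by (simp add: conv_at_def)

lemma ce_deriv:
  assumes "conv_at F t" "0 \<le> t"
  shows "(ce F has_field_derivative of_real (eval_fps (fps_deriv F) t)) (at (of_real t))"
proof -
  have e: "fps_deriv (cfps F) = cfps (fps_deriv F)" by (simp add: fps_eq_iff)
  have "conv_at (fps_deriv F) t"
    using assms fps_conv_radius_deriv [of F] unfolding conv_at_def by (metis less_le_trans)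
  then have "eval_fps (fps_deriv (cfps F)) (of_real t) = of_real (eval_fps (fps_deriv F) t)"
    unfolding e using assms by (intro eval_cfps_real) simp
  moreover have "(ce F has_field_derivative eval_fps (fps_deriv (cfps F)) (of_real t)) (at (of_real t))"
    unfolding ce_def [abs_def] using assms
    by (intro has_field_derivative_eval_fps) (simp add: conv_at_def)
  ultimately show ?thesis by simp
qed

context vertical_rule
begin

definition cA where "cA z = ce (g South South) z"
definition cN where "cN z = ce (g North North) z"
definition cG where "cG z = ce (g South North) z * ce (g North South) z"
definition cc where "cc z = 1 - cG z - cA z * cN z"
text \<open>The discriminant of the kernel in \<open>zeta\<close> is \<open>cc^2 (1 - cV)\<close>.
  In this normalization \<open>1 - cV\<close> has nonnegative real part on the closed disc, so the
  principal root never meets its branch cut except at the branch point itself.\<close>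

definition cV where "cV z = 4 * cA z * cG z * cN z / (cc z)\<^sup>2"
definition cW where "cW z = csqrt (1 - cV z)"
text \<open>The small root of \<open>G N Z^2 - cc Z + A\<close>. The form with \<open>1 + cW\<close>
  in the denominator is regular at the origin, where \<open>G N\<close> vanishes.\<close>

definition cZ where "cZ z = 2 * cA z / (cc z * (1 + cW z))"
definition c0 where "c0 = 1 - G kappa0 - A kappa0 * N kappa0"

text \<open>Squaring the critical equation gives \<open>1 - G - A N = 2 sqrt (A N G)\<close>, so
  \<open>c0\<close> is at once the minimum of \<open>cc\<close> in modulus and the root of the
  maximum of \<open>4 A G N\<close>.\<close>

lemma c0_eq: "c0 = 2 * (sqrt (A kappa0 * N kappa0) * sqrt (G kappa0))" "0 < c0" "c0\<^sup>2 = 4 * (A kappa0 * N kappa0 * G kappa0)"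
proof -
  note p = ANG_pos [OF kappa0(1,2)]
  have "(sqrt (A kappa0 * N kappa0) + sqrt (G kappa0))\<^sup>2 = 1" using kappa0(3) by (simp add: crit_def)
  then have "A kappa0 * N kappa0 + G kappa0 + 2 * (sqrt (A kappa0 * N kappa0) * sqrt (G kappa0)) = 1"
    using p by (simp add: power2_sum)
  then show 1: "c0 = 2 * (sqrt (A kappa0 * N kappa0) * sqrt (G kappa0))" unfolding c0_def by linarith
  then show "0 < c0" using p by simp
  show "c0\<^sup>2 = 4 * (A kappa0 * N kappa0 * G kappa0)" unfolding 1 using p by (simp add: power_mult_distrib)
qed

lemma ce_g_real: "conv_dom t \<Longrightarrow> ce (g i j) (of_real t) = of_real (gv i j t)"
  unfolding gv_def by (intro ce_real domD)

lemma c_real: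
  assumes "conv_dom t"
  shows "cA (of_real t) = of_real (A t)" "cN (of_real t) = of_real (N t)" "cG (of_real t) = of_real (G t)"
    "cc (of_real t) = of_real (1 - G t - A t * N t)"
  by (simp_all add: cA_def cN_def cG_def cc_def A_def N_def G_def ce_g_real [OF assms])

lemma norm_ce_g:
  assumes "norm z \<le> kappa0"
  shows "norm (ce (g i j) z) \<le> gv i j (norm z)" "gv i j (norm z) \<le> gv i j kappa0"
proof -
  have "conv_dom (norm z)" using dom_mono kappa0(1) assms by simp
  then show "norm (ce (g i j) z) \<le> gv i j (norm z)"
    unfolding gv_def by (intro norm_ce_le g_nonneg domD)
  show "gv i j (norm z) \<le> gv i j kappa0" using kappa0 assms by (intro gv_mono) auto
qed

lemma norm_cANG:
  assumes "norm z \<le> kappa0"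
  shows "norm (cA z) \<le> A kappa0" "norm (cN z) \<le> N kappa0" "norm (cG z) \<le> G kappa0"
    "norm (cA z * cN z) \<le> A kappa0 * N kappa0" "norm (cG z) \<le> G (norm z)"
proof -
  note 1 = norm_ce_g [OF assms]
  note 2 = order_trans [OF 1]
  show A: "norm (cA z) \<le> A kappa0" "norm (cN z) \<le> N kappa0" using 2 by (auto simp: cA_def cN_def A_def N_def)
  show "norm (cG z) \<le> G kappa0" unfolding cG_def G_def norm_mult using 2 gv_nonneg kappa0(1) by (intro mult_mono) auto
  show "norm (cA z * cN z) \<le> A kappa0 * N kappa0" unfolding norm_mult
    using A order_trans [OF norm_ge_zero A(1)] by (intro mult_mono) auto
  have "conv_dom (norm z)" using dom_mono kappa0(1) assms by simp
  then show "norm (cG z) \<le> G (norm z)" unfolding cG_def G_def norm_mult using 1 gv_nonneg by (intro mult_mono) auto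
qed

lemma norm_cc:
  assumes "norm z \<le> kappa0" shows "c0 \<le> norm (cc z)" "cc z \<noteq> 0"
proof -
  have "1 \<le> norm (cc z) + norm (cG z) + norm (cA z * cN z)"
  proof -
    have "norm (1::complex) = norm (cc z + cG z + cA z * cN z)" by (simp add: cc_def)
    also have "\<dots> \<le> norm (cc z) + norm (cG z) + norm (cA z * cN z)" by (meson add_right_mono norm_triangle_ineq order_trans)
    finally show ?thesis by simp
  qed
  then show "c0 \<le> norm (cc z)" using norm_cANG [OF assms] by (simp add: c0_def)
  then show "cc z \<noteq> 0" using c0_eq(2) by auto
qed

lemma norm_4AGN:
  assumes "norm z \<le> kappa0"
  shows "norm (4 * cA z * cG z * cN z) \<le> c0\<^sup>2" "norm z < kappa0 \<Longrightarrow> norm (4 * cA z * cG z * cN z) < c0\<^sup>2"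
proof -
  have e: "norm (4 * cA z * cG z * cN z) = 4 * (norm (cA z * cN z) * norm (cG z))" by (simp add: norm_mult)
  note p = ANG_pos [OF kappa0(1,2)]
  have "norm (cA z * cN z) * norm (cG z) \<le> (A kappa0 * N kappa0) * G kappa0"
    using norm_cANG [OF assms] p by (intro mult_mono) auto
  then show "norm (4 * cA z * cG z * cN z) \<le> c0\<^sup>2" unfolding e c0_eq(3) by simp
  assume z: "norm z < kappa0"
  have "G (norm z) < G kappa0" unfolding G_def using kappa0 z dom_mono [OF kappa0(1), of "norm z"]
    by (intro mult_strict_mono' gv_strict_mono g_South_North g_North_South gv_nonneg) auto
  then have "norm (cG z) < G kappa0" using norm_cANG(5) [OF assms] by simp
  moreover have "norm (cA z * cN z) * norm (cG z) \<le> (A kappa0 * N kappa0) * norm (cG z)"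
    using norm_cANG [OF assms] by (intro mult_right_mono) auto
  ultimately have "norm (cA z * cN z) * norm (cG z) < (A kappa0 * N kappa0) * G kappa0"
    using p by (smt (verit) mult_pos_pos mult_strict_left_mono)
  then show "norm (4 * cA z * cG z * cN z) < c0\<^sup>2" unfolding e c0_eq(3) by simp
qed

text \<open>The same number \<open>c0^2\<close> bounds the numerator from above and the denominator
  from below. A point of the closed unit disc other than 1 has real part less than 1.\<close>

lemma norm_cV:
  assumes "norm z \<le> kappa0"
  shows "norm (cV z) \<le> 1" "norm z < kappa0 \<Longrightarrow> norm (cV z) < 1" "cV z \<noteq> 1 \<Longrightarrow> 0 < Re (1 - cV z)"
proof -
  have c: "c0\<^sup>2 \<le> (norm (cc z))\<^sup>2" "0 < (norm (cc z))\<^sup>2"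
    using norm_cc [OF assms] c0_eq(2) by (auto intro: power_mono)
  have e: "norm (cV z) = norm (4 * cA z * cG z * cN z) / (norm (cc z))\<^sup>2" by (simp add: cV_def norm_divide norm_power)
  show le: "norm (cV z) \<le> 1" unfolding e using c norm_4AGN(1) [OF assms] by (simp add: divide_le_eq_1)
  show "norm z < kappa0 \<Longrightarrow> norm (cV z) < 1"
    unfolding e using c norm_4AGN(2) [OF assms] by (simp add: divide_less_eq_1)
  show "cV z \<noteq> 1 \<Longrightarrow> 0 < Re (1 - cV z)"
  proof (rule ccontr)
    assume "cV z \<noteq> 1" "\<not> 0 < Re (1 - cV z)"
    then have "1 \<le> Re (cV z)" by simp
    then have "Re (cV z) = 1" "norm (cV z) = 1" using le complex_Re_le_cmod [of "cV z"] by linarith+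
    then show False using norm_1_Re_1 \<open>cV z \<noteq> 1\<close> by blast
  qed
qed

text \<open>A principal root has nonnegative real part, which keeps \<open>1 + cW\<close> away from
  0.\<close>

lemma cW_facts: "(cW z)\<^sup>2 = 1 - cV z" "1 \<le> norm (1 + cW z)" "1 + cW z \<noteq> 0"
proof -
  show "(cW z)\<^sup>2 = 1 - cV z" by (simp add: cW_def)
  have "1 \<le> Re (1 + cW z)" unfolding cW_def using Re_csqrt [of "1 - cV z"] by (simp del: csqrt.simps)
  then show "1 \<le> norm (1 + cW z)" using complex_Re_le_cmod [of "1 + cW z"] by linarith
  then show "1 + cW z \<noteq> 0" by auto
qed

lemma cZ_eq:
  assumes "norm z \<le> kappa0"
  shows "cG z * cN z * cZ z = cc z * (1 - cW z) / 2"
    "cG z * cN z * (cZ z)\<^sup>2 - cc z * cZ z + cA z = 0"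
proof -
  note c = norm_cc(2) [OF assms]
  have "4 * cA z * cG z * cN z = (cc z)\<^sup>2 * (1 - (cW z)\<^sup>2)"
    using c by (simp add: cW_facts(1) cV_def)
  then have 0: "4 * cA z * cG z * cN z = (cc z)\<^sup>2 * ((1 - cW z) * (1 + cW z))"
    by (simp add: power2_eq_square algebra_simps)
  define D where "D = 2 * (cc z * (1 + cW z))"
  have D: "D \<noteq> 0" using c cW_facts(3) [of z] by (simp add: D_def)
  have "cG z * cN z * cZ z * D = 4 * cA z * cG z * cN z"
    using c cW_facts(3) [of z] by (simp add: cZ_def D_def)
  also have "\<dots> = cc z * (1 - cW z) / 2 * D"
    unfolding 0 D_def by (simp add: power2_eq_square)
  finally have e: "cG z * cN z * cZ z * D = cc z * (1 - cW z) / 2 * D" .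
  show 1: "cG z * cN z * cZ z = cc z * (1 - cW z) / 2" by (rule mult_right_cancel [OF D, THEN iffD1, OF e])
  have "cZ z * (cc z * (1 + cW z)) = 2 * cA z" using c cW_facts(3) [of z] by (simp add: cZ_def)
  then have 2: "cA z = cZ z * (cc z * (1 + cW z)) / 2" by simp
  have "cG z * cN z * (cZ z)\<^sup>2 = cc z * (1 - cW z) / 2 * cZ z"
    unfolding 1 [symmetric] by (simp add: power2_eq_square)
  then show "cG z * cN z * (cZ z)\<^sup>2 - cc z * cZ z + cA z = 0"
    by (subst 2) (simp add: field_simps)
qed

section \<open>Convergence of the half-plane series up to \<open>\<kappa>\<close>\<close>

lemma parts_conv:
  assumes "admissible t y"
  shows "conv_at (loop y) t" "conv_at (tail y \<theta>) t" "conv_at (no_South y \<theta>) t" "conv_at (to_South y) t"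
proof -
  note 1 = tgf_South_val(1) [OF assms]
  show "conv_at (loop y) t" unfolding loop_def by (rule 1)
  show "conv_at (tail y \<theta>) t" unfolding tail_def by (simp add: 1)
  show "conv_at (to_South y) t" unfolding to_South_def by (intro conv_at_sum conv_at_mult conv_unit_step 1)
  have i: "conv_at (if k = \<theta> then 1 else 0 :: real fps) t" for k by simp
  show "conv_at (no_South y \<theta>) t" unfolding no_South_def
    by (auto intro!: conv_at_sum conv_at_mult conv_at_add conv_unit_step 1 i)
qed

lemma all_from_nonneg: "0 < y \<Longrightarrow> nonneg_coeffs (all_from y k \<theta>)"
  unfolding all_from_def using tgf_nonneg by (intro nonneg_coeffs_add) auto

text \<open>At \<open>y = tau0\<close> the loop reaches 1 only at \<open>kappa0\<close>, so the
  full-plane series converge below it.\<close>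

lemma all_from_conv:
  assumes "0 < t" "t < kappa0"
  shows "conv_at (all_from tau0 South \<theta>) t"
proof -
  have o: "admissible t tau0" using ok_mono [OF is_rho_ta(2)] assms by simp
  have l: "lv t tau0 < 1" using lv_strict_mono [OF is_rho_ta(2) assms] is_rho_ta(1) by (simp add: is_rho_def)
  have tau0: "0 < tau0" by (rule kap_values)
  have 1: "conv_at (inverse (1 - loop tau0)) t"
  proof (rule conv_at_geometric)
    show "nonneg_coeffs (loop tau0)" unfolding loop_def using tau0 by (rule tgf_nonneg)
    show "fps_nth (loop tau0) 0 = 0" unfolding loop_def by (rule tgf_nth_0)
    show "eval_fps (loop tau0) t < 1" using l tgf_South_val(2) [OF o] by (simp add: loop_def lv_def)
  qed (use parts_conv(1) [OF o] assms in auto)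
  have "inverse (1 - loop tau0) * (1 - loop tau0) = 1"
    by (rule inverse_mult_eq_1) (simp add: loop_def tgf_nth_0)
  then have "all_from tau0 South \<theta> = inverse (1 - loop tau0) * tail tau0 \<theta>"
    unfolding all_from_South [OF tau0, symmetric] by (simp add: mult.assoc [symmetric])
  then show ?thesis using 1 parts_conv(2) [OF o] by (simp add: conv_at_mult)
qed

lemma K_nonneg: "nonneg_coeffs K"
  unfolding K_def using x_pos by (intro nonneg_coeffs_sum nonneg_coeffs_mult walk_gf_nonneg) auto

lemma H_nonneg: "0 < y \<Longrightarrow> nonneg_coeffs (H y \<theta>)"
  unfolding H_def using x_pos by (intro walk_gf_nonneg)

lemma unit_step_nonneg: "0 < y \<Longrightarrow> nonneg_coeffs (unit_step y k)"
  unfolding unit_step_def using x_pos by (intro nonneg_coeffs_mult) (auto simp: step_weight_def)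

text \<open>At \<open>tau0\<close> the half-plane series is dominated by a full-plane one.
  Half-plane walks end at nonnegative height, so the weights for \<open>y \<le> tau0\<close> are no
  larger than at \<open>tau0\<close>.\<close>

lemma H_conv:
  assumes "0 < t" "t < kappa0" "0 < y" "y \<le> tau0"
  shows "conv_at (H y \<theta>) t"
proof -
  have tau0: "0 < tau0" by (rule kap_values)
  have o: "admissible t tau0" using ok_mono [OF is_rho_ta(2)] assms by simp
  let ?U = "no_South tau0 \<theta> + to_South tau0 * all_from tau0 South \<theta>"
  have cU: "conv_at ?U t"
    using parts_conv [OF o] all_from_conv assms by (intro conv_at_add conv_at_mult) auto
  have HU: "H tau0 \<theta> = ?U - unit_step tau0 South * K * all_from tau0 South \<theta>"
    unfolding H_all_from [OF tau0] all_from_not_South [OF tau0] ..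
  have "nonneg_coeffs (unit_step tau0 South * K * all_from tau0 South \<theta>)"
    by (intro nonneg_coeffs_mult unit_step_nonneg K_nonneg all_from_nonneg tau0)
  then have "fps_nth (H tau0 \<theta>) n \<le> fps_nth ?U n" for n unfolding HU by (simp add: nonneg_coeffs_def)
  then have cH: "conv_at (H tau0 \<theta>) t"
    using conv_at_coeff_le [OF H_nonneg [OF tau0] _ cU] assms by auto
  have "fps_nth (H y \<theta>) n \<le> fps_nth (H tau0 \<theta>) n" for n
    unfolding H_def walk_gf_nth
  proof (rule sum_mono)
    fix w assume "w \<in> {w \<in> half_plane_walks R \<theta>. length w = n}"
    then have "0 \<le> end_y (take (length w) w)" unfolding half_plane_walks_def by blast
    then have "y powi end_y w \<le> tau0 powi end_y w"
      using assms by (simp add: power_int_def power_mono)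
    then show "x powi end_x w * y powi end_y w \<le> x powi end_x w * tau0 powi end_y w"
      using x_pos by (intro mult_left_mono) auto
  qed
  then show ?thesis using conv_at_coeff_le [OF H_nonneg [OF assms(3)] _ cH] assms by auto
qed

lemma K_conv:
  assumes "0 < t" "t < kappa0"
  shows "conv_at K t"
proof -
  have tau0: "0 < tau0" by (rule kap_values)
  let ?Z = "\<lambda>i. {w \<in> half_plane_walks R i. end_y w = 0}"
  have "fps_nth (walk_gf (?Z i) x 1) n \<le> fps_nth (H tau0 i) n" for i n
  proof -
    have "walk_gf (?Z i) x 1 = walk_gf (?Z i) x tau0" using walk_gf_height [of "?Z i" 0 x tau0] by simp
    also have "fps_nth \<dots> n \<le> fps_nth (H tau0 i) n"
      unfolding H_def walk_gf_nth using x_pos tau0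
      by (intro sum_mono2) (auto simp: finite_length_eq)
    finally show ?thesis .
  qed
  then have "conv_at (walk_gf (?Z i) x 1) t" for i
    using conv_at_coeff_le [of "walk_gf (?Z i) x 1" "H tau0 i" t] H_conv [of t tau0 i] assms tau0 walk_gf_nonneg [OF x_pos, of 1]
    by auto
  then show ?thesis unfolding K_def by (intro conv_at_sum conv_at_mult conv_at_simps)
qed

lemma ta_sqrt: "tau0 * sqrt (A kappa0 * N kappa0) = A kappa0" "zv kappa0 tau0 * sqrt (G kappa0) = tau0" "G kappa0 * N kappa0 * zv kappa0 tau0 = c0 / 2"
proof -
  note p = ANG_pos [OF kappa0(1,2)]
  have "sqrt (A kappa0) * sqrt (A kappa0) = A kappa0" using p by simp
  then show "tau0 * sqrt (A kappa0 * N kappa0) = A kappa0"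
    unfolding tau0_def using p by (simp add: real_sqrt_divide real_sqrt_mult field_simps)
  have "1 - tau0 * N kappa0 = sqrt (G kappa0)" using kap_values by simp
  then have z: "zv kappa0 tau0 = tau0 / sqrt (G kappa0)" by (simp add: zv_def)
  then show 2: "zv kappa0 tau0 * sqrt (G kappa0) = tau0" using p by simp
  have "G kappa0 * N kappa0 * zv kappa0 tau0 = (sqrt (G kappa0) * sqrt (G kappa0)) * N kappa0 * zv kappa0 tau0" using p by simp
  also have "\<dots> = sqrt (G kappa0) * ((zv kappa0 tau0 * sqrt (G kappa0)) * N kappa0)" by (simp only: mult_ac)
  also have "\<dots> = c0 / 2" unfolding 2 using kap_values c0_eq by simp
  finally show "G kappa0 * N kappa0 * zv kappa0 tau0 = c0 / 2" .
qed

text \<open>The kernel method: substituting the small root of the kernel for \<open>y\<close> eliminates the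
  half-plane series from \<open>H_eq\<close>.\<close>

lemma K_real:
  assumes t: "0 < t" "t < kappa0"
  shows "of_real t * ce K (of_real t) = ce q0 (of_real t) + ce n1 (of_real t) * cZ (of_real t)"
proof -
  have d: "conv_dom t" using dom_mono kappa0(1) t by simp
  note p = ANG_pos [OF d t(1)] and p0 = ANG_pos [OF kappa0(1,2)]
  define c where "c = 1 - G t - A t * N t"
  define v where "v = 4 * A t * G t * N t / c\<^sup>2"
  define w where "w = sqrt (1 - v)"
  define Z where "Z = 2 * A t / (c * (1 + w))"
  have le: "gv i j t \<le> gv i j kappa0" for i j using kappa0 t by (intro gv_mono) auto
  have AN: "A t \<le> A kappa0" "N t \<le> N kappa0" using le by (auto simp: A_def N_def)
  have Gle: "G t \<le> G kappa0" unfolding G_def using le gv_nonneg d kappa0(1) by (intro mult_mono) auto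
  have "A t * N t \<le> A kappa0 * N kappa0" using AN p p0 by (intro mult_mono) auto
  then have c: "c0 \<le> c" using Gle by (simp add: c_def c0_def)
  then have cp: "0 < c" using c0_eq(2) by simp
  have nz: "norm (complex_of_real t) \<le> kappa0" "norm (complex_of_real t) < kappa0" using t by auto
  have cV: "cV (of_real t) = of_real v" by (simp add: cV_def c_real [OF d] v_def c_def)
  have "\<bar>v\<bar> < 1" using norm_cV(2) [OF nz] by (simp add: cV)
  then have w0: "0 \<le> w" "w\<^sup>2 = 1 - v" by (auto simp: w_def)
  have cW: "cW (of_real t) = of_real w"
  proof -
    have "1 - cV (of_real t) = of_real (1 - v)" by (simp add: cV)
    then show ?thesis unfolding cW_def w_def using \<open>\<bar>v\<bar> < 1\<close> by (simp only: csqrt_of_real_nonneg) simp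
  qed
  have cZ: "cZ (of_real t) = of_real Z" by (simp add: cZ_def c_real [OF d] cW Z_def c_def)
  have "complex_of_real (G t * N t * Z\<^sup>2 - c * Z + A t) = 0"
    using cZ_eq(2) [OF nz(1)] by (simp add: cZ c_real [OF d] c_def)
  then have q: "G t * N t * Z\<^sup>2 - c * Z + A t = 0" by (simp only: of_real_eq_0_iff)
  have Zp: "0 < Z" using p cp w0 by (simp add: Z_def)
  \<comment> \<open>The bound by the value of \<open>zeta\<close> at the critical point guarantees
    below that the substituted height weight stays at most \<open>tau0\<close>.\<close>
  have Zle: "Z \<le> zv kappa0 tau0"
  proof -
    have "Z \<le> 2 * A kappa0 / (c0 * 1)"
      unfolding Z_def using AN p c c0_eq(2) w0 p0 by (intro frac_le mult_mono) auto
    also have "\<dots> = tau0 / sqrt (G kappa0)"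
    proof -
      have "2 * A kappa0 = 2 * (tau0 * sqrt (A kappa0 * N kappa0))" by (simp only: ta_sqrt(1))
      then show ?thesis unfolding c0_eq(1) using p0 by (simp add: field_simps)
    qed
    also have "\<dots> = zv kappa0 tau0"
    proof -
      have "tau0 = zv kappa0 tau0 * sqrt (G kappa0)" by (simp only: ta_sqrt(2))
      moreover have "sqrt (G kappa0) \<noteq> 0" using p0 by simp
      ultimately show ?thesis by (metis nonzero_mult_div_cancel_right)
    qed
    finally show ?thesis .
  qed
  \<comment> \<open>The inverse of the substitution \<open>zeta = y / (1 - y N)\<close>, so that
    \<open>zv t Y = Z\<close> and the loop equals 1 at \<open>Y\<close>.\<close>
  define Y where "Y = Z / (1 + Z * N t)"
  have ZN: "0 < 1 + Z * N t" using Zp p by (simp add: add_pos_pos)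
  have Yp: "0 < Y" using Zp ZN by (simp add: Y_def)
  have YN: "1 - Y * N t = 1 / (1 + Z * N t)" using ZN by (simp add: Y_def field_simps)
  have o: "admissible t Y"
  proof -
    have "0 < 1 - Y * N t" unfolding YN using ZN by simp
    then show ?thesis using d t Yp by (simp add: admissible_def)
  qed
  have zvY: "zv t Y = Z" unfolding zv_def YN using ZN by (simp add: Y_def)
  have YA: "A t + G t * Z = Y"
  proof -
    have "(A t + G t * Z) * (1 + Z * N t) = Z" using q by (simp add: c_def algebra_simps power2_eq_square)
    then show ?thesis unfolding Y_def using ZN by (simp add: field_simps)
  qed
  have "lv t Y = 1" using lv_eq [OF o] zvY YA Yp by simp
  have "Y \<le> A kappa0 + G kappa0 * zv kappa0 tau0"
    unfolding YA [symmetric] using AN Gle Zle Zp p0 by (intro add_mono mult_mono) auto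
  also have "\<dots> = tau0"
    using lv_eq [OF is_rho_ta(2)] is_rho_ta(1) kap_values(6) by (simp add: is_rho_def)
  finally have Yta: "Y \<le> tau0" .
  \<comment> \<open>Convergence at \<open>Y\<close> is what allows the vanishing kernel to
    annihilate the left-hand side of \<open>H_eq\<close>. With \<open>\<theta> = South\<close> the
    tail is 1, and \<open>K\<close> is left isolated.\<close>
  have cH: "conv_at (H Y South) t" using H_conv t Yp Yta by blast
  have cK: "conv_at K t" using K_conv t by blast
  note pc = parts_conv [OF o]
  have "eval_fps ((H Y South - no_South Y South) * (1 - loop Y)) t
      = eval_fps ((to_South Y - unit_step Y South * K) * tail Y South) t"
    by (simp only: H_eq [OF Yp])
  moreover have "eval_fps (1 - loop Y) t = 0"
    using \<open>lv t Y = 1\<close> tgf_South_val(2) [OF o, of South South] pc t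
    by (simp add: ev_diff [of _ t] loop_def lv_def)
  ultimately have "eval_fps ((to_South Y - unit_step Y South * K) * tail Y South) t = 0"
    using cH pc t by (simp add: ev_mult [of _ t] conv_at_diff)
  moreover have "tail Y South = 1" by (simp add: tail_def)
  ultimately have "eval_fps (to_South Y) t = eval_fps (unit_step Y South) t * eval_fps K t"
    using pc cK t conv_unit_step by (simp add: ev_diff [of _ t] ev_mult [of _ t] conv_at_mult)
  moreover have "eval_fps (unit_step Y South) t = t / Y"
  proof -
    have "eval_fps (fps_const a * fps_X) t = a * t" for a :: real
      by (subst ev_mult [of _ t]) (use t in simp_all)
    then show ?thesis unfolding unit_step_def by (simp add: step_weight_def power_int_minus divide_inverse)
  qed
  moreover have "eval_fps (to_South Y) t = tosv t Y"
    using rat_val_parts(4) [OF o] rat_val_eval [of "to_South Y" t] pc(4) t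
    by (metis abs_of_pos rat_eval_eq rational_fps_iff)
  ultimately have "tosv t Y = t / Y * eval_fps K t" by simp
  then have "t * eval_fps K t = q0v t + n1v t * Z"
    unfolding tosv_eq [OF o] zvY using Yp by (simp add: field_simps)
  then have "complex_of_real (t * eval_fps K t) = of_real (q0v t + n1v t * Z)" by simp
  then show ?thesis using t cK conv_q0_n1 [OF d] by (simp add: ce_real cZ q0v_def n1v_def)
qed

section \<open>The explicit half-plane series and its continuation across the circle\<close>

definition big_radius where "big_radius = (SOME r. kappa0 < r \<and> conv_dom r)"

lemma big_radius: "kappa0 < big_radius" "conv_dom big_radius"
  unfolding big_radius_def using someI_ex [of "\<lambda>r. kappa0 < r \<and> conv_dom r"] dom_enlarge [OF kappa0(1)] by metis+

lemma c_holomorphic: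
  shows "cA holomorphic_on ball 0 big_radius" "cN holomorphic_on ball 0 big_radius" "cG holomorphic_on ball 0 big_radius"
    "cc holomorphic_on ball 0 big_radius" "ce n1 holomorphic_on ball 0 big_radius" "ce q0 holomorphic_on ball 0 big_radius"
proof -
  have g: "ce (g i j) holomorphic_on ball 0 big_radius" for i j
    using domD(1) [OF big_radius(2)] by (intro ce_holomorphic conv_at_radius)
  show 1: "cA holomorphic_on ball 0 big_radius" "cN holomorphic_on ball 0 big_radius" "cG holomorphic_on ball 0 big_radius"
    unfolding cA_def [abs_def] cN_def [abs_def] cG_def [abs_def] by (intro holomorphic_on_mult g)+
  show "cc holomorphic_on ball 0 big_radius" unfolding cc_def [abs_def]
    by (intro holomorphic_on_diff holomorphic_on_mult holomorphic_on_const 1)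
  show "ce n1 holomorphic_on ball 0 big_radius" "ce q0 holomorphic_on ball 0 big_radius"
    using conv_q0_n1 [OF big_radius(2)] by (intro ce_holomorphic conv_at_radius; simp)+
qed

lemma cV_holomorphic:
  assumes "S \<subseteq> ball 0 big_radius" "\<And>z. z \<in> S \<Longrightarrow> cc z \<noteq> 0"
  shows "cV holomorphic_on S"
  unfolding cV_def [abs_def]
  by (intro holomorphic_on_divide holomorphic_on_mult holomorphic_on_power holomorphic_on_const
      holomorphic_on_subset [OF c_holomorphic(1)] holomorphic_on_subset [OF c_holomorphic(2)]
      holomorphic_on_subset [OF c_holomorphic(3)] holomorphic_on_subset [OF c_holomorphic(4)] assms(1))
     (simp add: assms(2))

lemma cW_holomorphic:
  assumes "S \<subseteq> ball 0 big_radius" "\<And>z. z \<in> S \<Longrightarrow> cc z \<noteq> 0" "\<And>z. z \<in> S \<Longrightarrow> 0 < Re (1 - cV z)"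
  shows "cW holomorphic_on S"
proof -
  have "(\<lambda>z. 1 - cV z) holomorphic_on S"
    by (intro holomorphic_on_diff holomorphic_on_const cV_holomorphic assms)
  then show ?thesis unfolding cW_def [abs_def]
  proof (rule holomorphic_on_csqrt')
    fix z assume "z \<in> S"
    then have "0 < Re (1 - cV z)" by (rule assms(3))
    then show "1 - cV z \<notin> \<real>\<^sub>\<le>\<^sub>0" by (auto simp: complex_nonpos_Reals_iff)
  qed
qed

lemma cZ_holomorphic:
  assumes "S \<subseteq> ball 0 big_radius" "\<And>z. z \<in> S \<Longrightarrow> cc z \<noteq> 0" "\<And>z. z \<in> S \<Longrightarrow> 0 < Re (1 - cV z)"
  shows "cZ holomorphic_on S"
  unfolding cZ_def [abs_def] using assms(2) cW_facts(3)
  by (intro holomorphic_on_divide holomorphic_on_mult holomorphic_on_add holomorphic_on_const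
      holomorphic_on_subset [OF c_holomorphic(1)] cW_holomorphic
      holomorphic_on_subset [OF c_holomorphic(4)] assms) auto

lemma inner_ball:
  assumes "z \<in> ball 0 kappa0"
  shows "cc z \<noteq> 0" "0 < Re (1 - cV z)" "norm z \<le> kappa0"
proof -
  show n: "norm z \<le> kappa0" using assms by simp
  show "cc z \<noteq> 0" by (rule norm_cc(2) [OF n])
  have "norm (cV z) < 1" using norm_cV(2) [OF n] assms by simp
  then show "0 < Re (1 - cV z)" using complex_Re_le_cmod [of "cV z"] by simp
qed

lemma ball_kap_bigr: "ball (0::complex) kappa0 \<subseteq> ball 0 big_radius"
  using big_radius(1) by auto

lemma K_radius: "ereal kappa0 \<le> fps_conv_radius K"
proof (rule ccontr)
  assume "\<not> ?thesis"
  then have "fps_conv_radius K < ereal kappa0" by simp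
  then obtain r where r: "fps_conv_radius K < ereal r" "ereal r < ereal kappa0" using ereal_dense2 by blast
  define s where "s = max r (kappa0 / 2)"
  have "conv_at K s" using r kappa0(2) by (intro K_conv) (auto simp: s_def)
  then have "conv_at K r" by (rule conv_at_mono) (simp add: s_def)
  then show False using r by (simp add: conv_at_def)
qed

lemma H_radius:
  assumes "0 < y" "y \<le> tau0" shows "ereal kappa0 \<le> fps_conv_radius (H y \<theta>)"
proof (rule ccontr)
  assume "\<not> ?thesis"
  then have "fps_conv_radius (H y \<theta>) < ereal kappa0" by simp
  then obtain r where r: "fps_conv_radius (H y \<theta>) < ereal r" "ereal r < ereal kappa0" using ereal_dense2 by blast
  define s where "s = max r (kappa0 / 2)"
  have "conv_at (H y \<theta>) s" using r kappa0(2) assms by (intro H_conv) (auto simp: s_def)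
  then have "conv_at (H y \<theta>) r" by (rule conv_at_mono) (simp add: s_def)
  then show False using r by (simp add: conv_at_def)
qed

text \<open>Both sides are holomorphic on the disc and agree on a real interval.\<close>

lemma K_complex:
  assumes "z \<in> ball 0 kappa0"
  shows "z * ce K z = ce q0 z + ce n1 z * cZ z"
proof -
  let ?f = "\<lambda>z. z * ce K z - (ce q0 z + ce n1 z * cZ z)"
  have "?f z = 0"
  proof (rule analytic_continuation [of ?f "ball 0 kappa0" "of_real ` {0<..<kappa0}" "of_real (kappa0/2)"])
    show "?f holomorphic_on ball 0 kappa0"
      by (intro holomorphic_on_diff holomorphic_on_add holomorphic_on_mult holomorphic_on_ident
          ce_holomorphic [OF K_radius] holomorphic_on_subset [OF c_holomorphic(5) ball_kap_bigr]
          holomorphic_on_subset [OF c_holomorphic(6) ball_kap_bigr] cZ_holomorphic ball_kap_bigr inner_ball)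
    show "complex_of_real (kappa0/2) islimpt of_real ` {0<..<kappa0}"
      unfolding islimpt_approachable
    proof (intro allI impI)
      fix e :: real assume e: "0 < e"
      define q where "q = min e kappa0 / 4"
      have q: "0 < q" "q < e" "q < kappa0 / 2" using e kappa0(2) by (auto simp: q_def)
      have d: "dist (complex_of_real (kappa0/2 + q)) (of_real (kappa0/2)) = q"
        by (simp only: dist_of_real) (use q in \<open>simp add: dist_real_def\<close>)
      have ne: "complex_of_real (kappa0/2 + q) \<noteq> of_real (kappa0/2)"
        by (simp only: of_real_eq_iff) (use q in simp)
      show "\<exists>u\<in>of_real ` {0<..<kappa0}. u \<noteq> complex_of_real (kappa0/2) \<and> dist u (of_real (kappa0/2)) < e"
      proof
        show "complex_of_real (kappa0/2 + q) \<in> of_real ` {0<..<kappa0}" using q by (intro imageI) auto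
        show "complex_of_real (kappa0/2 + q) \<noteq> complex_of_real (kappa0/2) \<and>
            dist (complex_of_real (kappa0/2 + q)) (of_real (kappa0/2)) < e"
          by (intro conjI ne) (simp only: d q)
      qed
    qed
    fix u :: complex assume "u \<in> of_real ` {0<..<kappa0}"
    then show "?f u = 0" using K_real by auto
  qed (use assms kappa0(2) in auto)
  then show ?thesis by simp
qed

lemma ok_bigr:
  assumes "0 < y" "y < tau0"
  obtains r where "kappa0 < r" "admissible r y" "r \<le> big_radius"
proof -
  obtain s where s: "kappa0 < s" "admissible s y" using ok_enlarge [OF lv_kap(1) [OF assms]] .
  have "admissible (min s big_radius) y" using ok_mono [OF s(2), of "min s big_radius"] big_radius kappa0(2) s by auto
  then show ?thesis using that [of "min s big_radius"] s big_radius by auto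
qed

text \<open>Up to sign, the cofactor of \<open>zeta - cZ\<close> in the kernel:
  \<open>cc (1 + cW) / 2\<close> is \<open>G N\<close> times the large root.\<close>

definition cM where "cM y z = cc z * (1 + cW z) / 2 - cG z * cN z * ce (zeta y) z"

lemma zeta_complex:
  assumes "admissible r y" "norm z \<le> r"
  shows "(1 - of_real y * cN z) * ce (zeta y) z = of_real y" "1 - of_real y * cN z \<noteq> 0"
proof -
  have y: "0 < y" using assms by (simp add: admissible_def)
  have c: "conv_at (zeta y) r" "conv_at (g North North) r"
    using zeta_conv(1) [OF assms(1)] domD(1) assms(1) by (auto simp: admissible_def)
  have "ce (zeta y * (1 - fps_const y * g North North)) z = ce (fps_const y) z" by (simp only: zeta_eq)
  then show 1: "(1 - of_real y * cN z) * ce (zeta y) z = of_real y"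
    using c assms(2) by (simp add: ce_mult [of _ r] ce_diff [of _ r] conv_at_mult conv_at_diff ce_simps cN_def mult.commute)
  then show "1 - of_real y * cN z \<noteq> 0" using y by auto
qed

text \<open>On the closed disc the modulus of the first term is at least \<open>c0 / 2\<close>. The
  second stays strictly below its value at \<open>kappa0\<close> and \<open>tau0\<close>, which is
  exactly \<open>c0 / 2\<close>; strictness comes from \<open>y < tau0\<close>.\<close>

lemma cM_nonzero:
  assumes "0 < y" "y < tau0" "norm z \<le> kappa0"
  shows "cM y z \<noteq> 0"
proof -
  note o = lv_kap(1) [OF assms(1,2)] and p = ANG_pos [OF kappa0(1,2)]
  have cz: "conv_at (zeta y) kappa0" by (rule zeta_conv [OF o])
  have "norm (ce (zeta y) z) \<le> eval_fps (zeta y) (norm z)"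
    using zeta_conv(3) [OF o] conv_at_mono [OF cz assms(3)] by (rule norm_ce_le)
  also have "\<dots> \<le> eval_fps (zeta y) kappa0" using zeta_conv(3) [OF o] cz assms by (intro eval_mono) auto
  also have "\<dots> = zv kappa0 y" by (rule zeta_val [OF o])
  also have "\<dots> < zv kappa0 tau0"
  proof -
    have "y * N kappa0 < tau0 * N kappa0" using assms p by simp
    moreover have "tau0 * N kappa0 < 1" using kap_values by simp
    ultimately show ?thesis unfolding zv_def using assms by (intro frac_less) auto
  qed
  finally have z: "norm (ce (zeta y) z) < zv kappa0 tau0" .
  have "norm (cG z * cN z * ce (zeta y) z) \<le> G kappa0 * N kappa0 * norm (ce (zeta y) z)"
    unfolding norm_mult using norm_cANG [OF assms(3)] p by (intro mult_right_mono mult_mono) auto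
  also have "\<dots> < G kappa0 * N kappa0 * zv kappa0 tau0" using z p by (intro mult_strict_left_mono) auto
  also have "\<dots> = c0 / 2" by (rule ta_sqrt)
  also have "\<dots> \<le> norm (cc z * (1 + cW z) / 2)"
  proof -
    have "c0 * 1 \<le> norm (cc z) * norm (1 + cW z)"
      using norm_cc(1) [OF assms(3)] cW_facts(2) [of z] c0_eq(2) by (intro mult_mono) auto
    then show ?thesis by (simp add: norm_mult norm_divide)
  qed
  finally show ?thesis unfolding cM_def by auto
qed

text \<open>The half-plane series after cancelling the factor \<open>zeta - cZ\<close>, which is common to the numerator
  and to the kernel: so no pole arises at the zeros of the kernel.\<close>

definition cH where
  "cH y \<theta> z = ce (no_South y \<theta>) z + ce (tail y \<theta>) z * ce n1 z / ((1 - of_real y * cN z) * cM y z)"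

lemma parts_holomorphic:
  assumes "admissible r y"
  shows "ce (zeta y) holomorphic_on ball 0 r" "ce (tail y \<theta>) holomorphic_on ball 0 r"
    "ce (no_South y \<theta>) holomorphic_on ball 0 r"
  using parts_conv [OF assms] zeta_conv(1) [OF assms] by (intro ce_holomorphic conv_at_radius; simp)+

lemma cM_holomorphic:
  assumes "admissible r y" "S \<subseteq> ball 0 big_radius" "S \<subseteq> ball 0 r" "\<And>z. z \<in> S \<Longrightarrow> cc z \<noteq> 0" "\<And>z. z \<in> S \<Longrightarrow> 0 < Re (1 - cV z)"
  shows "cM y holomorphic_on S"
  unfolding cM_def [abs_def]
  by (intro holomorphic_on_diff holomorphic_on_divide holomorphic_on_mult holomorphic_on_add holomorphic_on_const
      holomorphic_on_subset [OF c_holomorphic(2)] holomorphic_on_subset [OF c_holomorphic(3)]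
      holomorphic_on_subset [OF c_holomorphic(4)] cW_holomorphic
      holomorphic_on_subset [OF parts_holomorphic(1) [OF assms(1)]] assms(2-5)) auto

lemma cH_holomorphic:
  assumes "admissible r y" "S \<subseteq> ball 0 big_radius" "S \<subseteq> ball 0 r" "\<And>z. z \<in> S \<Longrightarrow> cc z \<noteq> 0" "\<And>z. z \<in> S \<Longrightarrow> 0 < Re (1 - cV z)"
    "\<And>z. z \<in> S \<Longrightarrow> cM y z \<noteq> 0"
  shows "cH y \<theta> holomorphic_on S"
proof -
  have "1 - of_real y * cN z \<noteq> 0" if "z \<in> S" for z
    using zeta_complex(2) [OF assms(1)] that assms(3) by force
  then show ?thesis
    unfolding cH_def [abs_def] using assms(6)
    by (intro holomorphic_on_diff holomorphic_on_divide holomorphic_on_mult holomorphic_on_add holomorphic_on_const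
      holomorphic_on_subset [OF c_holomorphic(2)] holomorphic_on_subset [OF c_holomorphic(5)] cM_holomorphic [OF assms(1)]
      holomorphic_on_subset [OF parts_holomorphic(2) [OF assms(1)]]
      holomorphic_on_subset [OF parts_holomorphic(3) [OF assms(1)]] assms(2-5)) auto
qed

text \<open>Inserting the formula for \<open>K\<close> into the functional equation makes the
  right-hand side a multiple of \<open>zeta - cZ\<close>; the kernel on the left has the same
  factor.\<close>

lemma H_complex_product:
  assumes y: "0 < y" "y < tau0" and z: "z \<in> ball 0 kappa0"
  shows "(ce (zeta y) z - cZ z) * ((ce (H y \<theta>) z - ce (no_South y \<theta>) z) * (1 - of_real y * cN z) * cM y z
      - ce (tail y \<theta>) z * ce n1 z) = 0"
proof -
  define r where "r = max (norm z) (kappa0/2)"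
  have r: "0 < r" "r < kappa0" "norm z \<le> r" using z kappa0(2) by (auto simp: r_def)
  have nz: "norm z \<le> kappa0" using z by simp
  have o: "admissible r y" using ok_mono [OF lv_kap(1) [OF y]] r by simp
  have d: "conv_dom r" using o by (simp add: admissible_def)
  note pc = parts_conv [OF o] and gc = domD(1) [OF d] and zc = zeta_conv(1) [OF o] and qc = conv_q0_n1 [OF d]
  have Hc: "conv_at (H y \<theta>) r" using H_conv r y by simp
  have Kc: "conv_at K r" using K_conv r by simp
  let ?y = "complex_of_real y" and ?\<zeta> = "ce (zeta y) z"
  let ?h = "ce (H y \<theta>) z - ce (no_South y \<theta>) z"
  have "ce ((H y \<theta> - no_South y \<theta>) * (1 - loop y)) z = ce ((to_South y - unit_step y South * K) * tail y \<theta>) z"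
    by (simp only: H_eq [OF y(1)])
  then have 1: "?h * (1 - ce (loop y) z) = (ce (to_South y) z - ce (unit_step y South) z * ce K z) * ce (tail y \<theta>) z"
    using pc Hc Kc r conv_unit_step
    by (simp add: ce_mult [of _ r] ce_diff [of _ r] conv_at_mult conv_at_diff ce_simps)
  have "ce (fps_const y * loop y) z = ce (g South South + zeta y * (g South North * g North South)) z"
    by (simp only: loop_eq [OF y(1)])
  then have l: "?y * ce (loop y) z = cA z + ?\<zeta> * cG z"
    using pc gc zc r by (simp add: ce_mult [of _ r] ce_add [of _ r] conv_at_mult ce_simps cA_def cG_def)
  have "ce (fps_const y * to_South y) z = ce (q0 + n1 * zeta y) z"
    by (simp only: to_South_eq [OF y(1)])
  then have t: "?y * ce (to_South y) z = ce q0 z + ce n1 z * ?\<zeta>"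
    using pc qc zc r by (simp add: ce_mult [of _ r] ce_add [of _ r] conv_at_mult ce_simps)
  have u: "?y * ce (unit_step y South) z = z"
    using y unfolding unit_step_def by (simp add: ce_mult [of _ r] r ce_simps step_weight_def power_int_minus)
  have "?y * (?h * (1 - ce (loop y) z)) = ?y * ((ce (to_South y) z - ce (unit_step y South) z * ce K z) * ce (tail y \<theta>) z)"
    by (simp only: 1)
  then have "?h * (?y - ?y * ce (loop y) z) = (?y * ce (to_South y) z - (?y * ce (unit_step y South) z) * ce K z) * ce (tail y \<theta>) z"
    by (simp add: algebra_simps)
  then have 2: "?h * (?y - (cA z + ?\<zeta> * cG z)) = (ce q0 z + ce n1 z * ?\<zeta> - z * ce K z) * ce (tail y \<theta>) z"
    by (simp only: l t u)
  also have "\<dots> = (?\<zeta> - cZ z) * (ce (tail y \<theta>) z * ce n1 z)"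
    unfolding K_complex [OF z] by (simp add: algebra_simps)
  finally have 3: "?h * (?y - (cA z + ?\<zeta> * cG z)) = (?\<zeta> - cZ z) * (ce (tail y \<theta>) z * ce n1 z)" .
  note ze = zeta_complex(1) [OF o r(3)]
  have M: "cM y z = cc z - cG z * cN z * cZ z - cG z * cN z * ?\<zeta>"
    unfolding cM_def cZ_eq(1) [OF nz] by (simp add: field_simps)
  have A: "cA z = cc z * cZ z - cG z * cN z * (cZ z)\<^sup>2" using cZ_eq(2) [OF nz] by (simp add: algebra_simps)
  have q: "(?\<zeta> - cZ z) * cM y z = - (cG z * cN z * ?\<zeta>\<^sup>2 - cc z * ?\<zeta> + cA z)"
    unfolding M by (subst A) (simp add: algebra_simps power2_eq_square)
  \<comment> \<open>The kernel in its original form \<open>y - (A + zeta G)\<close> is the factored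
    quadratic in \<open>zeta\<close> times \<open>1 - y N\<close>.\<close>
  have "(?\<zeta> - cZ z) * ((1 - ?y * cN z) * cM y z) = (1 - ?y * cN z) * ((?\<zeta> - cZ z) * cM y z)"
    by (simp only: mult_ac)
  also have "\<dots> = (1 - ?y * cN z) * ((1 - cG z - cA z * cN z) * ?\<zeta> - cG z * cN z * ?\<zeta>\<^sup>2 - cA z)"
    unfolding q cc_def by simp
  also have "\<dots> = ((1 - ?y * cN z) * ?\<zeta>) * (1 - cG z - cA z * cN z - cG z * cN z * ?\<zeta>) - (1 - ?y * cN z) * cA z"
    by (simp add: algebra_simps power2_eq_square)
  also have "\<dots> = ?y - cA z - cG z * (?y + ?y * cN z * ?\<zeta>)"
    unfolding ze by (simp add: algebra_simps)
  also have "?y + ?y * cN z * ?\<zeta> = ?\<zeta>" using ze by (simp add: algebra_simps)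
  finally have 4: "(?\<zeta> - cZ z) * ((1 - ?y * cN z) * cM y z) = ?y - (cA z + ?\<zeta> * cG z)" by (simp add: algebra_simps)
  have "(?\<zeta> - cZ z) * (?h * (1 - ?y * cN z) * cM y z - ce (tail y \<theta>) z * ce n1 z)
     = ?h * ((?\<zeta> - cZ z) * ((1 - ?y * cN z) * cM y z)) - (?\<zeta> - cZ z) * (ce (tail y \<theta>) z * ce n1 z)"
    by (simp add: algebra_simps)
  also have "\<dots> = 0" unfolding 4 3 by simp
  finally show ?thesis .
qed

text \<open>The common factor equals \<open>y\<close> at the origin and so is nonzero nearby. The
  other factor vanishes near 0, hence on the whole disc, including points where
  \<open>zeta = cZ\<close>.\<close>

lemma H_complex:
  assumes y: "0 < y" "y < tau0" and z: "z \<in> ball 0 kappa0"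
  shows "ce (H y \<theta>) z = cH y \<theta> z"
proof -
  obtain r where r: "kappa0 < r" "admissible r y" "r \<le> big_radius" using ok_bigr [OF y] .
  have sr: "ball (0::complex) kappa0 \<subseteq> ball 0 r" using r by auto
  let ?\<phi> = "\<lambda>z. ce (zeta y) z - cZ z"
  let ?\<psi> = "\<lambda>z. (ce (H y \<theta>) z - ce (no_South y \<theta>) z) * (1 - of_real y * cN z) * cM y z - ce (tail y \<theta>) z * ce n1 z"
  have h\<phi>: "?\<phi> holomorphic_on ball 0 kappa0"
    by (intro holomorphic_on_diff cZ_holomorphic inner_ball ball_kap_bigr
        holomorphic_on_subset [OF parts_holomorphic(1) [OF r(2)] sr])
  have h\<psi>: "?\<psi> holomorphic_on ball 0 kappa0"
    by (intro holomorphic_on_diff holomorphic_on_mult holomorphic_on_const ce_holomorphic H_radius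
        holomorphic_on_subset [OF parts_holomorphic(2) [OF r(2)] sr]
        holomorphic_on_subset [OF parts_holomorphic(3) [OF r(2)] sr]
        holomorphic_on_subset [OF c_holomorphic(2) ball_kap_bigr]
        holomorphic_on_subset [OF c_holomorphic(5) ball_kap_bigr]
        cM_holomorphic [OF r(2)] ball_kap_bigr sr inner_ball) (use y in auto)
  have "?\<phi> 0 = of_real y"
  proof -
    have "inverse (1 - fps_const y * g North North) $ 0 = 1" by (simp add: g_nth_0)
    then show ?thesis by (simp add: ce_0 zeta_def cZ_def cA_def g_nth_0)
  qed
  then have n0: "?\<phi> 0 \<noteq> 0" using y by simp
  have c0: "isCont ?\<phi> 0" using kappa0(2)
    by (intro field_differentiable_imp_continuous_at holomorphic_on_imp_differentiable_at [OF h\<phi> open_ball]) simp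
  obtain d where d: "0 < d" "\<And>u. dist 0 u < d \<Longrightarrow> ?\<phi> u \<noteq> 0"
    using continuous_at_avoid [OF c0 n0] by blast
  have "?\<psi> z = 0"
  proof (rule analytic_continuation [OF h\<psi>, of "ball 0 (min d kappa0)" 0])
    show "(0::complex) islimpt ball 0 (min d kappa0)" using d kappa0(2) by (simp add: islimpt_ball)
    fix u :: complex assume "u \<in> ball 0 (min d kappa0)"
    then have "u \<in> ball 0 kappa0" "?\<phi> u \<noteq> 0" using d(2) [of u] by auto
    then show "?\<psi> u = 0" using H_complex_product [OF y, of u] by (simp add: mult_eq_0_iff)
  qed (use z kappa0(2) in auto)
  moreover have "cM y z \<noteq> 0" using cM_nonzero y z by simp
  moreover have "1 - of_real y * cN z \<noteq> 0" using zeta_complex(2) [OF r(2)] z r by simp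
  ultimately show ?thesis unfolding cH_def by (simp add: field_simps)
qed

text \<open>If \<open>cV z \<noteq> 1\<close>, then \<open>1 - cV\<close> stays in the open right
  half-plane near \<open>z\<close> and the denominators stay nonzero, so the explicit formula is
  holomorphic across the circle.\<close>

lemma H_continues:
  assumes y: "0 < y" "y < tau0" and z: "norm z = kappa0" "cV z \<noteq> 1"
  shows "\<exists>u \<delta>. 0 < \<delta> \<and> u holomorphic_on ball z \<delta> \<and> (\<forall>t\<in>ball z \<delta> \<inter> ball 0 kappa0. ce (H y \<theta>) t = u t)"
proof -
  obtain r where r: "kappa0 < r" "admissible r y" "r \<le> big_radius" using ok_bigr [OF y] .
  have zr: "z \<in> ball 0 r" using z r by simp
  have sb: "ball (0::complex) r \<subseteq> ball 0 big_radius" using r by auto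
  have c0': "cc z \<noteq> 0" using norm_cc z by simp
  have c1: "isCont cc z"
    using holomorphic_on_imp_differentiable_at [OF c_holomorphic(4) open_ball] zr sb
    by (intro field_differentiable_imp_continuous_at) auto
  obtain d1 where d1: "0 < d1" "\<And>u. dist z u < d1 \<Longrightarrow> cc u \<noteq> 0"
    using continuous_at_avoid [OF c1 c0'] by blast
  define e1 where "e1 = min d1 (r - kappa0)"
  have e1: "0 < e1" "ball z e1 \<subseteq> ball 0 r" "\<And>u. u \<in> ball z e1 \<Longrightarrow> cc u \<noteq> 0"
  proof -
    show "0 < e1" using d1 r by (simp add: e1_def)
    show "ball z e1 \<subseteq> ball 0 r"
    proof
      fix u assume "u \<in> ball z e1"
      then have "dist z u < r - kappa0" by (simp add: e1_def)
      then show "u \<in> ball 0 r" using norm_triangle_ineq2 [of u z] z by (simp add: dist_norm norm_minus_commute)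
    qed
    show "\<And>u. u \<in> ball z e1 \<Longrightarrow> cc u \<noteq> 0" using d1 by (simp add: e1_def)
  qed
  have hV: "cV holomorphic_on ball z e1" using e1 sb by (intro cV_holomorphic) auto
  have cVc: "isCont cV z"
    by (intro field_differentiable_imp_continuous_at holomorphic_on_imp_differentiable_at [OF hV open_ball])
       (use e1 in simp)
  have "isCont (\<lambda>u. 1 - cV u) z" by (intro isCont_diff continuous_const cVc)
  then have "isCont (\<lambda>u. Re (1 - cV u)) z" unfolding isCont_def by (rule tendsto_Re)
  moreover have "0 < Re (1 - cV z)" using norm_cV(3) z by simp
  ultimately have "eventually (\<lambda>u. 0 < Re (1 - cV u)) (nhds z)"
    by (metis isCont_def order_tendstoD(1) tendsto_at_iff_tendsto_nhds)
  then obtain d2 where d2: "0 < d2" "\<And>u. dist u z < d2 \<Longrightarrow> 0 < Re (1 - cV u)"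
    unfolding eventually_nhds_metric by blast
  define e2 where "e2 = min e1 d2"
  have e2: "0 < e2" "ball z e2 \<subseteq> ball 0 r" "\<And>u. u \<in> ball z e2 \<Longrightarrow> cc u \<noteq> 0" "\<And>u. u \<in> ball z e2 \<Longrightarrow> 0 < Re (1 - cV u)"
    using e1 d2 by (auto simp: e2_def dist_commute)
  have hM: "cM y holomorphic_on ball z e2" using e2 sb r by (intro cM_holomorphic [OF r(2)]) auto
  have c3: "isCont (cM y) z"
    using holomorphic_on_imp_differentiable_at [OF hM open_ball] e2
    by (intro field_differentiable_imp_continuous_at) auto
  have n3: "cM y z \<noteq> 0" using cM_nonzero y z by simp
  obtain d3 where d3: "0 < d3" "\<And>u. dist z u < d3 \<Longrightarrow> cM y u \<noteq> 0"
    using continuous_at_avoid [OF c3 n3] by blast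
  have "cH y \<theta> holomorphic_on ball z (min e2 d3)"
    by (rule cH_holomorphic [OF r(2)]) (use e2 sb d3 in auto)
  then show ?thesis using e2 d3 H_complex [OF y] by (intro exI [of _ "cH y \<theta>"] exI [of _ "min e2 d3"]) auto
qed

end

section \<open>Local expansion at \<open>\<kappa>\<close> and exclusion of other
  singularities\<close>

context vertical_rule
begin

text \<open>With \<open>p = sqrt A\<close> and \<open>q = sqrt N\<close> every critical quantity is
  rational, which reduces identities at \<open>kappa0\<close> to polynomial algebra.\<close>

lemma kap_pq:
  obtains p q where "0 < p" "0 < q" "p * q < 1" "A kappa0 = p\<^sup>2" "N kappa0 = q\<^sup>2" "G kappa0 = (1 - p * q)\<^sup>2"
    "tau0 = p / q" "c0 = 2 * p * q * (1 - p * q)"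
proof -
  define p q where "p = sqrt (A kappa0)" and "q = sqrt (N kappa0)"
  note P = ANG_pos [OF kappa0(1,2)]
  have 1: "0 < p" "0 < q" "A kappa0 = p\<^sup>2" "N kappa0 = q\<^sup>2" using P by (auto simp: p_def q_def)
  have pq: "sqrt (A kappa0 * N kappa0) = p * q" by (simp add: p_def q_def real_sqrt_mult)
  have s: "sqrt (G kappa0) = 1 - p * q" using kap_values(1) pq by simp
  have "G kappa0 = (sqrt (G kappa0))\<^sup>2" using P by simp
  then have 2: "G kappa0 = (1 - p * q)\<^sup>2" unfolding s .
  have 3: "p * q < 1" using kap_values(4) pq by simp
  have 4: "tau0 = p / q" by (simp add: tau0_def p_def q_def real_sqrt_divide)
  have "c0 = 2 * p * q * (1 - p * q)" unfolding c0_eq(1) pq s by simp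
  with 1 2 3 4 show ?thesis using that by blast
qed

definition cD where "cD z = (cc z)\<^sup>2 - 4 * cA z * cG z * cN z"

lemma cD_kap: "cc (of_real kappa0) = of_real c0" "cD (of_real kappa0) = 0"
proof -
  show 1: "cc (of_real kappa0) = of_real c0" by (simp add: c_real [OF kappa0(1)] c0_def)
  have "c0\<^sup>2 - 4 * A kappa0 * G kappa0 * N kappa0 = 0" using c0_eq(3) by (simp add: mult_ac)
  then have "complex_of_real (c0\<^sup>2 - 4 * A kappa0 * G kappa0 * N kappa0) = 0" by (simp only: of_real_0)
  then show "cD (of_real kappa0) = 0" unfolding cD_def 1 c_real [OF kappa0(1)] by simp
qed

text \<open>The kernels in \<open>zeta\<close> and in \<open>y\<close> have the same discriminant,
  \<open>bv^2 - 4 A N\<close>. Differentiating and inserting the double root,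
  \<open>bv = 2 N \<tau>\<close> and \<open>A = N \<tau>^2\<close>, leaves \<open>- 4 N\<close>
  times the derivative of the kernel in \<open>t\<close>. In particular the zero is simple.\<close>

lemma cD_deriv: "(cD has_field_derivative of_real (- 4 * N kappa0 * kt kappa0 tau0)) (at (of_real kappa0))"
proof -
  let ?k = "complex_of_real kappa0"
  have d: "(ce (g i j) has_field_derivative of_real (eval_fps (fps_deriv (g i j)) kappa0)) (at ?k)" for i j
    by (intro ce_deriv domD kappa0)
  have dA: "(cA has_field_derivative of_real (A' kappa0)) (at ?k)"
    unfolding cA_def [abs_def] A'_def by (rule d)
  have dN: "(cN has_field_derivative of_real (N' kappa0)) (at ?k)"
    unfolding cN_def [abs_def] N'_def by (rule d)
  have dG: "(cG has_field_derivative of_real (G' kappa0)) (at ?k)"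
    unfolding cG_def [abs_def]
    by (rule DERIV_cong [OF DERIV_mult [OF d d]]) (simp add: G'_def ce_g_real [OF kappa0(1)])
  define c' where "c' = - G' kappa0 - (A' kappa0 * N kappa0 + N' kappa0 * A kappa0)"
  have dc: "(cc has_field_derivative of_real c') (at ?k)"
    unfolding cc_def [abs_def]
    by (rule DERIV_cong [OF DERIV_diff [OF DERIV_diff [OF DERIV_const dG] DERIV_mult [OF dA dN]]])
       (simp add: c'_def c_real [OF kappa0(1)])
  define D' where "D' = 2 * c0 * c' - 4 * (A' kappa0 * G kappa0 * N kappa0 + G' kappa0 * A kappa0 * N kappa0 + N' kappa0 * A kappa0 * G kappa0)"
  have "((\<lambda>z. cc z * cc z - 4 * (cA z * cG z * cN z)) has_field_derivative of_real D') (at ?k)"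
    by (rule DERIV_cong [OF DERIV_diff [OF DERIV_mult [OF dc dc] DERIV_cmult [OF DERIV_mult [OF DERIV_mult [OF dA dG] dN]]]])
       (simp add: D'_def c_real(1-3) [OF kappa0(1)] cD_kap algebra_simps)
  moreover have "(\<lambda>z. cc z * cc z - 4 * (cA z * cG z * cN z)) = cD"
    by (simp add: cD_def [abs_def] power2_eq_square mult.assoc)
  moreover have "D' = - 4 * N kappa0 * kt kappa0 tau0"
  proof -
    obtain p q where pq: "0 < p" "0 < q" "p * q < 1" "A kappa0 = p\<^sup>2" "N kappa0 = q\<^sup>2" "G kappa0 = (1 - p * q)\<^sup>2"
      "tau0 = p / q" "c0 = 2 * p * q * (1 - p * q)" by (rule kap_pq)
    have "N kappa0 * kt kappa0 tau0 = N' kappa0 * p\<^sup>2 - b' kappa0 * (p * q) + A' kappa0 * q\<^sup>2"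
      unfolding kt_def pq using pq(2) by (simp add: field_simps power2_eq_square)
    then show ?thesis
      unfolding D'_def c'_def b'_def pq by (simp add: algebra_simps power2_eq_square)
  qed
  ultimately show ?thesis by simp
qed

lemma isCont_holomorphic: "f holomorphic_on S \<Longrightarrow> open S \<Longrightarrow> z \<in> S \<Longrightarrow> isCont f z"
  by (intro field_differentiable_imp_continuous_at holomorphic_on_imp_differentiable_at)

lemma ball_nonzero:
  fixes f :: "complex \<Rightarrow> complex"
  assumes "isCont f z" "f z \<noteq> 0"
  obtains d where "0 < d" "\<And>u. u \<in> ball z d \<Longrightarrow> f u \<noteq> 0"
  using continuous_at_avoid [OF assms] by (auto simp: that)

lemma ball_Re_pos:
  fixes f :: "complex \<Rightarrow> complex"
  assumes "isCont f z" "0 < Re (f z)"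
  obtains d where "0 < d" "\<And>u. u \<in> ball z d \<Longrightarrow> 0 < Re (f u)"
proof -
  have "(f \<longlongrightarrow> f z) (nhds z)"
    using assms(1) unfolding isCont_def by (simp only: tendsto_at_iff_tendsto_nhds)
  then have "((\<lambda>u. Re (f u)) \<longlongrightarrow> Re (f z)) (nhds z)" by (rule tendsto_Re)
  then have "eventually (\<lambda>u. 0 < Re (f u)) (nhds z)" using assms(2) by (rule order_tendstoD)
  then show ?thesis using that unfolding eventually_nhds_metric by (metis dist_commute mem_ball)
qed

lemma kt_kap_pos: "0 < kt kappa0 tau0"
  using kt_pos [OF is_rho_ta(2)] kv_kap_zero [of tau0] by simp

text \<open>Matches the coefficient \<open>- T be / al^2\<close> of the local expansion with the
  constant of the statement. The link is that \<open>al^2\<close> is a multiple of the kernel at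
  \<open>kappa0\<close>, hence of \<open>1 - lv\<close>.\<close>

lemma c_minus_local:
  assumes y: "0 < y" "y < tau0"
  shows "c0 / 2 - G kappa0 * N kappa0 * zv kappa0 y \<noteq> 0"
    "- (tailv \<theta> kappa0 y * n1v kappa0 / (1 - y * N kappa0)) * (sqrt (4 * kappa0 * N kappa0 * kt kappa0 tau0) / 2)
       / (c0 / 2 - G kappa0 * N kappa0 * zv kappa0 y)\<^sup>2 = c_minus R \<theta> x y"
proof -
  obtain p q where pq: "0 < p" "0 < q" "p * q < 1" "A kappa0 = p\<^sup>2" "N kappa0 = q\<^sup>2" "G kappa0 = (1 - p * q)\<^sup>2"
      "tau0 = p / q" "c0 = 2 * p * q * (1 - p * q)" by (rule kap_pq)
  note o = lv_kap [OF y]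
  define u where "u = 1 - y * N kappa0"
  define al where "al = c0 / 2 - G kappa0 * N kappa0 * zv kappa0 y"
  define k where "k = kv kappa0 y"
  define s where "s = 1 - p * q"
  have s: "0 < s" using pq by (simp add: s_def)
  have u: "0 < u" using o(1) by (simp add: admissible_def u_def)
  have k: "0 < k" using kv_sign(3) [OF o(1)] o(2) by (simp add: k_def)
  have "sqrt (N kappa0) = q" "sqrt (A kappa0) = p" using pq by simp_all
  then have kq: "k = (q * y - p)\<^sup>2" using kap_values(3) [of y] by (simp add: k_def)
  \<comment> \<open>Clearing the denominator of \<open>zv\<close> leaves a multiple of
    \<open>q y - p\<close>, whose square is the kernel at \<open>kappa0\<close>.\<close>
  have "al * u = c0 / 2 * u - G kappa0 * N kappa0 * y"
    unfolding al_def zv_def u_def [symmetric] using u by (simp add: left_diff_distrib)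
  also have "\<dots> = - (q * s * (q * y - p))"
    unfolding pq u_def s_def by (simp add: algebra_simps power2_eq_square)
  finally have alu: "al * u = - (q * s * (q * y - p))" .
  have "(al * u)\<^sup>2 = N kappa0 * G kappa0 * k" unfolding alu kq pq s_def [symmetric] by (simp add: power_mult_distrib)
  then have al2: "al\<^sup>2 = N kappa0 * G kappa0 * k / u\<^sup>2" using u by (simp add: power_mult_distrib field_simps)
  have NG: "0 < N kappa0" "0 < G kappa0" using ANG_pos [OF kappa0(1,2)] by auto
  have "al\<^sup>2 \<noteq> 0" unfolding al2 using NG k u by simp
  then show "c0 / 2 - G kappa0 * N kappa0 * zv kappa0 y \<noteq> 0" by (simp add: al_def)
  have k2: "k = - (y * u * (1 - lv kappa0 y))" unfolding k_def kv_eq [OF o(1)] u_def by (simp add: algebra_simps)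
  then have l: "1 - lv kappa0 y = - k / (y * u)" using y u by (simp add: field_simps)
  define S where "S = sqrt (kappa0 * N kappa0 * kt kappa0 tau0)"
  have S1: "sqrt (4 * kappa0 * N kappa0 * kt kappa0 tau0) / 2 = S" by (simp add: S_def real_sqrt_mult)
  have S2: "sqrt (kappa0 * kt kappa0 tau0 / N kappa0) = S / N kappa0"
  proof (rule real_sqrt_unique)
    have "S\<^sup>2 = kappa0 * N kappa0 * kt kappa0 tau0" unfolding S_def using kappa0(2) NG kt_kap_pos by simp
    then show "(S / N kappa0)\<^sup>2 = kappa0 * kt kappa0 tau0 / N kappa0" using NG by (simp add: power_divide power2_eq_square)
    show "0 \<le> S / N kappa0" unfolding S_def using kappa0(2) NG kt_kap_pos by simp
  qed
  show "- (tailv \<theta> kappa0 y * n1v kappa0 / (1 - y * N kappa0)) * (sqrt (4 * kappa0 * N kappa0 * kt kappa0 tau0) / 2)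
       / (c0 / 2 - G kappa0 * N kappa0 * zv kappa0 y)\<^sup>2 = c_minus R \<theta> x y"
    unfolding c_minus_eq [OF y] S1 S2 l al_def [symmetric] u_def [symmetric] al2
    using u k NG kappa0(2) y by (simp add: field_simps power2_eq_square)
qed

lemma c_minus_nonzero:
  assumes y: "0 < y" "y < tau0"
  shows "c_minus R \<theta> x y \<noteq> 0"
  unfolding c_minus_eq [OF y]
  using tailv_pos [OF lv_kap(1) [OF y], of \<theta>] lv_kap(2) [OF y] n1v_pos [OF kappa0(1,2)] kappa0(2) kt_kap_pos
    ANG_pos [OF kappa0(1,2)] y by simp

text \<open>Near \<open>kappa0\<close> one has \<open>cW = E s\<close> with \<open>E\<close>
  holomorphic and \<open>s\<close> the square root, so the series is \<open>T / (al + be s)\<close>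
  plus a regular term. Multiplying by \<open>al - be s\<close> separates the part even in
  \<open>s\<close> from the odd one.\<close>

lemma H_local:
  assumes y: "0 < y" "y < tau0"
  obtains g h \<epsilon> where "0 < \<epsilon>" "g holomorphic_on ball (of_real kappa0) \<epsilon>" "h holomorphic_on ball (of_real kappa0) \<epsilon>"
    "h (of_real kappa0) = of_real (c_minus R \<theta> x y)" "g (of_real kappa0) \<in> \<real>"
    "\<And>t. t \<in> ball (of_real kappa0) \<epsilon> \<inter> ball 0 kappa0 \<Longrightarrow> ce (H y \<theta>) t = g t + h t * csqrt (1 - t / of_real kappa0)"
proof -
  let ?k = "complex_of_real kappa0"
  obtain r where r: "kappa0 < r" "admissible r y" "r \<le> big_radius" using ok_bigr [OF y] .
  have sb: "ball (0::complex) r \<subseteq> ball 0 big_radius" using r by auto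
  have kr: "?k \<in> ball 0 r" using r kappa0(2) by simp
  note ch = holomorphic_on_subset [OF c_holomorphic(1) sb] holomorphic_on_subset [OF c_holomorphic(2) sb]
    holomorphic_on_subset [OF c_holomorphic(3) sb] holomorphic_on_subset [OF c_holomorphic(4) sb]
    holomorphic_on_subset [OF c_holomorphic(5) sb]
  note ph = parts_holomorphic [OF r(2)]
  have hD: "cD holomorphic_on ball 0 r" unfolding cD_def [abs_def]
    by (intro holomorphic_on_diff holomorphic_on_mult holomorphic_on_power holomorphic_on_const ch)
  obtain pd where pd: "pd holomorphic_on ball 0 r" "\<And>t. cD t = cD ?k + (t - ?k) * pd t" "pd ?k = deriv cD ?k"
    using holomorphic_divided_difference [OF hD open_ball] by metis
  define \<rho> where "\<rho> = 4 * kappa0 * N kappa0 * kt kappa0 tau0"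
  have \<rho>: "0 < \<rho>" unfolding \<rho>_def using kappa0(2) kt_kap_pos ANG_pos [OF kappa0(1,2)] by simp
  \<comment> \<open>The simple zero of the discriminant is split off as the factor
    \<open>1 - t / kappa0\<close>.\<close>
  define rr where "rr z = - ?k * pd z" for z
  have rrD: "cD t = (1 - t / ?k) * rr t" for t
    unfolding pd(2) [of t] cD_kap rr_def using kappa0(2) by (simp add: field_simps)
  have rrk: "rr ?k = of_real \<rho>"
    unfolding rr_def pd(3) DERIV_imp_deriv [OF cD_deriv] by (simp add: \<rho>_def)
  have hrr: "rr holomorphic_on ball 0 r" unfolding rr_def [abs_def]
    by (intro holomorphic_on_mult holomorphic_on_const pd(1))
  define q where "q z = rr z / (cc z)\<^sup>2" for z
  have cck: "cc ?k \<noteq> 0" using cD_kap(1) c0_eq(2) by simp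
  obtain d1 where d1: "0 < d1" "\<And>u. u \<in> ball ?k d1 \<Longrightarrow> cc u \<noteq> 0"
    using ball_nonzero [OF isCont_holomorphic [OF ch(4) open_ball kr] cck] by blast
  define e1 where "e1 = min d1 (r - kappa0)"
  have e1: "0 < e1" "ball ?k e1 \<subseteq> ball 0 r" "\<And>u. u \<in> ball ?k e1 \<Longrightarrow> cc u \<noteq> 0"
  proof -
    show "0 < e1" using d1 r by (simp add: e1_def)
    show "ball ?k e1 \<subseteq> ball 0 r"
    proof
      fix u assume "u \<in> ball ?k e1"
      then have "dist ?k u < r - kappa0" by (simp add: e1_def)
      then show "u \<in> ball 0 r" using norm_triangle_ineq2 [of u ?k] kappa0(2) by (simp add: dist_norm norm_minus_commute)
    qed
    show "\<And>u. u \<in> ball ?k e1 \<Longrightarrow> cc u \<noteq> 0" using d1 by (simp add: e1_def)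
  qed
  have hq: "q holomorphic_on ball ?k e1"
    unfolding q_def [abs_def]
    by (intro holomorphic_on_divide holomorphic_on_power holomorphic_on_subset [OF hrr e1(2)]
        holomorphic_on_subset [OF ch(4) e1(2)]) (use e1(3) in simp)
  have qk: "q ?k = of_real (\<rho> / c0\<^sup>2)" by (simp add: q_def rrk cD_kap)
  have "0 < Re (q ?k)" unfolding qk using \<rho> c0_eq(2) by (simp del: of_real_divide of_real_power)
  moreover have "isCont q ?k" by (rule isCont_holomorphic [OF hq open_ball]) (use e1 in simp)
  ultimately obtain d2 where d2: "0 < d2" "\<And>u. u \<in> ball ?k d2 \<Longrightarrow> 0 < Re (q u)"
    using ball_Re_pos by blast
  define e2 where "e2 = min e1 d2"
  have e2: "0 < e2" "ball ?k e2 \<subseteq> ball 0 r" "ball ?k e2 \<subseteq> ball ?k e1" "\<And>u. u \<in> ball ?k e2 \<Longrightarrow> 0 < Re (q u)"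
    using e1 d2 by (auto simp: e2_def)
  define E where "E z = csqrt (q z)" for z
  have hE: "E holomorphic_on ball ?k e2" unfolding E_def [abs_def]
    by (rule holomorphic_on_csqrt' [OF holomorphic_on_subset [OF hq e2(3)]]) (intro Re_pos_not_nonpos e2(4))
  have Ek: "E ?k = of_real (sqrt \<rho> / c0)"
  proof -
    have "E ?k = of_real (sqrt (\<rho> / c0\<^sup>2))"
      unfolding E_def qk using \<rho> c0_eq(2) by (subst csqrt_of_real_nonneg) (simp_all del: of_real_divide of_real_power)
    also have "sqrt (\<rho> / c0\<^sup>2) = sqrt \<rho> / c0" using c0_eq(2) by (simp add: real_sqrt_divide)
    finally show ?thesis .
  qed
  define al where "al z = cc z / 2 - cG z * cN z * ce (zeta y) z" for z
  define be where "be z = cc z * E z / 2" for z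
  define T where "T z = ce (tail y \<theta>) z * ce n1 z / (1 - of_real y * cN z)" for z
  \<comment> \<open>The product of \<open>al + be s\<close> and \<open>al - be s\<close>, which is
    free of the square root.\<close>
  define D2 where "D2 z = (al z)\<^sup>2 - (be z)\<^sup>2 * (1 - z / ?k)" for z
  have sub: "f holomorphic_on ball 0 r \<Longrightarrow> f holomorphic_on ball ?k e2" for f :: "complex \<Rightarrow> complex"
    by (rule holomorphic_on_subset [OF _ e2(2)])
  have hal: "al holomorphic_on ball ?k e2" unfolding al_def [abs_def]
    by (intro holomorphic_on_diff holomorphic_on_mult holomorphic_on_divide holomorphic_on_const sub ch ph) simp
  have hbe: "be holomorphic_on ball ?k e2" unfolding be_def [abs_def]
    by (intro holomorphic_on_mult holomorphic_on_divide holomorphic_on_const hE sub ch) simp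
  have T0: "1 - of_real y * cN z \<noteq> 0" if "z \<in> ball ?k e2" for z
    using zeta_complex(2) [OF r(2), of z] that e2(2) by force
  have hT: "T holomorphic_on ball ?k e2" unfolding T_def [abs_def]
    by (intro holomorphic_on_diff holomorphic_on_mult holomorphic_on_divide holomorphic_on_const sub ch ph T0)
  have hD2: "D2 holomorphic_on ball ?k e2" unfolding D2_def [abs_def]
    by (intro holomorphic_on_diff holomorphic_on_mult holomorphic_on_divide holomorphic_on_power
        holomorphic_on_const holomorphic_on_ident hal hbe) (use kappa0(2) in simp)
  note o = lv_kap(1) [OF y]
  have zk: "ce (zeta y) ?k = of_real (zv kappa0 y)"
    using zeta_conv(1) [OF o] kappa0(2) zeta_val [OF o] by (simp add: ce_real)
  have alk: "al ?k = of_real (c0 / 2 - G kappa0 * N kappa0 * zv kappa0 y)"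
    by (simp add: al_def cD_kap c_real(1-3) [OF kappa0(1)] zk)
  have tk: "ce (tail y \<theta>) ?k = of_real (tailv \<theta> kappa0 y)"
  proof -
    have c: "conv_at (tail y \<theta>) kappa0" by (rule parts_conv [OF o])
    have "rat_val (tail y \<theta>) kappa0 (eval_fps (tail y \<theta>) kappa0)"
      by (rule rat_val_eval) (use rat_val_parts(2) [OF o] rational_fps_iff c kappa0(2) in auto)
    then have "eval_fps (tail y \<theta>) kappa0 = tailv \<theta> kappa0 y" using rat_val_parts(2) [OF o] rat_eval_eq by metis
    then show ?thesis using c kappa0(2) by (simp add: ce_real)
  qed
  have nk: "ce n1 ?k = of_real (n1v kappa0)" using conv_q0_n1(2) [OF kappa0(1)] kappa0(2) by (simp add: ce_real n1v_def)
  have Tk: "T ?k = of_real (tailv \<theta> kappa0 y * n1v kappa0 / (1 - y * N kappa0))"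
    by (simp add: T_def tk nk c_real(1-3) [OF kappa0(1)])
  have bek: "be ?k = of_real (sqrt \<rho> / 2)" unfolding be_def Ek cD_kap using c0_eq(2) by simp
  have D2k: "D2 ?k = (al ?k)\<^sup>2" using kappa0(2) by (simp add: D2_def)
  have "D2 ?k \<noteq> 0" unfolding D2k alk using c_minus_local(1) [OF y]
    by (simp only: power_eq_0_iff of_real_eq_0_iff) simp
  moreover have "isCont D2 ?k" by (rule isCont_holomorphic [OF hD2 open_ball]) (use e2 in simp)
  ultimately obtain d3 where d3: "0 < d3" "\<And>u. u \<in> ball ?k d3 \<Longrightarrow> D2 u \<noteq> 0" using ball_nonzero by blast
  define e3 where "e3 = min e2 d3"
  have e3: "0 < e3" "ball ?k e3 \<subseteq> ball ?k e2" "\<And>u. u \<in> ball ?k e3 \<Longrightarrow> D2 u \<noteq> 0"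
    using e2 d3 by (auto simp: e3_def)
  define gg where "gg z = ce (no_South y \<theta>) z + T z * al z / D2 z" for z
  define hh where "hh z = - T z * be z / D2 z" for z
  show ?thesis
  proof (rule that [of e3 gg hh])
    show "gg holomorphic_on ball ?k e3" unfolding gg_def [abs_def]
      by (intro holomorphic_on_add holomorphic_on_mult holomorphic_on_divide holomorphic_on_subset [OF hT e3(2)]
         holomorphic_on_subset [OF hal e3(2)] holomorphic_on_subset [OF hD2 e3(2)]
         holomorphic_on_subset [OF sub [OF ph(3)] e3(2)] e3(3))
    show "hh holomorphic_on ball ?k e3" unfolding hh_def [abs_def]
      by (intro holomorphic_on_minus holomorphic_on_mult holomorphic_on_divide holomorphic_on_subset [OF hT e3(2)]
         holomorphic_on_subset [OF hbe e3(2)] holomorphic_on_subset [OF hD2 e3(2)] e3(3))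
    have "hh ?k = of_real (- (tailv \<theta> kappa0 y * n1v kappa0 / (1 - y * N kappa0)) * (sqrt \<rho> / 2)
       / (c0 / 2 - G kappa0 * N kappa0 * zv kappa0 y)\<^sup>2)"
      unfolding hh_def D2k alk Tk bek by simp
    then show "hh ?k = of_real (c_minus R \<theta> x y)" unfolding \<rho>_def c_minus_local(2) [OF y] .
    have "ce (no_South y \<theta>) ?k \<in> \<real>" using parts_conv(3) [OF o] kappa0(2) by (simp add: ce_real)
    then show "gg ?k \<in> \<real>" unfolding gg_def D2k alk Tk by simp
    fix t assume t: "t \<in> ball ?k e3 \<inter> ball 0 kappa0"
    let ?s = "csqrt (1 - t / ?k)"
    have "t \<in> ball ?k e3" using t by simp
    then have te: "t \<in> ball ?k e2" "t \<in> ball ?k e1" using e3(2) e2(3) by blast+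
    have "norm t \<le> kappa0" "t \<noteq> ?k" using t kappa0(2) by auto
    then have s1: "0 < Re (1 - t / ?k)" using Re_one_minus_pos kappa0(2) by blast
    have cct: "cc t \<noteq> 0" using e1(3) te by blast
    have "1 - cV t = cD t / (cc t)\<^sup>2" using cct by (simp add: cV_def cD_def field_simps)
    also have "\<dots> = (1 - t / ?k) * q t" unfolding rrD q_def by simp
    \<comment> \<open>Both factors lie in the right half-plane, so the principal root of the product
      splits.\<close>
    finally have W: "cW t = ?s * E t"
      unfolding cW_def E_def by (simp only: csqrt_mult_Re_pos [OF s1 e2(4) [OF te(1)]])
    have M: "cM y t = al t + be t * ?s"
      unfolding cM_def W al_def be_def by (simp add: field_simps del: csqrt.simps)
    have D2t: "D2 t = (al t + be t * ?s) * (al t - be t * ?s)"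
    proof -
      have "(al t + be t * ?s) * (al t - be t * ?s) = (al t)\<^sup>2 - (be t)\<^sup>2 * ?s\<^sup>2"
        by (simp add: algebra_simps power2_eq_square del: csqrt.simps power2_csqrt)
      then show ?thesis by (simp add: D2_def)
    qed
    have D2n: "D2 t \<noteq> 0" using e3(3) t by blast
    then have n: "al t + be t * ?s \<noteq> 0" "al t - be t * ?s \<noteq> 0" unfolding D2t by auto
    have "ce (H y \<theta>) t = ce (no_South y \<theta>) t + T t / (al t + be t * ?s)"
      using H_complex [OF y, of t \<theta>] t unfolding cH_def M T_def by simp
    also have "T t / (al t + be t * ?s) = T t * (al t - be t * ?s) / D2 t"
      unfolding D2t using n by simp
    also have "\<dots> = T t * al t / D2 t + (- T t * be t / D2 t) * ?s"
      by (simp add: diff_divide_distrib right_diff_distrib mult.assoc del: csqrt.simps)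
    finally show "ce (H y \<theta>) t = gg t + hh t * ?s" by (simp add: gg_def hh_def)
  qed (rule e3(1))
qed

text \<open>If all the series reach their maximal modulus at \<open>z\<close>, then the phases of \<open>z\<close> along closed walks
  are determined by the height alone.\<close>

lemma walk_phase:
  assumes al: "\<And>i j m. i \<in> {North, South} \<Longrightarrow> j \<in> {North, South} \<Longrightarrow> fps_nth (g i j) m \<noteq> 0
      \<Longrightarrow> \<omega> ^ m * \<eta> powi dy j * \<psi> i = \<psi> j"
    and \<eta>: "\<eta> \<noteq> (0 :: complex)"
  shows "i \<in> {North, South} \<Longrightarrow> w \<noteq> [] \<Longrightarrow> successively R (i # w) \<Longrightarrow> last w \<in> {North, South} \<Longrightarrow>
    \<omega> ^ length w * \<eta> powi end_y w * \<psi> i = \<psi> (last w)"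
proof (induction "length w" arbitrary: i w rule: less_induct)
  case less
  have "\<exists>s\<in>set w. s \<in> {North, South}" using less.prems by (intro bexI [of _ "last w"]) auto
  then obtain u j v where w: "w = u @ j # v" "j \<in> {North, South}" "\<forall>s\<in>set u. s \<notin> {North, South}"
    using split_list_first_prop [of w "\<lambda>s. s \<in> {North, South}"] by blast
  have "successively R ((i # u @ [j]) @ v)" using less.prems w by simp
  then have s1: "successively R (i # u @ [j])" using successively_append_iff by blast
  have s2: "successively R (j # v)"
  proof -
    have "successively R ((i # u) @ (j # v))" using less.prems w by simp
    then show ?thesis using successively_append_iff by blast
  qed
  have "u @ [j] \<in> taboo_walks R {North, South} i j" using s1 w(3) by (auto simp: taboo_walks_def)
  then have "0 < fps_nth (g i j) (length (u @ [j]))"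
    unfolding g_def tgf_def using x_pos by (intro walk_gf_nth_pos) auto
  then have 1: "\<omega> ^ Suc (length u) * \<eta> powi dy j * \<psi> i = \<psi> j"
    using al [OF less.prems(1) w(2), of "length (u @ [j])"] by simp
  have hu: "end_y u = 0" using w(3) by (intro end_y_horizontal) auto
  show ?case
  proof (cases "v = []")
    case True
    then show ?thesis using 1 hu w by simp
  next
    case False
    have "\<omega> ^ length v * \<eta> powi end_y v * \<psi> j = \<psi> (last v)"
      using less.hyps [of v j] less.prems w s2 False by simp
    then have "\<omega> ^ length v * \<eta> powi end_y v * (\<omega> ^ Suc (length u) * \<eta> powi dy j * \<psi> i) = \<psi> (last v)"
      unfolding 1 .
    moreover have "length w = length v + Suc (length u)" "end_y w = end_y v + dy j" "last w = last v"
      using w hu False by auto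
    ultimately show ?thesis using \<eta> by (simp add: power_add power_int_add mult_ac)
  qed
qed

text \<open>The value \<open>cV z = 1\<close> forces equality in every modulus bound, so each of the
  four series is aligned and \<open>cG\<close> and \<open>cA cN\<close> are positive. Closed walks
  of height 0 then have trivial phase; two of them with coprime lengths \<open>k\<close> and
  \<open>2 k + 1\<close> give \<open>z = kappa0\<close>.\<close>

lemma no_other_singularity:
  assumes h: "height_aperiodic R" and z: "norm z = kappa0" "z \<noteq> of_real kappa0"
  shows "cV z \<noteq> 1"
proof
  assume V: "cV z = 1"
  note P = ANG_pos [OF kappa0(1,2)]
  have zk: "norm z \<le> kappa0" using z by simp
  have e4: "4 * cA z * cG z * cN z = (cc z)\<^sup>2" using V norm_cc(2) [OF zk] by (simp add: cV_def)
  have "(norm (cc z))\<^sup>2 \<le> c0\<^sup>2" using norm_4AGN(1) [OF zk] by (simp add: e4 norm_power)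
  then have "norm (cc z) \<le> c0" by (rule power2_le_imp_le) (use c0_eq(2) in simp)
  then have nc: "norm (cc z) = c0" using norm_cc(1) [OF zk] by simp
  let ?P = "norm (cA z * cN z)" and ?G = "norm (cG z)"
  have "norm (4 * cA z * cG z * cN z) = 4 * (?P * ?G)" by (simp add: norm_mult)
  then have PG: "?P * ?G = A kappa0 * N kappa0 * G kappa0" using nc c0_eq(3) by (simp add: e4 norm_power)
  have le: "?P \<le> A kappa0 * N kappa0" "?G \<le> G kappa0" using norm_cANG [OF zk] by auto
  have max_eq: "a = a'" if "a * b = a' * b'" "a \<le> a'" "b \<le> b'" "0 \<le> a" "0 < b'" for a b a' b' :: real
  proof (rule ccontr)
    assume "a \<noteq> a'"
    then have "a * b' < a' * b'" using that by (intro mult_strict_right_mono) auto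
    moreover have "a * b \<le> a * b'" using that by (intro mult_left_mono) auto
    ultimately show False using that(1) by simp
  qed
  have eG: "?G = G kappa0" using max_eq [of ?G ?P "G kappa0" "A kappa0 * N kappa0"] PG le P by (simp add: mult_ac)
  have eP: "?P = A kappa0 * N kappa0" using max_eq [of ?P ?G "A kappa0 * N kappa0" "G kappa0"] PG le P by simp
  have "Re (cc z) \<le> c0" using complex_Re_le_cmod [of "cc z"] nc by simp
  then have "G kappa0 + A kappa0 * N kappa0 \<le> Re (cG z) + Re (cA z * cN z)" by (simp add: cc_def c0_def)
  moreover have "Re (cG z) \<le> G kappa0" "Re (cA z * cN z) \<le> A kappa0 * N kappa0"
    using complex_Re_le_cmod eG eP by metis+
  ultimately have re: "Re (cG z) = G kappa0" "Re (cA z * cN z) = A kappa0 * N kappa0" by linarith+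
  have real: "v = of_real a" if "Re v = a" "norm v = a" for v a
  proof -
    have "(Re v)\<^sup>2 + (Im v)\<^sup>2 = a\<^sup>2" using that(2) cmod_power2 [of v] by simp
    then show ?thesis using that(1) by (simp add: complex_eq_iff)
  qed
  \<comment> \<open>The real parts attain the moduli, so these products are positive reals.
    Consequently the phases of their factors are inverse to each other.\<close>
  have rG: "cG z = of_real (G kappa0)" and rP: "cA z * cN z = of_real (A kappa0 * N kappa0)"
    using real re eG eP by blast+
  have eA: "norm (cA z) = A kappa0" "norm (cN z) = N kappa0"
    using max_eq [of "norm (cA z)" "norm (cN z)" "A kappa0" "N kappa0"] max_eq [of "norm (cN z)" "norm (cA z)" "N kappa0" "A kappa0"]
      eP norm_cANG [OF zk] P by (auto simp: norm_mult mult.commute)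
  let ?a = "ce (g South North) z" and ?b = "ce (g North South) z"
  have pab: "0 < gv South North kappa0" "0 < gv North South kappa0"
    using gv_pos [OF kappa0(1,2)] g_South_North g_North_South by auto
  have lab: "norm ?a \<le> gv South North kappa0" "norm ?b \<le> gv North South kappa0"
    using norm_ce_g [OF zk] order_trans by blast+
  have "norm ?a * norm ?b = gv South North kappa0 * gv North South kappa0" using eG by (simp add: cG_def G_def norm_mult)
  then have eab: "norm ?a = gv South North kappa0" "norm ?b = gv North South kappa0"
    using max_eq [of "norm ?a" "norm ?b" "gv South North kappa0" "gv North South kappa0"]
      max_eq [of "norm ?b" "norm ?a" "gv North South kappa0" "gv South North kappa0"] lab pab by (auto simp: mult.commute)
  define \<omega> where "\<omega> = z / of_real kappa0"
  have al: "\<exists>\<sigma>. norm \<sigma> = 1 \<and> ce (g i j) z = \<sigma> * of_real (gv i j kappa0) \<and> (\<forall>m. fps_nth (g i j) m \<noteq> 0 \<longrightarrow> \<omega> ^ m = \<sigma>)"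
    if n: "norm (ce (g i j) z) = gv i j kappa0" for i j
  proof -
    have c: "conv_at (g i j) (norm z)" using domD(1) [OF kappa0(1)] z by simp
    have "norm (eval_fps (cfps (g i j)) z) = eval_fps (g i j) (norm z)" using n z by (simp add: ce_def gv_def)
    moreover have "z \<noteq> 0" using z kappa0(2) by auto
    ultimately obtain \<sigma> where "norm \<sigma> = 1" "eval_fps (cfps (g i j)) z = \<sigma> * of_real (eval_fps (g i j) (norm z))"
      "\<And>m. fps_nth (g i j) m \<noteq> 0 \<Longrightarrow> (z / of_real (norm z)) ^ m = \<sigma>"
      using eval_aligned [OF g_nonneg c] by metis
    then show ?thesis using z by (intro exI [of _ \<sigma>]) (simp add: ce_def gv_def \<omega>_def)
  qed
  obtain s1 where s1: "norm s1 = 1" "cA z = s1 * of_real (A kappa0)" "\<And>m. fps_nth (g South South) m \<noteq> 0 \<Longrightarrow> \<omega> ^ m = s1"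
    using al [of South South] eA by (auto simp: cA_def A_def)
  obtain s2 where s2: "norm s2 = 1" "cN z = s2 * of_real (N kappa0)" "\<And>m. fps_nth (g North North) m \<noteq> 0 \<Longrightarrow> \<omega> ^ m = s2"
    using al [of North North] eA by (auto simp: cN_def N_def)
  obtain s3 where s3: "norm s3 = 1" "?a = s3 * of_real (gv South North kappa0)" "\<And>m. fps_nth (g South North) m \<noteq> 0 \<Longrightarrow> \<omega> ^ m = s3"
    using al [of South North] eab by auto
  obtain s4 where s4: "norm s4 = 1" "?b = s4 * of_real (gv North South kappa0)" "\<And>m. fps_nth (g North South) m \<noteq> 0 \<Longrightarrow> \<omega> ^ m = s4"
    using al [of North South] eab by auto
  have nz: "A kappa0 \<noteq> 0" "N kappa0 \<noteq> 0" using P by auto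
  have s12: "s1 * s2 = 1" using rP nz unfolding s1(2) s2(2) by simp
  have s34: "s3 * s4 = 1" using rG pab unfolding cG_def s3(2) s4(2) G_def by simp
  \<comment> \<open>A potential on the vertical steps: the phase of a passage is a power of
    \<open>s1\<close> determined by the height, up to the change of potential between its
    ends.\<close>
  define \<psi> where "\<psi> i = (if i = North then s3 * s1 else 1)" for i
  have s1n: "s1 \<noteq> 0" using s12 by auto
  have ph: "\<omega> ^ m * s1 powi dy j * \<psi> i = \<psi> j"
    if ij: "i \<in> {North, South}" "j \<in> {North, South}" "fps_nth (g i j) m \<noteq> 0" for i j m
  proof -
    consider "i = South" "j = South" | "i = South" "j = North" | "i = North" "j = South" | "i = North" "j = North"
      using ij by auto
    then show ?thesis
    proof cases
      case 1 then show ?thesis using ij s1n s1(3) by (simp add: \<psi>_def power_int_minus)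
    next
      case 2 then show ?thesis using ij s3(3) by (simp add: \<psi>_def)
    next
      case 3
      have "s4 * inverse s1 * (s3 * s1) = (s3 * s4) * (inverse s1 * s1)" by (simp only: mult_ac)
      also have "\<dots> = 1" using s34 s1n by simp
      finally show ?thesis using 3 ij s4(3) by (simp add: \<psi>_def power_int_minus)
    next
      case 4 then show ?thesis using ij s2(3) s12 by (simp add: \<psi>_def mult_ac)
    qed
  qed
  have cyc: "\<omega> ^ length w = 1" if "w \<noteq> []" "successively R (South # w)" "last w = South" "end_y w = 0" for w
    using walk_phase [OF ph s1n, of South w] that by (simp add: \<psi>_def)
  obtain k where k: "1 \<le> k" "\<And>i j. \<exists>w. length w = k \<and> last w = j \<and> successively R (i # w) \<and> end_y w = 0"
    using h unfolding height_aperiodic_def by blast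
  have ne: "w \<noteq> []" if "length w = k" for w :: "step list" using that k(1) by auto
  obtain w0 where w0: "length w0 = k" "last w0 = South" "successively R (South # w0)" "end_y w0 = 0" using k(2) by blast
  have k1: "\<omega> ^ k = 1" using cyc [OF ne [OF w0(1)]] w0 by simp
  \<comment> \<open>A step that may precede East. Inserting one East step between two closed pieces
    adds 1 to the length and nothing to the height.\<close>
  obtain i where i: "R i East"
  proof -
    obtain w where w: "length w = k" "last w = East" "successively R (South # w)" using k(2) by blast
    have "w = butlast w @ [East]" using ne [OF w(1)] w(2) by (metis append_butlast_last_id)
    then have "successively R ((South # butlast w) @ [East])" using w(3) by (metis append_Cons)
    then have "R (last (South # butlast w)) East" unfolding successively_append_iff by simp
    then show ?thesis by (rule that)
  qed
  obtain u where u: "length u = k" "last u = i" "successively R (South # u)" "end_y u = 0" using k(2) by blast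
  obtain v where v: "length v = k" "last v = South" "successively R (East # v)" "end_y v = 0" using k(2) by blast
  have "successively R ((South # u) @ (East # v))"
    using u v i ne [OF u(1)] by (subst successively_append_iff) auto
  then have "\<omega> ^ length (u @ East # v) = 1" using u v ne [OF v(1)] by (intro cyc) auto
  then have "\<omega> ^ k * \<omega> ^ k * \<omega> = 1" using u v by (simp add: power_add mult_ac)
  then have "\<omega> = 1" using k1 by simp
  then show False using z(2) kappa0(2) by (simp add: \<omega>_def)
qed

end

section \<open>From the hypotheses on the rule to the analytic setting; the final assembly\<close>

lemma matrix_power_walk:
  "((\<lambda>M. transfer_matrix R ** M) ^^ k) (mat 1) $ i $ j \<noteq> 0 \<Longrightarrow> (k = 0 \<and> i = j) \<or> taboo_walks R {} i j \<noteq> {}"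
proof (induction k arbitrary: i)
  case 0
  then show ?case by (auto simp: mat_def split: if_splits)
next
  case (Suc k)
  let ?M = "((\<lambda>M. transfer_matrix R ** M) ^^ k) (mat 1)"
  have "(\<Sum>l\<in>UNIV. transfer_matrix R $ i $ l * ?M $ l $ j) \<noteq> 0"
    using Suc.prems by (simp add: matrix_matrix_mult_def)
  then obtain l where l: "transfer_matrix R $ i $ l * ?M $ l $ j \<noteq> 0" by (meson sum.not_neutral_contains_not_neutral)
  then have R: "R i l" by (auto simp: transfer_matrix_def split: if_splits)
  have "?M $ l $ j \<noteq> 0" using l by auto
  from Suc.IH [OF this] show ?case
  proof
    assume "k = 0 \<and> l = j"
    then have "[j] \<in> taboo_walks R {} i j" using R by (simp add: taboo_walks_def)
    then show ?thesis by blast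
  next
    assume "taboo_walks R {} l j \<noteq> {}"
    then obtain w where "w \<in> taboo_walks R {} l j" by blast
    then have "l # w \<in> taboo_walks R {} i j" using R by (simp add: taboo_walks_def)
    then show ?thesis by blast
  qed
qed

text \<open>The extracted list starts at position \<open>i + 1\<close>, because a taboo walk omits
  the step it departs from.\<close>

lemma walk_segment:
  assumes w: "w \<in> walks R" and ij: "i < j" "j < length w" and T: "\<And>k. i < k \<Longrightarrow> k < j \<Longrightarrow> w ! k \<notin> T"
  shows "taboo_walks R T (w ! i) (w ! j) \<noteq> {}"
proof -
  let ?v = "map ((!) w) [Suc i..<Suc j]"
  have s: "successively R w" using w by (simp add: walks_def)
  have "w ! i # ?v = map ((!) w) [i..<Suc j]" using ij by (simp add: upt_conv_Cons)
  moreover have "successively R (map ((!) w) [i..<Suc j])"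
    using s ij unfolding successively_conv_nth by (auto simp del: upt_Suc)
  ultimately have "successively R (w ! i # ?v)" by simp
  moreover have "?v = map ((!) w) [Suc i..<j] @ [w ! j]" using ij by simp
  moreover have "set (map ((!) w) [Suc i..<j]) \<inter> T = {}" using T by auto
  ultimately have "?v \<in> taboo_walks R T (w ! i) (w ! j)" by (simp add: taboo_walks_def)
  then show ?thesis by blast
qed

text \<open>A violation of the north-bound condition is a pair of South steps with no North between
  them, and the segment joining them is the required loop; likewise for the south-bound
  condition.\<close>

lemma vertical_rule_intro:
  assumes "aperiodic R" "vertically_unbounded R" "0 < x"
  shows "vertical_rule R x"
proof
  show "0 < x" by fact
  obtain k where k: "1 \<le> k" "\<And>i j. ((\<lambda>M. transfer_matrix R ** M) ^^ k) (mat 1) $ i $ j > 0"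
    using assms(1) unfolding aperiodic_def by blast
  show "taboo_walks R {} i j \<noteq> {}" for i j
    using matrix_power_walk [where R = R and k = k and i = i and j = j] k(1) k(2) [of i j] by auto
  have "\<not> north_bound R" "\<not> south_bound R" using assms(2) by (auto simp: vertically_unbounded_def)
  then obtain w i j where w: "w \<in> walks R" "i < j" "j < length w" "w ! i = South" "w ! j = South"
    "\<And>k. i < k \<Longrightarrow> k < j \<Longrightarrow> w ! k \<noteq> North" unfolding north_bound_def by blast
  show "taboo_walks R {North} South South \<noteq> {}" using walk_segment [OF w(1-3), of "{North}"] w(4-6) by auto
  obtain w i j where w: "w \<in> walks R" "i < j" "j < length w" "w ! i = North" "w ! j = North"
    "\<And>k. i < k \<Longrightarrow> k < j \<Longrightarrow> w ! k \<noteq> South" using \<open>\<not> south_bound R\<close> unfolding south_bound_def by blast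
  show "taboo_walks R {South} North North \<noteq> {}" using walk_segment [OF w(1-3), of "{South}"] w(4-6) by auto
qed

text \<open>With \<open>t - k = - k s^2\<close>, the error is \<open>s\<close> times
  \<open>- k s p + h - h(k)\<close>, and the second factor tends to 0.\<close>

lemma two_term_expansion:
  assumes k: "0 < k" and e: "0 < \<epsilon>"
    and hol: "g holomorphic_on ball (of_real k) \<epsilon>" "h holomorphic_on ball (of_real k) \<epsilon>"
    and f: "\<And>t. t \<in> ball (of_real k) \<epsilon> \<inter> ball 0 k \<Longrightarrow> f t = g t + h t * csqrt (1 - t / of_real k)"
  shows "(\<lambda>t. f t - (g (of_real k) + h (of_real k) * csqrt (1 - t / of_real k)))
    \<in> o[at (complex_of_real k) within ball 0 k](\<lambda>t. csqrt (1 - t / of_real k))"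
proof -
  let ?k = "complex_of_real k"
  let ?F = "at ?k within ball 0 k"
  let ?s = "\<lambda>t. csqrt (1 - t / ?k)"
  have kin: "?k \<in> ball ?k \<epsilon>" using e by simp
  obtain p where p: "p holomorphic_on ball ?k \<epsilon>" "\<And>t. g t = g ?k + (t - ?k) * p t"
    using holomorphic_divided_difference [OF hol(1) open_ball] by metis
  have cont: "(u \<longlongrightarrow> u ?k) ?F" if "u holomorphic_on ball ?k \<epsilon>" for u
  proof -
    have "isCont u ?k"
      by (intro field_differentiable_imp_continuous_at holomorphic_on_imp_differentiable_at [OF that open_ball kin])
    then show ?thesis unfolding isCont_def by (rule tendsto_within_subset) simp
  qed
  have "((\<lambda>t. sqrt (norm (1 - t / ?k))) \<longlongrightarrow> sqrt (norm (1 - ?k / ?k))) ?F"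
    using k by (intro tendsto_intros) auto
  moreover have "norm (?s t) = sqrt (norm (1 - t / ?k))" for t
  proof -
    have "(norm (?s t))\<^sup>2 = norm (1 - t / ?k)" by (simp add: norm_power [symmetric])
    then show ?thesis by (metis norm_ge_zero real_sqrt_unique)
  qed
  ultimately have "((\<lambda>t. norm (?s t)) \<longlongrightarrow> 0) ?F" using k by simp
  then have s0: "(?s \<longlongrightarrow> 0) ?F" by (rule tendsto_norm_zero_cancel)
  have near: "eventually (\<lambda>t. t \<in> ball ?k \<epsilon> \<inter> ball 0 k) ?F"
    unfolding eventually_at using e by (intro exI [of _ \<epsilon>]) (auto simp: dist_commute)
  have ne: "?s t \<noteq> 0" if "t \<in> ball 0 k" for t
  proof -
    have "t \<noteq> ?k" using that k by auto
    then show ?thesis using k by (simp add: field_simps del: csqrt.simps)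
  qed
  show ?thesis
  proof (rule smalloI_tendsto)
    show "eventually (\<lambda>t. ?s t \<noteq> 0) ?F" using near by eventually_elim (use ne in blast)
    have "((\<lambda>t. - ?k * ?s t * p t + (h t - h ?k)) \<longlongrightarrow> - ?k * 0 * p ?k + (h ?k - h ?k)) ?F"
      by (intro tendsto_intros s0 cont p hol)
    then have L: "((\<lambda>t. - ?k * ?s t * p t + (h t - h ?k)) \<longlongrightarrow> 0) ?F" by simp
    show "((\<lambda>t. (f t - (g ?k + h ?k * ?s t)) / ?s t) \<longlongrightarrow> 0) ?F"
    proof (rule Lim_transform_eventually [OF L])
      show "eventually (\<lambda>t. - ?k * ?s t * p t + (h t - h ?k) = (f t - (g ?k + h ?k * ?s t)) / ?s t) ?F"
        using near
      proof eventually_elim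
        case (elim t)
        have sq: "t - ?k = - ?k * (?s t * ?s t)"
        proof -
          have "?s t * ?s t = 1 - t / ?k" unfolding power2_eq_square [symmetric] by (rule power2_csqrt)
          then show ?thesis using k by (simp add: field_simps del: csqrt.simps)
        qed
        have "f t - (g ?k + h ?k * ?s t) = (t - ?k) * p t + (h t - h ?k) * ?s t"
          using f [OF elim] p(2) [of t] by (simp add: algebra_simps del: csqrt.simps)
        also have "\<dots> = (- ?k * ?s t * p t + (h t - h ?k)) * ?s t"
          unfolding sq by (simp add: algebra_simps del: csqrt.simps)
        finally show ?case using ne [of t] elim by (simp del: csqrt.simps)
      qed
    qed
  qed
qed

theorem lemma14:
  fixes R :: rule and \<theta> :: step and x y :: real
  assumes "aperiodic R" and "vertically_unbounded R"
    and "0 < x" and "0 < y" and "y < tau R x"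
  shows "drift_y R \<theta> x y < 0
    \<and> dominant_singularity (H_gf R \<theta> x y) (of_real (kappa R x))
    \<and> sqrt_singularity (H_gf R \<theta> x y) (of_real (kappa R x))
    \<and> (\<exists>c_star :: real.
        (\<lambda>t. eval_fps (H_gf R \<theta> x y) t
              - (of_real c_star + of_real (c_minus R \<theta> x y) * csqrt (1 - t / of_real (kappa R x))))
        \<in> o[at (of_real (kappa R x)) within ball 0 (kappa R x)](
            \<lambda>t. csqrt (1 - t / of_real (kappa R x))))
    \<and> (height_aperiodic R \<longrightarrow>
        (\<forall>z. dominant_singularity (H_gf R \<theta> x y) z \<longrightarrow> z = of_real (kappa R x))
        \<and> (\<lambda>m. Theta_plus R \<theta> x y m) \<sim>[sequentially]
            (\<lambda>m. - (c_minus R \<theta> x y / (2 * sqrt pi * real m powr (3/2))) * (1 / kappa R x) ^ m))"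
proof -
  interpret vertical_rule R x using assms by (intro vertical_rule_intro)
  have y: "0 < y" "y < tau0" using assms by (auto simp: tau_eq)
  let ?k = "complex_of_real kappa0" and ?F = "H_gf R \<theta> x y" and ?c = "c_minus R \<theta> x y"
  have F: "?F = cfps (H y \<theta>)"
    by (simp add: H_gf_def cfps_def H_def Theta_plus_def)
  have eF: "eval_fps ?F t = ce (H y \<theta>) t" for t by (simp add: F ce_def)
  have nk: "norm ?k = kappa0" using kappa0(2) by simp
  obtain g h \<epsilon> where L: "0 < \<epsilon>" "g holomorphic_on ball ?k \<epsilon>" "h holomorphic_on ball ?k \<epsilon>"
    "h ?k = of_real ?c" "g ?k \<in> \<real>"
    "\<And>t. t \<in> ball ?k \<epsilon> \<inter> ball 0 kappa0 \<Longrightarrow> ce (H y \<theta>) t = g t + h t * csqrt (1 - t / ?k)"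
    by (rule H_local [OF y, where \<theta> = \<theta>]) (rule that)
  have L6: "eval_fps ?F t = g t + h t * csqrt (1 - t / ?k)" if "t \<in> ball ?k \<epsilon> \<inter> ball 0 kappa0" for t
    unfolding eF by (rule L(6) [OF that])
  have c0: "?c \<noteq> 0" by (rule c_minus_nonzero [OF y])
  then have h0: "h ?k \<noteq> 0" using L(4) by simp
  note not_cont = sqrt_not_continuable [OF kappa0(2) L(1-3) h0 L6]
  have R1: "ereal kappa0 \<le> fps_conv_radius ?F" unfolding F using H_radius [of y \<theta>] y by simp
  \<comment> \<open>A larger radius would make the series its own continuation across
    \<open>kappa0\<close>, which the nonzero square-root term forbids.\<close>
  have R2: "fps_conv_radius ?F = ereal kappa0"
  proof (rule ccontr)
    assume "fps_conv_radius ?F \<noteq> ereal kappa0"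
    then have "ereal kappa0 < fps_conv_radius ?F" using R1 by simp
    then obtain s where s: "ereal kappa0 < ereal s" "ereal s < fps_conv_radius ?F" using ereal_dense2 by blast
    have "ball ?k (s - kappa0) \<subseteq> ball 0 s"
    proof
      fix u assume "u \<in> ball ?k (s - kappa0)"
      then show "u \<in> ball 0 s" using norm_triangle_ineq2 [of u ?k] nk by (simp add: dist_norm norm_minus_commute)
    qed
    also have "\<dots> \<subseteq> eball 0 (fps_conv_radius ?F)" using s by (intro ball_eball_mono) simp
    finally have "eval_fps ?F holomorphic_on ball ?k (s - kappa0)" by (rule holomorphic_on_eval_fps)
    then show False using not_cont s(1) by (metis diff_gt_0_iff_gt ereal_less(2) less_ereal.simps(1))
  qed
  have dominant: "dominant_singularity ?F ?k" unfolding dominant_singularity_def nk using R2 not_cont by blast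
  have sq: "sqrt_singularity ?F ?k" unfolding sqrt_singularity_def nk
    by (intro exI [of _ g] exI [of _ h] exI [of _ \<epsilon>] conjI ballI L(1-3) h0 L6)
  obtain cs where cs: "g ?k = of_real cs" using L(5) by (auto elim: Reals_cases)
  have ex: "(\<lambda>t. eval_fps ?F t - (of_real cs + of_real ?c * csqrt (1 - t / ?k)))
      \<in> o[at ?k within ball 0 kappa0](\<lambda>t. csqrt (1 - t / ?k))"
    using two_term_expansion [OF kappa0(2) L(1-3) L6] unfolding cs L(4) .
  have ha: "(\<forall>z. dominant_singularity ?F z \<longrightarrow> z = ?k) \<and> (\<lambda>m. Theta_plus R \<theta> x y m) \<sim>[sequentially]
            (\<lambda>m. - (?c / (2 * sqrt pi * real m powr (3/2))) * (1 / kappa0) ^ m)" if ha: "height_aperiodic R"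
  proof
    have other: "\<exists>u \<delta>. 0 < \<delta> \<and> u holomorphic_on ball z \<delta> \<and> (\<forall>t\<in>ball z \<delta> \<inter> ball 0 kappa0. eval_fps ?F t = u t)"
      if "norm z = kappa0" "z \<noteq> ?k" for z
      unfolding eF using H_continues [OF y that(1) no_other_singularity [OF ha that]] .
    show "\<forall>z. dominant_singularity ?F z \<longrightarrow> z = ?k"
    proof (intro allI impI)
      fix z assume z: "dominant_singularity ?F z"
      then have nz: "norm z = kappa0" using R2 by (simp add: dominant_singularity_def)
      show "z = ?k"
      proof (rule ccontr)
        assume "z \<noteq> ?k"
        then show False using other [OF nz] z unfolding dominant_singularity_def nz by blast
      qed
    qed
    define l where "l = - ?c / (2 * sqrt pi)"
    have l0: "l \<noteq> 0" using c0 by (simp add: l_def)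
    have "(\<lambda>m. fps_nth ?F m * of_real (kappa0 ^ m * real m powr (3/2))) \<longlonglongrightarrow> - h ?k / of_real (2 * sqrt pi)"
      by (rule sqrt_transfer [OF kappa0(2) R1 L(1-3) L6 other])
    moreover have "fps_nth ?F m * of_real (kappa0 ^ m * real m powr (3/2))
        = of_real (Theta_plus R \<theta> x y m * (kappa0 ^ m * real m powr (3/2)))" for m
      by (simp add: H_gf_def)
    moreover have "- h ?k / of_real (2 * sqrt pi) = of_real l" by (simp add: L(4) l_def)
    ultimately have "(\<lambda>m. complex_of_real (Theta_plus R \<theta> x y m * (kappa0 ^ m * real m powr (3/2)))) \<longlonglongrightarrow> of_real l"
      by (simp only:)
    then have "(\<lambda>m. Theta_plus R \<theta> x y m * (kappa0 ^ m * real m powr (3/2))) \<longlonglongrightarrow> l" by (simp only: tendsto_of_real_iff)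
    then have "(\<lambda>m. Theta_plus R \<theta> x y m * (kappa0 ^ m * real m powr (3/2)) / l) \<longlonglongrightarrow> l / l"
      using l0 by (intro tendsto_divide tendsto_const)
    then have lim: "(\<lambda>m. Theta_plus R \<theta> x y m * (kappa0 ^ m * real m powr (3/2)) / l) \<longlonglongrightarrow> 1" using l0 by simp
    show "(\<lambda>m. Theta_plus R \<theta> x y m) \<sim>[sequentially]
            (\<lambda>m. - (?c / (2 * sqrt pi * real m powr (3/2))) * (1 / kappa0) ^ m)"
    proof (rule asymp_equivI', rule Lim_transform_eventually [OF lim])
      show "eventually (\<lambda>m. Theta_plus R \<theta> x y m * (kappa0 ^ m * real m powr (3/2)) / l
          = Theta_plus R \<theta> x y m / (- (?c / (2 * sqrt pi * real m powr (3/2))) * (1 / kappa0) ^ m)) sequentially"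
        using eventually_gt_at_top [of 0]
      proof eventually_elim
        case (elim m)
        have "- (?c / (2 * sqrt pi * real m powr (3/2))) * (1 / kappa0) ^ m = l / (kappa0 ^ m * real m powr (3/2))"
          by (simp add: l_def power_divide)
        then show ?case by simp
      qed
    qed
  qed
  show ?thesis unfolding kappa_eq
    using drift_neg [OF y] dominant sq ex ha by blast
qed

end
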